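(* Let $n\geqslant4$, $m=\lfloor\frac{n-1}{2}\rfloor$, $F=\lfloor\frac{n+1}{2}\rfloor$ and $G=\lfloor\frac n2\rfloor$. Let $\bar B'=\{h,x,e_2,\ldots,e_F,x_1,\ldots,x_m,y_1,\ldots,y_m\}$ be an alphabet and let $\bar V'$ consist of the following monoid relations on $\bar B'^*$: $(V'_1)$ $e_i^2=e_i$, for $2\leqslant i\leqslant F$; $(V'_2)$ $(xh)^2x=x$; $(V'_3)$ $xhx^2hxh=hxhx^2hx$; $(V'_4)$ $e_ie_j=e_je_i$, for $2\leqslant i<j\leqslant F$; $e_ihe_jh=he_jhe_i$, for $2\leqslant i\leqslant F$ and $2\leqslant j\leqslant G$; $(V'_5)$ $(xh)^2e_i=e_i(xh)^2$ and $(hx)^2e_i=e_i(hx)^2$, for $2\leqslant i\leqslant F$; $(V'_6)$ $xe_{i+1}=e_ix$, for $2\leqslant i\leqslant m$; $xhe_Gh=e_Fx$; $xhe_ih=he_{i+1}hx$, for $2\leqslant i\leqslant\lfloor\frac{n-2}{2}\rfloor$; $(V'_7)$ $x(xh)^2=he_2hx$ and $(hx)^2x=xe_2$; $(V'_8)$ $(hx)^2e_2\cdots e_Fhe_2\cdots e_G(hx)^2=xe_2\cdots e_Fhe_2\cdots e_G(hx)^2$; $(V'_9)$ $x_iy_i=e_2\cdots e_ie_{i+2}\cdots e_Fhe_2\cdots e_Gh(xh)^2$, for $1\leqslant i\leqslant m$; $y_1x_1=e_2\cdots e_Fhe_2\cdots e_Gh$; $y_ix_i=e_2\cdots e_Fhe_2\cdots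 e_{i-1}e_{i+1}\cdots e_Gh(xh)^2$, for $2\leqslant i\leqslant m$; $(V'_{10})$ $x_ie_j=x_i$ and $e_jy_i=y_i$, for $1\leqslant i\leqslant m$ and $2\leqslant j\leqslant F$; $x_ihe_jh=x_i$ and $he_jhy_i=y_i$, for $1\leqslant i\leqslant m$, $2\leqslant j\leqslant G$, $j\neq i$; $(V'_{11})$ $e_jx_i=x_i$ and $y_ie_j=y_i$, for $1\leqslant i\leqslant m$, $2\leqslant j\leqslant F$, $j\neq i+1$; $he_jhx_i=x_i$ and $y_ihe_jh=y_i$, for $1\leqslant i\leqslant m$ and $2\leqslant j\leqslant G$; $(V'_{12})$ $x_i(xh)^2=(xh)^2x_i=x_i$ and $(xh)^2y_i=y_i(xh)^2=y_i$, for $2\leqslant i\leqslant m$; $(xh)^2x_1=x_1$ and $y_1(xh)^2=y_1$; $(V'_{13})$ $(hx)^2x_1=x_1(hx)^2=x^{n-2}he_2h$; $(hx)^2x_i=x_i(hx)^2=x^{n-2i}e_{n-2i+1}\cdots e_Fhe_2\cdots e_{i-1}e_{i+1}\cdots e_Gh(xh)^2$, for $2\leqslant i\leqslant m$; $(hx)^2y_i=y_i(hx)^2=hx^{n-2i+1}hxe_2\cdots e_ie_{i+2}\cdots e_Fhe_{n-2i+1}\cdots e_Gh$, for $1\leqslant i\leqslant m$; $(V'_{14})$ $x_1(xh)^2=e_2x_1=y_1e_2=(xh)^2y_1=e_2\cdots e_Fhe_2\cdots e_Gh(xh)^2$; $x_ihe_ih=e_{i+1}x_i=y_ie_{i+1}=he_ihy_i=e_2\cdots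 e_Fhe_2\cdots e_Gh(xh)^2$, for $2\leqslant i\leqslant m$; $(\bar V'_0)$ $h^2=1$; $(\bar V'_1)$ $he_F=e_Fh$, if $n$ is odd; $hx_i=hx^{n-i-1}hx_ix^{i-1}h$ and $hy_i=hx^{i-1}hy_ix^{n-i-1}h$, for $1\leqslant i\leqslant m$; $(\bar V'_2)$ $e_2\cdots e_Fhe_2\cdots e_G(hx)^2=x^{n-1}$. Then the monoid $\mathcal{MDI}_n$ is defined by the presentation $\langle\bar B'\mid\bar V'\rangle$ on $2+3\lfloor\frac{n-1}{2}\rfloor$ generators and $2n^2+\frac{7-(-1)^n}{4}n-2(-1)^n-1$ relations.
   Context: Let $\Omega_n=\{1<2<\cdots<n\}$. $\mathcal{I}_n$ is the symmetric inverse monoid of all partial permutations (injective partial maps) of $\Omega_n$ under composition; maps act on the right, so $\alpha\beta$ means first $\alpha$, then $\beta$. Let $g$ be the permutation $i\mapsto i+1$ ($1\leqslant i\leqslant n-1$), $n\mapsto 1$, and $h$ the permutation $i\mapsto n+1-i$; they generate the dihedral group $\mathcal{D}_{2n}$ of order $2n$ inside the symmetric group on $\Omega_n$. The dihedral inverse monoid $\mathcal{DI}_n$ is the submonoid of $\mathcal{I}_n$ of all restrictions (to arbitrary subsets of $\Omega_n$) of elements of $\mathcal{D}_{2n}$. An $\alpha\in\mathcal{I}_n$ is order-preserving [order-reversing] if $a\leqslant b$ implies $a\alpha\leqslant b\alpha$ [$a\alpha\geqslant b\alpha$] for all $a,b\in\mathrm{Dom}(\alpha)$, and monotone if it is order-preserving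 or order-reversing. $\mathcal{MDI}_n$ is the monoid of all monotone elements of $\mathcal{DI}_n$. A monoid $M$ is defined by a presentation $\langle\bar B'\mid\bar V'\rangle$, where $\bar V'\subseteq\bar B'^*\times\bar B'^*$, if $M\cong\bar B'^*/\rho$, where $\rho$ is the smallest congruence on the free monoid $\bar B'^*$ containing $\bar V'$. Conventions: $1$ denotes the empty word, and $u^0=1$; $e_a\cdots e_b$ denotes the product of the letters $e_k$, $a\leqslant k\leqslant b$, in increasing order of index, and is the empty word if $a>b$.
   Formalization: The stated number of relations is wrong for the displayed list (n=4: 32 relations listed, formula gives 35; n=5: 67 against 61); the formal theorem instead proves the count 19n²/8 − (1+9(−1)^n)n/8 + (13−29(−1)^n)/16. *)

theory Defs
  imports Complex_Main "HOL-Algebra.Sym_Groups"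
begin

section \<open>Monotone partial permutations in the dihedral inverse monoid\<close>

definition sym_inv_monoid :: "nat \<Rightarrow> (nat \<rightharpoonup> nat) monoid" where
  "sym_inv_monoid n =
    \<lparr> carrier = {\<alpha>. dom \<alpha> \<subseteq> {1..n} \<and> ran \<alpha> \<subseteq> {1..n} \<and> inj_on \<alpha> (dom \<alpha>)},
      mult = (\<lambda>\<alpha> \<beta>. \<beta> \<circ>\<^sub>m \<alpha>),  \<comment> \<open>maps act on the right: first \<open>\<alpha>\<close>, then \<open>\<beta>\<close>\<close>
      one = (\<lambda>i. if i \<in> {1..n} then Some i else None) \<rparr>"

definition rot :: "nat \<Rightarrow> nat \<Rightarrow> nat" where
  "rot n i = (if 1 \<le> i \<and> i < n then i + 1 else if i = n then 1 else i)"

definition flip :: "nat \<Rightarrow> nat \<Rightarrow> nat" where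
  "flip n i = (if i \<in> {1..n} then n + 1 - i else i)"

text \<open>The product of \<^term>\<open>sym_group n\<close> composes from right to left; this does not affect which
  permutations the two generators generate.\<close>

definition dihedral :: "nat \<Rightarrow> (nat \<Rightarrow> nat) set" where
  "dihedral n = generate (sym_group n) {rot n, flip n}"

definition DI :: "nat \<Rightarrow> (nat \<rightharpoonup> nat) set" where
  "DI n = {\<alpha>. \<exists>\<sigma>\<in>dihedral n. \<exists>A\<subseteq>{1..n}. \<alpha> = (\<lambda>i. if i \<in> A then Some (\<sigma> i) else None)}"

definition order_preserving :: "(nat \<rightharpoonup> nat) \<Rightarrow> bool" where
  "order_preserving \<alpha> \<longleftrightarrow> (\<forall>a\<in>dom \<alpha>. \<forall>b\<in>dom \<alpha>. a \<le> b \<longrightarrow> the (\<alpha> a) \<le> the (\<alpha> b))"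

definition order_reversing :: "(nat \<rightharpoonup> nat) \<Rightarrow> bool" where
  "order_reversing \<alpha> \<longleftrightarrow> (\<forall>a\<in>dom \<alpha>. \<forall>b\<in>dom \<alpha>. a \<le> b \<longrightarrow> the (\<alpha> a) \<ge> the (\<alpha> b))"

definition MDI :: "nat \<Rightarrow> (nat \<rightharpoonup> nat) monoid" where
  "MDI n = (sym_inv_monoid n)
     \<lparr> carrier := {\<alpha> \<in> DI n. order_preserving \<alpha> \<or> order_reversing \<alpha>} \<rparr>"


section \<open>Monoid presentations\<close>

text \<open>Words over an alphabet \<open>A\<close> are the elements of \<^term>\<open>lists A\<close>, multiplied by \<^term>\<open>(@)\<close>.\<close>

definition word_congruence :: "'a set \<Rightarrow> ('a list \<times> 'a list) set \<Rightarrow> bool" where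
  "word_congruence A \<rho> \<longleftrightarrow> equiv (lists A) \<rho> \<and>
     (\<forall>(u, v)\<in>\<rho>. \<forall>w\<in>lists A. (w @ u, w @ v) \<in> \<rho> \<and> (u @ w, v @ w) \<in> \<rho>)"

definition generated_congruence :: "'a set \<Rightarrow> ('a list \<times> 'a list) set \<Rightarrow> ('a list \<times> 'a list) set" where
  "generated_congruence A R = \<Inter>{\<rho>. word_congruence A \<rho> \<and> R \<subseteq> \<rho>}"

definition word_quotient :: "'a set \<Rightarrow> ('a list \<times> 'a list) set \<Rightarrow> 'a list set monoid" where
  "word_quotient A \<rho> =
    \<lparr> carrier = lists A // \<rho>,
      mult = (\<lambda>P Q. \<Union>u\<in>P. \<Union>v\<in>Q. \<rho> `` {u @ v}),
      one = \<rho> `` {[]} \<rparr>"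

definition defined_by_presentation ::
    "('m, 'b) monoid_scheme \<Rightarrow> 'a set \<Rightarrow> ('a list \<times> 'a list) set \<Rightarrow> bool" where
  "defined_by_presentation M A R \<longleftrightarrow>
     R \<subseteq> lists A \<times> lists A \<and> M \<cong> word_quotient A (generated_congruence A R)"


section \<open>The presentation\<close>

text \<open>\<open>LX\<close> is the letter \<open>x\<close>, whereas \<open>LXi i\<close> and \<open>LYi i\<close> are \<open>x\<^sub>i\<close> and \<open>y\<^sub>i\<close>.
  A word is a list of letters, and \<open>w\<^sup>k\<close> for a single letter is \<^const>\<open>replicate\<close>.\<close>

datatype letter = LH | LX | LE nat | LXi nat | LYi nat

type_synonym word_relations = "(letter list \<times> letter list) set"

abbreviation (input) mN :: "nat \<Rightarrow> nat" where "mN n \<equiv> (n - 1) div 2"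
abbreviation (input) FN :: "nat \<Rightarrow> nat" where "FN n \<equiv> (n + 1) div 2"
abbreviation (input) GN :: "nat \<Rightarrow> nat" where "GN n \<equiv> n div 2"

definition alphabet :: "nat \<Rightarrow> letter set" where
  "alphabet n = {LH, LX} \<union> LE ` {2..FN n} \<union> LXi ` {1..mN n} \<union> LYi ` {1..mN n}"

text \<open>\<open>es a b\<close> is \<open>e\<^sub>a \<cdots> e\<^sub>b\<close>, the empty word if \<open>a > b\<close>.\<close>

definition es :: "nat \<Rightarrow> nat \<Rightarrow> letter list" where
  "es a b = map LE [a..<Suc b]"

abbreviation (input) xh2 :: "letter list" where "xh2 \<equiv> [LX, LH, LX, LH]"
abbreviation (input) hx2 :: "letter list" where "hx2 \<equiv> [LH, LX, LH, LX]"

text \<open>A chain \<open>u\<^sub>1 = \<cdots> = u\<^sub>k = v\<close> is rendered by the \<open>k\<close> pairs \<open>(u\<^sub>i, v)\<close>.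
  All subtractions of natural numbers below are exact for the indices in question.\<close>

definition V1 :: "nat \<Rightarrow> word_relations" where
  "V1 n = {([LE i, LE i], [LE i]) | i. i \<in> {2..FN n}}"

definition V2 :: "word_relations" where
  "V2 = {(xh2 @ [LX], [LX])}"

definition V3 :: "word_relations" where
  "V3 = {([LX, LH, LX, LX, LH, LX, LH], [LH, LX, LH, LX, LX, LH, LX])}"

definition V4 :: "nat \<Rightarrow> word_relations" where
  "V4 n =
     {([LE i, LE j], [LE j, LE i]) | i j. i \<in> {2..FN n} \<and> j \<in> {2..FN n} \<and> i < j} \<union>
     {([LE i, LH, LE j, LH], [LH, LE j, LH, LE i]) | i j. i \<in> {2..FN n} \<and> j \<in> {2..GN n}}"

definition V5 :: "nat \<Rightarrow> word_relations" where
  "V5 n =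
     {(xh2 @ [LE i], [LE i] @ xh2) | i. i \<in> {2..FN n}} \<union>
     {(hx2 @ [LE i], [LE i] @ hx2) | i. i \<in> {2..FN n}}"

definition V6 :: "nat \<Rightarrow> word_relations" where
  "V6 n =
     {([LX, LE (i + 1)], [LE i, LX]) | i. i \<in> {2..mN n}} \<union>
     {([LX, LH, LE (GN n), LH], [LE (FN n), LX])} \<union>
     {([LX, LH, LE i, LH], [LH, LE (i + 1), LH, LX]) | i. i \<in> {2..(n - 2) div 2}}"

definition V7 :: "word_relations" where
  "V7 =
     {([LX] @ xh2, [LH, LE 2, LH, LX]),
      (hx2 @ [LX], [LX, LE 2])}"

definition V8 :: "nat \<Rightarrow> word_relations" where
  "V8 n =
     {(hx2 @ es 2 (FN n) @ [LH] @ es 2 (GN n) @ hx2,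
       [LX] @ es 2 (FN n) @ [LH] @ es 2 (GN n) @ hx2)}"

definition V9 :: "nat \<Rightarrow> word_relations" where
  "V9 n =
     {([LXi i, LYi i], es 2 i @ es (i + 2) (FN n) @ [LH] @ es 2 (GN n) @ [LH] @ xh2)
       | i. i \<in> {1..mN n}} \<union>
     {([LYi 1, LXi 1], es 2 (FN n) @ [LH] @ es 2 (GN n) @ [LH])} \<union>
     {([LYi i, LXi i], es 2 (FN n) @ [LH] @ es 2 (i - 1) @ es (i + 1) (GN n) @ [LH] @ xh2)
       | i. i \<in> {2..mN n}}"

definition V10 :: "nat \<Rightarrow> word_relations" where
  "V10 n =
     {([LXi i, LE j], [LXi i]) | i j. i \<in> {1..mN n} \<and> j \<in> {2..FN n}} \<union>
     {([LE j, LYi i], [LYi i]) | i j. i \<in> {1..mN n} \<and> j \<in> {2..FN n}} \<union>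
     {([LXi i, LH, LE j, LH], [LXi i]) | i j. i \<in> {1..mN n} \<and> j \<in> {2..GN n} \<and> j \<noteq> i} \<union>
     {([LH, LE j, LH, LYi i], [LYi i]) | i j. i \<in> {1..mN n} \<and> j \<in> {2..GN n} \<and> j \<noteq> i}"

definition V11 :: "nat \<Rightarrow> word_relations" where
  "V11 n =
     {([LE j, LXi i], [LXi i]) | i j. i \<in> {1..mN n} \<and> j \<in> {2..FN n} \<and> j \<noteq> i + 1} \<union>
     {([LYi i, LE j], [LYi i]) | i j. i \<in> {1..mN n} \<and> j \<in> {2..FN n} \<and> j \<noteq> i + 1} \<union>
     {([LH, LE j, LH, LXi i], [LXi i]) | i j. i \<in> {1..mN n} \<and> j \<in> {2..GN n}} \<union>
     {([LYi i, LH, LE j, LH], [LYi i]) | i j. i \<in> {1..mN n} \<and> j \<in> {2..GN n}}"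

definition V12 :: "nat \<Rightarrow> word_relations" where
  "V12 n =
     {([LXi i] @ xh2, [LXi i]) | i. i \<in> {2..mN n}} \<union>
     {(xh2 @ [LXi i], [LXi i]) | i. i \<in> {2..mN n}} \<union>
     {(xh2 @ [LYi i], [LYi i]) | i. i \<in> {2..mN n}} \<union>
     {([LYi i] @ xh2, [LYi i]) | i. i \<in> {2..mN n}} \<union>
     {(xh2 @ [LXi 1], [LXi 1]), ([LYi 1] @ xh2, [LYi 1])}"

definition V13_x1 :: "nat \<Rightarrow> letter list" where
  "V13_x1 n = replicate (n - 2) LX @ [LH, LE 2, LH]"

definition V13_x :: "nat \<Rightarrow> nat \<Rightarrow> letter list" where
  "V13_x n i = replicate (n - 2 * i) LX @ es (n - 2 * i + 1) (FN n) @ [LH] @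
     es 2 (i - 1) @ es (i + 1) (GN n) @ [LH] @ xh2"

definition V13_y :: "nat \<Rightarrow> nat \<Rightarrow> letter list" where
  "V13_y n i = [LH] @ replicate (n - 2 * i + 1) LX @ [LH, LX] @
     es 2 i @ es (i + 2) (FN n) @ [LH] @ es (n - 2 * i + 1) (GN n) @ [LH]"

definition V13 :: "nat \<Rightarrow> word_relations" where
  "V13 n =
     {(hx2 @ [LXi 1], V13_x1 n), ([LXi 1] @ hx2, V13_x1 n)} \<union>
     {(hx2 @ [LXi i], V13_x n i) | i. i \<in> {2..mN n}} \<union>
     {([LXi i] @ hx2, V13_x n i) | i. i \<in> {2..mN n}} \<union>
     {(hx2 @ [LYi i], V13_y n i) | i. i \<in> {1..mN n}} \<union>
     {([LYi i] @ hx2, V13_y n i) | i. i \<in> {1..mN n}}"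

definition V14_rhs :: "nat \<Rightarrow> letter list" where
  "V14_rhs n = es 2 (FN n) @ [LH] @ es 2 (GN n) @ [LH] @ xh2"

definition V14 :: "nat \<Rightarrow> word_relations" where
  "V14 n =
     {([LXi 1] @ xh2, V14_rhs n), ([LE 2, LXi 1], V14_rhs n),
      ([LYi 1, LE 2], V14_rhs n), (xh2 @ [LYi 1], V14_rhs n)} \<union>
     {([LXi i, LH, LE i, LH], V14_rhs n) | i. i \<in> {2..mN n}} \<union>
     {([LE (i + 1), LXi i], V14_rhs n) | i. i \<in> {2..mN n}} \<union>
     {([LYi i, LE (i + 1)], V14_rhs n) | i. i \<in> {2..mN n}} \<union>
     {([LH, LE i, LH, LYi i], V14_rhs n) | i. i \<in> {2..mN n}}"

definition Vbar0 :: "word_relations" where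
  "Vbar0 = {([LH, LH], [])}"

definition Vbar1 :: "nat \<Rightarrow> word_relations" where
  "Vbar1 n =
     (if odd n then {([LH, LE (FN n)], [LE (FN n), LH])} else {}) \<union>
     {([LH, LXi i],
       [LH] @ replicate (n - i - 1) LX @ [LH, LXi i] @ replicate (i - 1) LX @ [LH])
       | i. i \<in> {1..mN n}} \<union>
     {([LH, LYi i],
       [LH] @ replicate (i - 1) LX @ [LH, LYi i] @ replicate (n - i - 1) LX @ [LH])
       | i. i \<in> {1..mN n}}"

definition Vbar2 :: "nat \<Rightarrow> word_relations" where
  "Vbar2 n = {(es 2 (FN n) @ [LH] @ es 2 (GN n) @ hx2, replicate (n - 1) LX)}"

definition relations :: "nat \<Rightarrow> word_relations" where
  "relations n =
     V1 n \<union> V2 \<union> V3 \<union> V4 n \<union> V5 n \<union> V6 n \<union> V7 \<union> V8 n \<union> V9 n \<union> V10 n \<union> V11 n \<union>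
     V12 n \<union> V13 n \<union> V14 n \<union> Vbar0 \<union> Vbar1 n \<union> Vbar2 n"

end

theory Submission
  imports Defs
begin

text \<open>Put \<open>y = hxh\<close>. The elements \<open>E\<^sub>1 = (hx)\<^sup>2\<close>, \<open>E\<^sub>n = (xh)\<^sup>2\<close>, \<open>E\<^sub>j = e\<^sub>j\<close> and \<open>E\<^bsub>n+1-j\<^esub> = h e\<^sub>j h\<close>
  satisfy the relations of the idempotents \<open>id - {(j, j)}\<close>: they commute, \<open>h E\<^sub>j = E\<^bsub>n+1-j\<^esub> h\<close>,
  \<open>x E\<^bsub>j+1\<^esub> = E\<^sub>j x\<close>, \<open>x y = E\<^sub>n\<close> and \<open>y x = E\<^sub>1\<close>. Write \<open>Z\<^sub>i = x\<^sub>i\<close> for \<open>i \<le> m\<close> and \<open>Z\<^sub>i = y\<^bsub>n-i\<^esub>\<close> for \<open>n - m \<le> i\<close>;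
  in both cases \<open>Z\<^sub>i\<close> is the map with \<open>1 \<mapsto> 1\<close> and \<open>i + 1 \<mapsto> n + 1 - i\<close>. An order-preserving element of
  \<open>MDI\<close> is either a restricted translation, given by a product of some \<open>E\<^sub>j\<close> and a power of \<open>x\<close> or \<open>y\<close>, or a
  restricted reflection of rank two, given by \<open>y\<^sup>p Z\<^sub>i x\<^sup>q\<close>; the order-reversing elements are
  these times \<open>h\<close>. The relations rewrite the product of such a normal form and a letter into a
  normal form, because a product \<open>E\<^sub>j Z\<^sub>i\<close> or \<open>Z\<^sub>i E\<^sub>j\<close> is \<open>Z\<^sub>i\<close> or a translation of rank at most one. Two normal forms that define the same map have equal values: for rank at least two
  the map determines the parameters, and in rank at most one the relations \<open>(V'\<^sub>8)\<close> and
  \<open>(\<bar>V'\<^sub>2)\<close> absorb the factor \<open>h\<close>.\<close>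


section \<open>Consequences of the relations: idempotents and shifts\<close>

definition E_word :: "nat \<Rightarrow> nat \<Rightarrow> letter list" where
  "E_word n j = (if j = 1 then hx2 else if j = n then xh2 else if j \<le> FN n then [LE j]
     else [LH, LE (n + 1 - j), LH])"

definition P_word :: "nat \<Rightarrow> nat set \<Rightarrow> letter list" where
  "P_word n A = concat (map (E_word n) (sorted_list_of_set A))"

definition y_word :: "nat \<Rightarrow> letter list" where
  "y_word k = [LH] @ replicate k LX @ [LH]"

definition Z_word :: "nat \<Rightarrow> nat \<Rightarrow> letter list" where
  "Z_word n i = [if i \<le> mN n then LXi i else LYi (n - i)]"

text \<open>The case \<open>2i = n\<close> is excluded: there \<open>1 \<mapsto> 1\<close>, \<open>i + 1 \<mapsto> n + 1 - i\<close> is a translation.\<close>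

definition Z_index :: "nat \<Rightarrow> nat set" where
  "Z_index n = {i. 1 \<le> i \<and> i < n \<and> 2 * i \<noteq> n}"

lemma mult_left_ext:
  fixes a b c t :: "'a :: monoid_mult"
  assumes "a * b = c"
  shows "a * (b * t) = c * t"
  by (simp add: assms flip: mult.assoc)

locale relation_model =
  fixes n :: nat and val :: "letter \<Rightarrow> 'a :: monoid_mult"
  assumes n4: "4 \<le> n"
    and rel: "(u, v) \<in> relations n \<Longrightarrow> prod_list (map val u) = prod_list (map val v)"
begin

abbreviation "ev w \<equiv> prod_list (map val w)"
abbreviation "h \<equiv> val LH"
abbreviation "x \<equiv> val LX"
abbreviation "e i \<equiv> val (LE i)"

definition y where "y = h * x * h"
definition E where "E j = ev (E_word n j)"
definition Z where "Z i = ev (Z_word n i)"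
definition Es where "Es l = prod_list (map E l)"
definition PE where "PE A = ev (P_word n A)"

lemma PE_Es: "PE A = Es (sorted_list_of_set A)"
proof -
  have "ev (concat (map (E_word n) l)) = Es l" for l
    by (induction l) (auto simp: Es_def E_def)
  then show ?thesis by (simp add: PE_def P_word_def)
qed

lemma hh [simp]: "h * h = 1"
  using rel[of "[LH, LH]" "[]"] by (simp add: relations_def Vbar0_def)
lemma hh' [simp]: "h * (h * t) = t"
  by (simp flip: mult.assoc)

lemma h_cancel: "h * a = h * b \<Longrightarrow> a = b"
  by (metis hh')

lemma xyx: "x * (h * (x * (h * x))) = x"
  using rel[of "xh2 @ [LX]" "[LX]"] by (simp add: relations_def V2_def)
lemma E_1: "E 1 = y * x"
  by (simp add: E_def E_word_def y_def mult.assoc)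
lemma E_n: "E n = x * y"
  using n4 by (simp add: E_def E_word_def y_def mult.assoc)
lemma E_low: "2 \<le> j \<Longrightarrow> j \<le> FN n \<Longrightarrow> E j = e j"
  using n4 by (cases "j = n") (simp_all add: E_def E_word_def)
lemma E_high: "FN n < j \<Longrightarrow> j < n \<Longrightarrow> E j = h * e (n + 1 - j) * h"
  using n4 by (cases "j = 1") (simp_all add: E_def E_word_def mult.assoc)
lemma E_high': "2 \<le> j \<Longrightarrow> j \<le> GN n \<Longrightarrow> E (n + 1 - j) = h * e j * h"
  using n4 by (subst E_high) auto

lemma hx: "h * x = y * h" and hy: "h * y = x * h"
  by (simp_all add: y_def mult.assoc)

lemma h_pow_x: "h * x ^ k = y ^ k * h"
  by (induction k) (simp, metis power_Suc mult.assoc hx)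

lemma h_pow_y: "h * y ^ k = x ^ k * h"
  by (induction k) (simp, metis power_Suc mult.assoc hy)

lemma ev_y_word: "ev (y_word k) = y ^ k"
proof -
  have "h * (x ^ k * h) = y ^ k"
    using h_pow_x[of k] by (metis hh mult.assoc mult_1_right)
  then show ?thesis by (simp add: y_word_def)
qed

lemma hE: assumes "j \<in> {1..n}" shows "h * E j = E (n + 1 - j) * h"
proof -
  have odd_case: "h * e (FN n) = e (FN n) * h" if "odd n"
    using rel[of "[LH, LE (FN n)]" "[LE (FN n), LH]"] that
    by (simp add: relations_def Vbar1_def)
  consider "j = 1" | "j = n" | "2 \<le> j" "j \<le> GN n" | "FN n < j" "j < n" | "odd n" "j = FN n"
  proof -
    have "j = 1 \<or> j = n \<or> 2 \<le> j \<and> j \<le> GN n \<or> FN n < j \<and> j < n \<or> odd n \<and> j = FN n"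
      using assms unfolding atLeastAtMost_iff by presburger
    with that show thesis by blast
  qed
  then show ?thesis
  proof cases
    case 1 then show ?thesis by (simp add: E_1[simplified] E_n y_def mult.assoc)
  next
    case 2 then show ?thesis by (simp add: E_1[simplified] E_n y_def mult.assoc)
  next
    case 3
    then show ?thesis using n4 by (subst E_low, simp, simp, subst E_high') (auto simp: mult.assoc)
  next
    case 4
    then have "E (n + 1 - j) = e (n + 1 - j)" by (intro E_low) auto
    then show ?thesis using 4 by (simp add: E_high mult.assoc)
  next
    case 5
    then have "n + 1 - j = j" by presburger
    moreover have "E j = e (FN n)" using 5 n4 by (subst E_low) auto
    ultimately show ?thesis using odd_case 5 by simp
  qed
qed

lemma hE': "j \<in> {1..n} \<Longrightarrow> h * (E j * t) = E (n + 1 - j) * (h * t)"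
  by (simp add: hE flip: mult.assoc)

lemma hEh: assumes "j \<in> {1..n}" shows "E j = h * (E (n + 1 - j) * h)"
  using assms by (subst hE') (auto simp: hE)

lemma E_idem_low: "2 \<le> j \<Longrightarrow> j \<le> FN n \<Longrightarrow> e j * e j = e j"
  using rel[of "[LE j, LE j]" "[LE j]"] by (auto simp: relations_def V1_def)

lemma E_idem [simp]: assumes "j \<in> {1..n}" shows "E j * E j = E j"
proof -
  have "E j * E j = E j" if "j \<in> {1..n}" "2 * j \<le> n + 1" for j
  proof (cases "j = 1")
    case True then show ?thesis by (simp add: E_1[simplified] y_def mult.assoc xyx)
  next
    case False
    with that show ?thesis by (auto simp: E_low E_idem_low)
  qed note * = this
  show ?thesis
  proof (cases "2 * j \<le> n + 1")
    case True with * assms show ?thesis by auto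
  next
    case False
    with assms *[of "n + 1 - j"] have "E (n + 1 - j) * E (n + 1 - j) = E (n + 1 - j)" by auto
    with mult_left_ext[OF this, of h] show ?thesis unfolding hEh[OF assms] by (simp add: mult.assoc)
  qed
qed

lemma E_comm_aux:
  assumes "i \<in> {1..n}" "2 * i \<le> n + 1" "j \<in> {1..n}"
  shows "E i * E j = E j * E i"
proof -
  have low: "e i * e j = e j * e i" if "2 \<le> i" "i \<le> FN n" "2 \<le> j" "j \<le> FN n" for i j
  proof -
    have "e i * e j = e j * e i" if "2 \<le> i" "i < j" "j \<le> FN n" for i j
      using rel[of "[LE i, LE j]" "[LE j, LE i]"] that by (auto simp: relations_def V4_def)
    then show ?thesis using that by (metis linorder_neqE_nat)
  qed
  have mid: "e i * (h * (e j * h)) = h * (e j * (h * e i))" if "2 \<le> i" "i \<le> FN n" "2 \<le> j" "j \<le> GN n" for i j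
    using rel[of "[LE i, LH, LE j, LH]" "[LH, LE j, LH, LE i]"] that
    by (auto simp: relations_def V4_def)
  have en: "x * (h * (x * (h * e i))) = e i * (x * (h * (x * h)))" if "2 \<le> i" "i \<le> FN n" for i
    using rel[of "xh2 @ [LE i]" "[LE i] @ xh2"] that by (auto simp: relations_def V5_def)
  have e1: "h * (x * (h * (x * e i))) = e i * (h * (x * (h * x)))" if "2 \<le> i" "i \<le> FN n" for i
    using rel[of "hx2 @ [LE i]" "[LE i] @ hx2"] that by (auto simp: relations_def V5_def)
  have v3: "x * (h * (x * (x * (h * (x * h))))) = h * (x * (h * (x * (x * (h * x)))))"
    using rel[of "[LX, LH, LX, LX, LH, LX, LH]" "[LH, LX, LH, LX, LX, LH, LX]"]
    by (simp add: relations_def V3_def)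
  have v3': "x * (h * (x * (x * (h * x)))) = h * (x * (h * (x * (x * (h * (x * h))))))"
    by (rule h_cancel) (simp add: v3[symmetric])
  have Eone: "E 1 * E j = E j * E 1" if "2 \<le> j" "j \<le> FN n" for j
    using e1[of j] that by (simp add: E_1[simplified] E_low y_def mult.assoc)
  have En: "E n * E j = E j * E n" if "2 \<le> j" "j \<le> FN n" for j
    using en[of j] that by (simp add: E_n E_low y_def mult.assoc)
  have E1n: "E 1 * E n = E n * E 1"
    using v3' by (simp add: E_1[simplified] E_n y_def mult.assoc)
  have Eone': "E 1 * E j = E j * E 1" if "FN n < j" "j < n" for j
  proof -
    from that have "E n * E (n + 1 - j) = E (n + 1 - j) * E n" by (intro En) auto
    moreover have "E 1 = h * (E n * h)" "E j = h * (E (n + 1 - j) * h)"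
      using hEh[of 1] hEh[of j] that n4 by auto
    ultimately show ?thesis by (simp add: mult.assoc) (simp flip: mult.assoc)
  qed
  have 1: "E 1 * E j = E j * E 1" if "j \<in> {1..n}" for j
    using Eone[of j] Eone'[of j] E1n that by (cases "j = 1"; cases "j = n"; cases "j \<le> FN n") auto
  show ?thesis
  proof (cases "i = 1")
    case True then show ?thesis using 1 assms by simp
  next
    case False
    then have i: "2 \<le> i" "i \<le> FN n" using assms by auto
    consider "j = 1" | "j = n" | "2 \<le> j" "j \<le> FN n" | "FN n < j" "j < n"
      using assms by fastforce
    then show ?thesis
    proof cases
      case 1 then show ?thesis using Eone i by simp
    next
      case 2 then show ?thesis using En i by simp
    next
      case 3 then show ?thesis using low i by (simp add: E_low)
    next
      case 4 then show ?thesis using mid[of i "n + 1 - j"] i by (simp add: E_low E_high mult.assoc)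
    qed
  qed
qed

lemma E_comm: assumes "i \<in> {1..n}" "j \<in> {1..n}" shows "E i * E j = E j * E i"
proof -
  consider "2 * i \<le> n + 1" | "2 * (n + 1 - i) \<le> n + 1" using assms by force
  then show ?thesis
  proof cases
    case 1 then show ?thesis using E_comm_aux assms by simp
  next
    case 2
    then have "E (n + 1 - i) * E (n + 1 - j) = E (n + 1 - j) * E (n + 1 - i)"
      using assms by (intro E_comm_aux) auto
    from mult_left_ext[OF this, of h]
    show ?thesis unfolding hEh[OF assms(1)] hEh[OF assms(2)] by (simp add: mult.assoc)
  qed
qed

lemma x_E: assumes "1 \<le> i" "i < n" shows "x * E (i + 1) = E i * x"
proof -
  consider "i = 1" | "2 \<le> i" "i \<le> mN n" | "i = FN n" | "FN n < i" "i < n - 1" | "i = n - 1"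
    using assms n4 by fastforce
  then show ?thesis
  proof cases
    case 1
    have "(hx2 @ [LX], [LX, LE 2]) \<in> relations n" by (simp add: relations_def V7_def)
    moreover have "E 2 = e 2" using n4 by (intro E_low) auto
    ultimately show ?thesis using rel[of "hx2 @ [LX]" "[LX, LE 2]"] 1 n4
      by (simp add: E_1[simplified] y_def mult.assoc numeral_2_eq_2)
  next
    case 2
    then have "([LX, LE (i + 1)], [LE i, LX]) \<in> relations n" by (auto simp: relations_def V6_def)
    from rel[OF this] 2 show ?thesis by (simp add: E_low)
  next
    case 3
    have "([LX, LH, LE (GN n), LH], [LE (FN n), LX]) \<in> relations n"
      by (auto simp: relations_def V6_def)
    note rel[OF this]
    moreover have "E (i + 1) = h * e (GN n) * h" 
    proof -
      have "i + 1 = n + 1 - GN n" using 3 by presburger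
      then show ?thesis using n4 E_high'[of "GN n"] by simp
    qed
    moreover have "E i = e (FN n)" using 3 n4 by (subst E_low) auto
    ultimately show ?thesis by (simp add: mult.assoc)
  next
    case 4
    define j where "j = n - i"
    with 4 have "2 \<le> j" "j \<le> (n - 2) div 2" by auto
    then have "([LX, LH, LE j, LH], [LH, LE (j + 1), LH, LX]) \<in> relations n"
      by (auto simp: relations_def V6_def)
    note rel[OF this]
    moreover have "E (i + 1) = h * e j * h" using 4 n4 by (subst E_high) (auto simp: j_def Suc_diff_le)
    moreover have "E i = h * e (j + 1) * h" using 4 n4 by (subst E_high) (auto simp: j_def Suc_diff_le)
    ultimately show ?thesis by (simp add: mult.assoc)
  next
    case 5
    have "([LX] @ xh2, [LH, LE 2, LH, LX]) \<in> relations n" by (auto simp: relations_def V7_def)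
    note rel[OF this]
    moreover have "E i = h * e 2 * h" using 5 n4 by (subst E_high) auto
    ultimately show ?thesis using 5 n4 by (simp add: E_n y_def mult.assoc)
  qed
qed

lemma x_E1: "x * E 1 = x" and En_x: "E n * x = x"
  by (simp_all add: E_1[simplified] E_n y_def mult.assoc xyx)

lemma pow_x_E: "k < j \<Longrightarrow> j \<le> n \<Longrightarrow> x ^ k * E j = E (j - k) * x ^ k"
proof (induction k arbitrary: j)
  case (Suc k)
  then have "x ^ k * E (j - 1) = E (j - Suc k) * x ^ k" using Suc.IH[of "j - 1"] by simp
  moreover have "x * E j = E (j - 1) * x" using x_E[of "j - 1"] Suc.prems by simp
  ultimately show ?case by (metis power_Suc2 mult.assoc)
qed simp

lemma pow_x_E_absorb: "1 \<le> j \<Longrightarrow> j \<le> k \<Longrightarrow> j \<le> n \<Longrightarrow> x ^ k * E j = x ^ k"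
proof (induction k)
  case (Suc k)
  show ?case
  proof (cases "j = Suc k")
    case True
    then have "x ^ k * E j = E 1 * x ^ k" using Suc.prems pow_x_E[of k j] by simp
    then show ?thesis using x_E1 by (metis mult.assoc power_Suc)
  next
    case False
    then show ?thesis using Suc by (simp add: mult.assoc)
  qed
qed simp

lemma E_pow_x: "1 \<le> j \<Longrightarrow> j + k \<le> n \<Longrightarrow> E j * x ^ k = x ^ k * E (j + k)"
  using pow_x_E[of k "j + k"] by simp

lemma E_pow_x_absorb: assumes "n < j + k" "1 \<le> j" "j \<le> n" shows "E j * x ^ k = x ^ k"
proof -
  obtain i l where k: "k = i + Suc l" and i: "j + i = n"
    using assms that[of "n - j" "k - (n - j) - 1"] by auto
  have "E j * x ^ i = x ^ i * E n" using E_pow_x[of j i] assms i by simp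
  then show ?thesis unfolding k power_add power_Suc
    by (simp add: mult_left_ext[of "E j"] mult_left_ext[OF En_x] mult.assoc)
qed

lemma pow_y: "y ^ k = h * (x ^ k * h)"
  using ev_y_word[of k] by (simp add: y_word_def)

lemma pow_y_E: assumes "1 \<le> j" "j + k \<le> n" shows "y ^ k * E j = E (j + k) * y ^ k"
proof -
  have "E (n + 1 - (j + k)) * x ^ k = x ^ k * E (n + 1 - j)"
    using assms by (subst E_pow_x) (auto simp: Suc_diff_le)
  moreover have "y ^ k * E j = h * (x ^ k * E (n + 1 - j) * h)"
    using hEh[of j] assms by (simp add: pow_y mult.assoc)
  moreover have "E (j + k) * y ^ k = h * (E (n + 1 - (j + k)) * x ^ k * h)"
    using hEh[of "j + k"] assms by (simp add: pow_y mult.assoc)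
  ultimately show ?thesis by simp
qed

lemma pow_y_E_absorb: assumes "n < j + k" "1 \<le> j" "j \<le> n" shows "y ^ k * E j = y ^ k"
proof -
  have "x ^ k * E (n + 1 - j) = x ^ k" using assms by (intro pow_x_E_absorb) auto
  then show ?thesis using hEh[of j] mult_left_ext[of "x ^ k" "E (n + 1 - j)" "x ^ k" h] assms
    by (simp add: pow_y mult.assoc)
qed

lemma E_pow_y: "k < j \<Longrightarrow> j \<le> n \<Longrightarrow> E j * y ^ k = y ^ k * E (j - k)"
  using pow_y_E[of "j - k" k] by simp

lemma E_pow_y_absorb: assumes "1 \<le> j" "j \<le> k" "j \<le> n" shows "E j * y ^ k = y ^ k"
proof -
  have "E (n + 1 - j) * x ^ k = x ^ k" using assms by (intro E_pow_x_absorb) auto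
  then show ?thesis using hEh[of j] mult_left_ext[of "E (n + 1 - j)" "x ^ k" "x ^ k" h] assms
    by (simp add: pow_y mult.assoc)
qed

lemma Es_simps [simp]: "Es [] = 1" "Es (j # l) = E j * Es l" "Es (l @ l') = Es l * Es l'"
  by (simp_all add: Es_def)

lemma E_Es_comm: "j \<in> {1..n} \<Longrightarrow> set l \<subseteq> {1..n} \<Longrightarrow> E j * Es l = Es l * E j"
proof (induction l)
  case (Cons i l)
  have "E j * Es (i # l) = (E j * E i) * Es l" by (simp add: mult.assoc)
  also have "E j * E i = E i * E j" using Cons.prems by (intro E_comm) auto
  also have "E i * E j * Es l = E i * (E j * Es l)" by (simp add: mult.assoc)
  also have "E j * Es l = Es l * E j" using Cons by auto
  finally show ?case by (simp add: mult.assoc)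
qed simp

lemma E_Es_absorb: "set l \<subseteq> {1..n} \<Longrightarrow> j \<in> set l \<Longrightarrow> E j * Es l = Es l"
proof (induction l)
  case (Cons i l)
  then show ?case
    using E_Es_comm[of j "i # l"] E_Es_comm[of j l] mult_left_ext[OF E_idem, of j "Es l"]
    by (cases "i = j") (auto simp: mult.assoc)
qed simp

lemma Es_absorb: "set l' \<subseteq> {1..n} \<Longrightarrow> set l \<subseteq> set l' \<Longrightarrow> Es l * Es l' = Es l'"
  by (induction l) (auto simp: mult.assoc E_Es_absorb)

lemma Es_comm: "set l' \<subseteq> {1..n} \<Longrightarrow> set l \<subseteq> {1..n} \<Longrightarrow> Es l * Es l' = Es l' * Es l"
proof (induction l)
  case (Cons i l)
  have "Es (i # l) * Es l' = E i * Es l' * Es l" using Cons by (auto simp: mult.assoc)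
  also have "E i * Es l' = Es l' * E i" using Cons.prems by (intro E_Es_comm) auto
  finally show ?case by (simp add: mult.assoc)
qed simp

lemma Es_cong: "set l = set l' \<Longrightarrow> set l \<subseteq> {1..n} \<Longrightarrow> Es l = Es l'"
  by (metis Es_absorb Es_comm order_refl)

lemma PE_set: "set l \<subseteq> {1..n} \<Longrightarrow> Es l = PE (set l)"
  unfolding PE_Es by (rule Es_cong) auto

lemma PE_empty [simp]: "PE {} = 1"
  by (simp add: PE_Es)

lemma PE_Un: assumes "A \<subseteq> {1..n}" "B \<subseteq> {1..n}" shows "PE A * PE B = PE (A \<union> B)"
proof -
  have "finite A" "finite B" using assms finite_subset by blast+
  then show ?thesis using assms unfolding PE_Es
    by (subst Es_simps(3)[symmetric], intro Es_cong) auto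
qed

lemma PE_single: "PE {j} = E j"
  by (simp add: PE_Es)

lemma PE_E: "A \<subseteq> {1..n} \<Longrightarrow> j \<in> {1..n} \<Longrightarrow> PE A * E j = PE (insert j A)"
  using PE_Un[of A "{j}"] by (simp add: PE_single)

lemma E_PE: "A \<subseteq> {1..n} \<Longrightarrow> j \<in> {1..n} \<Longrightarrow> E j * PE A = PE (insert j A)"
  using PE_Un[of "{j}" A] by (simp add: PE_single)

end

section \<open>Translations and rank-two reflections\<close>

context relation_model
begin

lemma ev_es_low: "set l \<subseteq> {2..FN n} \<Longrightarrow> ev (map LE l) = Es l"
  by (induction l) (auto simp: E_low)

lemma ev_es_high:
  assumes "set l \<subseteq> {2..GN n}"
  shows "ev ([LH] @ map LE l @ [LH]) = Es (map (\<lambda>j. n + 1 - j) l)"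
proof -
  have "h * (ev (map LE l) * h) = Es (map (\<lambda>j. n + 1 - j) l)"
    using assms
  proof (induction l)
    case (Cons j l)
    have "h * (ev (map LE (j # l)) * h) = (h * e j * h) * (h * (ev (map LE l) * h))"
      by (simp add: mult.assoc)
    also have "\<dots> = E (n + 1 - j) * Es (map (\<lambda>j. n + 1 - j) l)"
      using Cons E_high'[of j] by simp
    finally show ?case by simp
  qed simp
  then show ?thesis by simp
qed

definition TR :: "'a set" where
  "TR = {PE A * x ^ k | A k. A \<subseteq> {1..n}} \<union> {PE A * y ^ k | A k. A \<subseteq> {1..n}}"

lemma TR_x: "A \<subseteq> {1..n} \<Longrightarrow> PE A * x ^ k \<in> TR" and TR_y: "A \<subseteq> {1..n} \<Longrightarrow> PE A * y ^ k \<in> TR"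
  by (auto simp: TR_def)

lemma TR_cases:
  assumes "t \<in> TR"
  obtains A k where "A \<subseteq> {1..n}" "t = PE A * x ^ k" | A k where "A \<subseteq> {1..n}" "t = PE A * y ^ k"
  using assms by (auto simp: TR_def)

lemma TR_pow_x: "x ^ k \<in> TR" and TR_pow_y: "y ^ k \<in> TR" and TR_1: "1 \<in> TR"
  using TR_x[of "{}" k] TR_y[of "{}" k] TR_x[of "{}" 0] by auto

lemma TR_E: assumes "t \<in> TR" "j \<in> {1..n}" shows "t * E j \<in> TR"
  using assms(1)
proof (cases rule: TR_cases)
  case (1 A k)
  show ?thesis
  proof (cases "j \<le> k")
    case True
    then show ?thesis using 1 assms by (simp add: mult.assoc pow_x_E_absorb TR_x)
  next
    case False
    then have "t * E j = PE A * E (j - k) * x ^ k" using 1 assms by (simp add: mult.assoc pow_x_E)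
    moreover have "PE A * E (j - k) * x ^ k = PE (insert (j - k) A) * x ^ k" using 1 assms False by (subst PE_E) auto
    moreover have "insert (j - k) A \<subseteq> {1..n}" using 1 assms False by auto
    ultimately show ?thesis using TR_x by simp
  qed
next
  case (2 A k)
  show ?thesis
  proof (cases "j + k \<le> n")
    case False
    then show ?thesis using 2 assms by (simp add: mult.assoc pow_y_E_absorb TR_y)
  next
    case True
    then have "t * E j = PE A * E (j + k) * y ^ k" using 2 assms by (simp add: mult.assoc pow_y_E)
    also have "\<dots> = PE (insert (j + k) A) * y ^ k" using 2 assms True by (subst PE_E) auto
    finally show ?thesis using 2 assms True TR_y[of "insert (j + k) A" k] by auto
  qed
qed

lemma TR_mult_x: assumes "t \<in> TR" shows "t * x \<in> TR"
proof -
  consider A k where "A \<subseteq> {1..n}" "t = PE A * x ^ k"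
    | A k where "A \<subseteq> {1..n}" "t = PE A * y ^ k"
    using assms unfolding TR_def by auto
  then consider A k where "A \<subseteq> {1..n}" "t = PE A * x ^ k"
    | A where "A \<subseteq> {1..n}" "t = PE A" | A k where "A \<subseteq> {1..n}" "t = PE A * y ^ Suc k"
  proof cases
    case (2 A k) then show thesis using that(2)[of A] that(3)[of A "k - 1"] by (cases k) auto
  qed (use that in auto)
  then show ?thesis
  proof cases
    case 1 then show ?thesis using TR_x[of A "Suc k"] by (simp add: mult.assoc power_commutes)
  next
    case 2 then show ?thesis using TR_x[of A 1] by simp
  next
    case 3
    then have "t * x = PE A * y ^ k * E 1" by (simp add: E_1[simplified] mult.assoc power_Suc2 del: power_Suc)
    then show ?thesis using 3 n4 TR_E[OF TR_y, of A 1 k] by simp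
  qed
qed

lemma TR_mult_y: assumes "t \<in> TR" shows "t * y \<in> TR"
proof -
  consider A k where "A \<subseteq> {1..n}" "t = PE A * y ^ k"
    | A k where "A \<subseteq> {1..n}" "t = PE A * x ^ k"
    using assms unfolding TR_def by auto
  then consider A k where "A \<subseteq> {1..n}" "t = PE A * y ^ k"
    | A where "A \<subseteq> {1..n}" "t = PE A" | A k where "A \<subseteq> {1..n}" "t = PE A * x ^ Suc k"
  proof cases
    case (2 A k) then show thesis using that(2)[of A] that(3)[of A "k - 1"] by (cases k) auto
  qed (use that in auto)
  then show ?thesis
  proof cases
    case 1 then show ?thesis using TR_y[of A "Suc k"] by (simp add: mult.assoc power_commutes)
  next
    case 2 then show ?thesis using TR_y[of A 1] by simp
  next
    case 3
    then have "t * y = PE A * x ^ k * E n" by (simp add: E_n mult.assoc power_Suc2 del: power_Suc)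
    then show ?thesis using 3 n4 TR_E[OF TR_x, of A n k] by simp
  qed
qed

lemma TR_mult_pow_x: "t \<in> TR \<Longrightarrow> t * x ^ k \<in> TR" and TR_mult_pow_y: "t \<in> TR \<Longrightarrow> t * y ^ k \<in> TR"
  by (induction k) (simp_all add: TR_mult_x TR_mult_y power_Suc2 flip: mult.assoc del: power_Suc)

lemma TR_mult_Es: "t \<in> TR \<Longrightarrow> set l \<subseteq> {1..n} \<Longrightarrow> t * Es l \<in> TR"
  by (induction l arbitrary: t) (auto simp: TR_E simp flip: mult.assoc)

lemma TR_mult_PE: assumes "t \<in> TR" "A \<subseteq> {1..n}" shows "t * PE A \<in> TR"
  using assms finite_subset[OF assms(2)] TR_mult_Es[of t "sorted_list_of_set A"] by (simp add: PE_Es)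

lemma TR_mult: assumes "t \<in> TR" "u \<in> TR" shows "t * u \<in> TR"
  using assms(2)
  by (cases rule: TR_cases)
    (simp_all add: TR_mult_pow_x TR_mult_pow_y TR_mult_PE assms flip: mult.assoc)

lemma TR_Es: "set l \<subseteq> {1..n} \<Longrightarrow> Es l \<in> TR"
  using TR_mult_Es[OF TR_1, of l] by simp

lemma TR_one_E: "j \<in> {1..n} \<Longrightarrow> E j \<in> TR"
  using TR_E[OF TR_1] by simp

definition "TR_words = {w. ev w \<in> TR}"

lemma TR_words_append: "u \<in> TR_words \<Longrightarrow> v \<in> TR_words \<Longrightarrow> u @ v \<in> TR_words"
  by (simp add: TR_words_def TR_mult)

lemma TR_words_x: "replicate k LX \<in> TR_words"
  by (simp add: TR_words_def TR_pow_x)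

lemma TR_words_y: "[LH] @ replicate k LX @ [LH] \<in> TR_words"
  using TR_pow_y[of k] ev_y_word[of k] by (simp add: TR_words_def y_word_def)

lemma TR_words_xh2: "xh2 \<in> TR_words"
  using TR_one_E[of n] n4 by (simp add: TR_words_def E_n y_def mult.assoc)

lemma TR_words_es: "2 \<le> a \<Longrightarrow> b \<le> FN n \<Longrightarrow> es a b \<in> TR_words"
proof -
  assume "2 \<le> a" "b \<le> FN n"
  then have "set [a..<Suc b] \<subseteq> {2..FN n}" "set [a..<Suc b] \<subseteq> {1..n}" using n4 by auto
  from ev_es_low[OF this(1)] TR_Es[OF this(2)] show ?thesis
    by (simp add: TR_words_def es_def del: upt_Suc)
qed

lemma TR_words_high: "set l \<subseteq> {2..GN n} \<Longrightarrow> [LH] @ map LE l @ [LH] \<in> TR_words"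
  unfolding TR_words_def mem_Collect_eq
  by (subst ev_es_high) (force intro!: TR_Es)+

lemma TR_words_es_high: "2 \<le> a \<Longrightarrow> b \<le> GN n \<Longrightarrow> [LH] @ es a b @ [LH] \<in> TR_words"
  unfolding es_def by (rule TR_words_high) auto

lemma TR_words_es_high2:
  assumes "2 \<le> a" "b \<le> GN n" "2 \<le> c" "d \<le> GN n"
  shows "[LH] @ es a b @ es c d @ [LH] \<in> TR_words"
proof -
  have "set ([a..<Suc b] @ [c..<Suc d]) \<subseteq> {2..GN n}" using assms by auto
  from TR_words_high[OF this] show ?thesis by (simp add: es_def del: upt_Suc)
qed

lemma V14_rhs_TR: "V14_rhs n \<in> TR_words"
  using TR_words_append[OF TR_words_es[of 2 "FN n"] TR_words_append[OF TR_words_es_high[of 2 "GN n"] TR_words_xh2]]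
  by (simp add: V14_rhs_def)

lemma V13_x1_TR: "V13_x1 n \<in> TR_words"
  using n4 TR_words_append[OF TR_words_x[of "n - 2"] TR_words_high[of "[2]"]]
  by (simp add: V13_x1_def)

lemma V13_x_TR: assumes "i \<in> {2..mN n}" shows "V13_x n i \<in> TR_words"
proof -
  have "es (n - 2 * i + 1) (FN n) \<in> TR_words" using assms by (intro TR_words_es) auto
  moreover have "[LH] @ es 2 (i - 1) @ es (i + 1) (GN n) @ [LH] \<in> TR_words"
    using assms by (intro TR_words_es_high2) auto
  ultimately have "replicate (n - 2 * i) LX @ es (n - 2 * i + 1) (FN n) @
    ([LH] @ es 2 (i - 1) @ es (i + 1) (GN n) @ [LH]) @ xh2 \<in> TR_words"
    by - (assumption | rule TR_words_x TR_words_xh2 TR_words_append)+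
  then show ?thesis by (simp add: V13_x_def)
qed

lemma V13_y_TR: assumes "i \<in> {1..mN n}" shows "V13_y n i \<in> TR_words"
proof -
  have "es 2 i \<in> TR_words" "es (i + 2) (FN n) \<in> TR_words" using assms by (intro TR_words_es, auto)+
  moreover have "[LH] @ es (n - 2 * i + 1) (GN n) @ [LH] \<in> TR_words"
    using assms by (intro TR_words_es_high) auto
  ultimately have "([LH] @ replicate (n - 2 * i + 1) LX @ [LH]) @ replicate 1 LX @
    es 2 i @ es (i + 2) (FN n) @ ([LH] @ es (n - 2 * i + 1) (GN n) @ [LH]) \<in> TR_words"
    by - (assumption | rule TR_words_x TR_words_y TR_words_append)+
  then show ?thesis by (simp add: V13_y_def)
qed

lemma V9_x_TR: assumes "i \<in> {1..mN n}"
  shows "es 2 i @ es (i + 2) (FN n) @ [LH] @ es 2 (GN n) @ [LH] @ xh2 \<in> TR_words"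
proof -
  have "es 2 i \<in> TR_words" "es (i + 2) (FN n) \<in> TR_words" using assms by (intro TR_words_es, auto)+
  moreover have "[LH] @ es 2 (GN n) @ [LH] \<in> TR_words"
    using assms by (intro TR_words_es_high) auto
  ultimately have "es 2 i @ es (i + 2) (FN n) @ ([LH] @ es 2 (GN n) @ [LH]) @ xh2 \<in> TR_words"
    by - (assumption | rule TR_words_xh2 TR_words_append)+
  then show ?thesis by simp
qed

lemma V9_y1_TR: "es 2 (FN n) @ [LH] @ es 2 (GN n) @ [LH] \<in> TR_words"
  using TR_words_append[OF TR_words_es[of 2 "FN n"] TR_words_es_high[of 2 "GN n"]] by simp

lemma V9_y_TR: assumes "i \<in> {2..mN n}"
  shows "es 2 (FN n) @ [LH] @ es 2 (i - 1) @ es (i + 1) (GN n) @ [LH] @ xh2 \<in> TR_words"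
proof -
  have "es 2 (FN n) \<in> TR_words" by (intro TR_words_es) auto
  moreover have "[LH] @ es 2 (i - 1) @ es (i + 1) (GN n) @ [LH] \<in> TR_words"
    using assms by (intro TR_words_es_high2) auto
  ultimately have "es 2 (FN n) @ ([LH] @ es 2 (i - 1) @ es (i + 1) (GN n) @ [LH]) @ xh2 \<in> TR_words"
    by - (assumption | rule TR_words_xh2 TR_words_append)+
  then show ?thesis by simp
qed

lemma TR_rel: "(u, v) \<in> relations n \<Longrightarrow> v \<in> TR_words \<Longrightarrow> ev u \<in> TR"
  using rel by (simp add: TR_words_def)

lemma Z_cases:
  assumes "i \<in> Z_index n"
  obtains "i \<in> {1..mN n}" "Z i = val (LXi i)"
    | j where "j \<in> {1..mN n}" "i = n - j" "Z i = val (LYi j)" "\<not> i \<le> mN n"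
proof (cases "i \<le> mN n")
  case True
  with assms that(1) show ?thesis by (auto simp: Z_index_def Z_def Z_word_def)
next
  case False
  with assms have "n - i \<le> mN n" unfolding Z_index_def mem_Collect_eq by presburger
  with False assms that(2)[of "n - i"] show ?thesis by (auto simp: Z_index_def Z_def Z_word_def)
qed

lemma E_cases:
  assumes "j \<in> {1..n}"
  obtains "j = 1" "E j = h * (x * (h * x))" | "j = n" "E j = x * (h * (x * h))"
    | "j \<in> {2..FN n}" "E j = e j"
    | i where "i \<in> {2..GN n}" "j = n + 1 - i" "E j = h * (e i * h)"
proof -
  consider "j = 1" | "j = n" | "j \<in> {2..FN n}" | "FN n < j" "j < n" using assms by fastforce
  then show thesis
  proof cases
    case 1 then show thesis using that(1) by (simp add: E_1[simplified] y_def mult.assoc)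
  next
    case 2 then show thesis using that(2) by (simp add: E_n y_def mult.assoc)
  next
    case 3 then show thesis using that(3) by (simp add: E_low)
  next
    case 4
    then have "n + 1 - j \<in> {2..GN n}" by auto
    with 4 show thesis using that(4)[of "n + 1 - j"] by (simp add: E_high mult.assoc)
  qed
qed

lemma E_Z:
  assumes i: "i \<in> Z_index n" and j: "j \<in> {1..n}" "j \<noteq> 1" "j \<noteq> i + 1"
  shows "E j * Z i = Z i"
  using i
proof (cases rule: Z_cases)
  case 1
  from j(1) show ?thesis
  proof (cases rule: E_cases)
    case 2
    show ?thesis using 1 2 rel[of "xh2 @ [LXi i]" "[LXi i]"]
      by (cases "i = 1") (auto simp: relations_def V12_def mult.assoc)
  next
    case 3
    then show ?thesis using 1 j rel[of "[LE j, LXi i]" "[LXi i]"]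
      by (auto simp: relations_def V11_def)
  next
    case (4 k)
    then show ?thesis using 1 rel[of "[LH, LE k, LH, LXi i]" "[LXi i]"]
      by (auto simp: relations_def V11_def mult.assoc)
  qed (use j in simp)
next
  case (2 l)
  from j(1) show ?thesis
  proof (cases rule: E_cases)
    case 2
    with \<open>i = n - l\<close> \<open>l \<in> {1..mN n}\<close> j have "l \<noteq> 1" by auto
    then show ?thesis using 2 \<open>l \<in> {1..mN n}\<close> \<open>Z i = val (LYi l)\<close> rel[of "xh2 @ [LYi l]" "[LYi l]"]
      by (auto simp: relations_def V12_def mult.assoc)
  next
    case 3
    then show ?thesis using 2 rel[of "[LE j, LYi l]" "[LYi l]"]
      by (auto simp: relations_def V10_def)
  next
    case (4 k)
    with 2 j have "k \<noteq> l" by auto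
    with 4 show ?thesis using 2 rel[of "[LH, LE k, LH, LYi l]" "[LYi l]"]
      by (auto simp: relations_def V10_def mult.assoc)
  qed (use j in simp)
qed

lemma Z_E:
  assumes i: "i \<in> Z_index n" and j: "j \<in> {1..n}" "j \<noteq> 1" "j \<noteq> n + 1 - i"
  shows "Z i * E j = Z i"
  using i
proof (cases rule: Z_cases)
  case 1
  from j(1) show ?thesis
  proof (cases rule: E_cases)
    case 2
    then have "i \<noteq> 1" using j by auto
    then show ?thesis using 1 2 rel[of "[LXi i] @ xh2" "[LXi i]"]
      by (auto simp: relations_def V12_def mult.assoc)
  next
    case 3
    then show ?thesis using 1 j rel[of "[LXi i, LE j]" "[LXi i]"]
      by (auto simp: relations_def V10_def)
  next
    case (4 k)
    with j have "k \<noteq> i" by auto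
    with 4 show ?thesis using 1 rel[of "[LXi i, LH, LE k, LH]" "[LXi i]"]
      by (auto simp: relations_def V10_def mult.assoc)
  qed (use j in simp)
next
  case (2 l)
  from j(1) show ?thesis
  proof (cases rule: E_cases)
    case 2
    show ?thesis using 2 \<open>l \<in> {1..mN n}\<close> \<open>Z i = val (LYi l)\<close> rel[of "[LYi l] @ xh2" "[LYi l]"]
      by (cases "l = 1") (auto simp: relations_def V12_def mult.assoc)
  next
    case 3
    with 2 j have "j \<noteq> l + 1" by auto
    with 3 show ?thesis using 2 rel[of "[LYi l, LE j]" "[LYi l]"]
      by (auto simp: relations_def V11_def)
  next
    case (4 k)
    with 4 show ?thesis using 2 rel[of "[LYi l, LH, LE k, LH]" "[LYi l]"]
      by (auto simp: relations_def V11_def mult.assoc)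
  qed (use j in simp)
qed

lemma E1_Z_TR: assumes "i \<in> Z_index n" shows "E 1 * Z i \<in> TR"
  using assms
proof (cases rule: Z_cases)
  case 1
  have "ev (hx2 @ [LXi i]) \<in> TR"
  proof (cases "i = 1")
    case True
    then show ?thesis by (intro TR_rel[OF _ V13_x1_TR]) (auto simp: relations_def V13_def)
  next
    case False
    then show ?thesis using 1
      by (intro TR_rel[OF _ V13_x_TR[of i]]) (auto simp: relations_def V13_def)
  qed
  then show ?thesis using 1 by (simp add: E_1[simplified] y_def mult.assoc)
next
  case (2 l)
  have "ev (hx2 @ [LYi l]) \<in> TR"
    using 2 by (intro TR_rel[OF _ V13_y_TR[of l]]) (auto simp: relations_def V13_def)
  then show ?thesis using 2 by (simp add: E_1[simplified] y_def mult.assoc)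
qed

lemma Z_E1_TR: assumes "i \<in> Z_index n" shows "Z i * E 1 \<in> TR"
  using assms
proof (cases rule: Z_cases)
  case 1
  have "ev ([LXi i] @ hx2) \<in> TR"
  proof (cases "i = 1")
    case True
    then show ?thesis by (intro TR_rel[OF _ V13_x1_TR]) (auto simp: relations_def V13_def)
  next
    case False
    then show ?thesis using 1
      by (intro TR_rel[OF _ V13_x_TR[of i]]) (auto simp: relations_def V13_def)
  qed
  then show ?thesis using 1 by (simp add: E_1[simplified] y_def mult.assoc)
next
  case (2 l)
  have "ev ([LYi l] @ hx2) \<in> TR"
    using 2 by (intro TR_rel[OF _ V13_y_TR[of l]]) (auto simp: relations_def V13_def)
  then show ?thesis using 2 by (simp add: E_1[simplified] y_def mult.assoc)
qed

lemma E_Z_TR: assumes "i \<in> Z_index n" shows "E (i + 1) * Z i \<in> TR"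
  using assms
proof (cases rule: Z_cases)
  case 1
  have "ev [LE (i + 1), LXi i] \<in> TR"
    using 1 by (cases "i = 1")
      (auto intro!: TR_rel[OF _ V14_rhs_TR] simp: relations_def V14_def numeral_2_eq_2 simp del: list.map)
  moreover have "E (i + 1) = e (i + 1)" using 1 by (intro E_low) auto
  ultimately show ?thesis using 1 by simp
next
  case (2 l)
  show ?thesis
  proof (cases "l = 1")
    case True
    have "ev (xh2 @ [LYi 1]) \<in> TR" by (intro TR_rel[OF _ V14_rhs_TR]) (auto simp: relations_def V14_def)
    then show ?thesis using 2 True n4 by (simp add: E_n y_def mult.assoc)
  next
    case False
    then have "ev [LH, LE l, LH, LYi l] \<in> TR"
      using 2 by (intro TR_rel[OF _ V14_rhs_TR]) (auto simp: relations_def V14_def)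
    moreover have "E (n + 1 - l) = h * e l * h" using False 2 by (intro E_high') auto
    moreover have "i + 1 = n + 1 - l" using 2 by auto
    ultimately show ?thesis using 2 by (simp add: mult.assoc)
  qed
qed

lemma Z_E_TR: assumes "i \<in> Z_index n" shows "Z i * E (n + 1 - i) \<in> TR"
  using assms
proof (cases rule: Z_cases)
  case 1
  show ?thesis
  proof (cases "i = 1")
    case True
    have "ev ([LXi 1] @ xh2) \<in> TR" by (intro TR_rel[OF _ V14_rhs_TR]) (auto simp: relations_def V14_def)
    then show ?thesis using 1 True n4 by (simp add: E_n y_def mult.assoc)
  next
    case False
    then have "ev [LXi i, LH, LE i, LH] \<in> TR"
      using 1 by (intro TR_rel[OF _ V14_rhs_TR]) (auto simp: relations_def V14_def)
    moreover have "E (n + 1 - i) = h * e i * h" using False 1 by (intro E_high') auto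
    ultimately show ?thesis using 1 by (simp add: mult.assoc)
  qed
next
  case (2 l)
  have "ev [LYi l, LE (l + 1)] \<in> TR"
    using 2 by (cases "l = 1")
      (auto intro!: TR_rel[OF _ V14_rhs_TR] simp: relations_def V14_def numeral_2_eq_2 simp del: list.map)
  moreover have "n + 1 - i = l + 1" using 2 by auto
  moreover have "E (l + 1) = e (l + 1)" using 2 by (intro E_low) auto
  ultimately show ?thesis using 2 by simp
qed

lemma Z_Z_TR: assumes "i \<in> Z_index n" shows "Z i * Z (n - i) \<in> TR"
  using assms
proof (cases rule: Z_cases)
  case 1
  then have "\<not> n - i \<le> mN n" "n - (n - i) = i" by auto
  then have Z: "Z (n - i) = val (LYi i)" by (simp add: Z_def Z_word_def)
  have "ev [LXi i, LYi i] \<in> TR"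
    using 1 by (intro TR_rel[OF _ V9_x_TR[of i]]) (auto simp: relations_def V9_def)
  then show ?thesis using 1 Z by simp
next
  case (2 l)
  then have "n - i \<le> mN n" "n - i = l" by auto
  then have Z: "Z (n - i) = val (LXi l)" by (simp add: Z_def Z_word_def)
  have "ev [LYi l, LXi l] \<in> TR"
  proof (cases "l = 1")
    case True
    then show ?thesis by (intro TR_rel[OF _ V9_y1_TR]) (auto simp: relations_def V9_def)
  next
    case False
    then show ?thesis using 2 by (intro TR_rel[OF _ V9_y_TR[of l]]) (auto simp: relations_def V9_def)
  qed
  then show ?thesis using 2 Z by simp
qed

lemma h_Z: assumes "i \<in> Z_index n" shows "h * Z i = y ^ (n - i - 1) * (Z i * (x ^ (i - 1) * h))"
  using assms
proof (cases rule: Z_cases)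
  case 1
  then have "([LH, LXi i], [LH] @ replicate (n - i - 1) LX @ [LH, LXi i] @ replicate (i - 1) LX @ [LH]) \<in> relations n"
    by (auto simp: relations_def Vbar1_def)
  from rel[OF this] 1 show ?thesis by (simp add: pow_y mult.assoc)
next
  case (2 l)
  then have "([LH, LYi l], [LH] @ replicate (l - 1) LX @ [LH, LYi l] @ replicate (n - l - 1) LX @ [LH]) \<in> relations n"
    by (auto simp: relations_def Vbar1_def)
  from rel[OF this] have "h * val (LYi l) = y ^ (l - 1) * (val (LYi l) * (x ^ (n - l - 1) * h))"
    by (simp add: pow_y mult.assoc)
  moreover have "l - 1 = n - i - 1" "n - l - 1 = i - 1" using 2 by auto
  ultimately show ?thesis using 2(3) by simp
qed

end

section \<open>Closure of the normal forms\<close>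

definition EXC_index :: "nat \<Rightarrow> (nat \<times> nat \<times> nat) set" where
  "EXC_index n = {(p, i, q). i \<in> Z_index n \<and> p + i < n \<and> q < i}"

context relation_model
begin

definition EXC :: "'a set" where
  "EXC = {y ^ p * Z i * x ^ q | p i q. (p, i, q) \<in> EXC_index n}"

abbreviation "OP \<equiv> TR \<union> EXC"

lemma EXC_I: "i \<in> Z_index n \<Longrightarrow> p + i < n \<Longrightarrow> q < i \<Longrightarrow> y ^ p * (Z i * x ^ q) \<in> EXC"
  by (auto simp: EXC_def EXC_index_def mult.assoc)

lemma EXC_E:
  assumes "t \<in> EXC"
  obtains p i q where "i \<in> Z_index n" "p + i < n" "q < i" "t = y ^ p * (Z i * x ^ q)"
  using assms by (auto simp: EXC_def EXC_index_def mult.assoc)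

lemma sandwich: "t \<in> TR \<Longrightarrow> y ^ p * (t * x ^ q) \<in> TR"
  by (simp add: TR_mult TR_pow_x TR_pow_y)

lemma pow_y_Z_pow_x: assumes "i \<in> Z_index n" shows "y ^ p * (Z i * x ^ q) \<in> OP"
proof -
  have i: "1 \<le> i" "i < n" using assms by (auto simp: Z_index_def)
  consider "p + i < n" "q < i" | "n \<le> p + i" | "i \<le> q" by linarith
  then show ?thesis
  proof cases
    case 1
    then show ?thesis using assms EXC_I by blast
  next
    case 2
    then have "y ^ p * E (i + 1) = y ^ p" using i by (intro pow_y_E_absorb) auto
    then have "y ^ p * (Z i * x ^ q) = y ^ p * ((E (i + 1) * Z i) * x ^ q)"
      by (metis mult.assoc)
    then show ?thesis using sandwich[OF E_Z_TR[OF assms]] by simp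
  next
    case 3
    then have "E (n + 1 - i) * x ^ q = x ^ q" using i by (intro E_pow_x_absorb) auto
    then have "y ^ p * (Z i * x ^ q) = y ^ p * ((Z i * E (n + 1 - i)) * x ^ q)"
      by (metis mult.assoc)
    then show ?thesis using sandwich[OF Z_E_TR[OF assms]] by simp
  qed
qed

lemma E_Z_OP: assumes "i \<in> Z_index n" "j \<in> {1..n}" shows "E j * Z i \<in> insert (Z i) TR"
proof -
  consider "j = 1" | "j = i + 1" | "j \<noteq> 1" "j \<noteq> i + 1" by blast
  then show ?thesis using assms E_Z[of i j] E_Z_TR[of i] E1_Z_TR[of i] by cases auto
qed

lemma Z_E_OP: assumes "i \<in> Z_index n" "j \<in> {1..n}" shows "Z i * E j \<in> insert (Z i) TR"
proof -
  consider "j = 1" | "j = n + 1 - i" | "j \<noteq> 1" "j \<noteq> n + 1 - i" by blast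
  then show ?thesis using assms Z_E[of i j] Z_E_TR[of i] Z_E1_TR[of i] by cases auto
qed

lemma OP_E: assumes "t \<in> OP" "j \<in> {1..n}" shows "t * E j \<in> OP"
proof (cases "t \<in> TR")
  case True
  then show ?thesis using TR_E assms by blast
next
  case False
  with assms(1) have "t \<in> EXC" by blast
  then obtain p i q where i: "i \<in> Z_index n" and t: "t = y ^ p * (Z i * x ^ q)" by (elim EXC_E)
  show ?thesis
  proof (cases "j \<le> q")
    case True
    then have "t * E j = t" using assms t by (simp add: mult.assoc pow_x_E_absorb)
    then show ?thesis using assms by simp
  next
    case False
    then have "t * E j = y ^ p * ((Z i * E (j - q)) * x ^ q)"
      using assms t by (simp add: mult.assoc pow_x_E)
    moreover have "Z i * E (j - q) \<in> insert (Z i) TR" using i assms False by (intro Z_E_OP) auto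
    ultimately show ?thesis using sandwich[of _ p q] pow_y_Z_pow_x[OF i, of p q] by auto
  qed
qed

lemma E_OP: assumes "t \<in> OP" "j \<in> {1..n}" shows "E j * t \<in> OP"
proof (cases "t \<in> TR")
  case True
  then show ?thesis using TR_mult TR_one_E assms by blast
next
  case False
  with assms(1) have "t \<in> EXC" by blast
  then obtain p i q where i: "i \<in> Z_index n" and t: "t = y ^ p * (Z i * x ^ q)" by (elim EXC_E)
  show ?thesis
  proof (cases "j \<le> p")
    case True
    then have "E j * t = t" using assms t E_pow_y_absorb[of j p] by (simp flip: mult.assoc)
    then show ?thesis using assms by simp
  next
    case False
    then have "E j * t = y ^ p * ((E (j - p) * Z i) * x ^ q)"
      using assms t mult_left_ext[OF E_pow_y[of p j]] by (simp add: mult.assoc)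
    moreover have "E (j - p) * Z i \<in> insert (Z i) TR" using i assms False by (intro E_Z_OP) auto
    ultimately show ?thesis using sandwich[of _ p q] pow_y_Z_pow_x[OF i, of p q] by auto
  qed
qed

lemma PE_OP: assumes "t \<in> OP" "A \<subseteq> {1..n}" shows "PE A * t \<in> OP"
proof -
  have "Es l * t \<in> OP" if "set l \<subseteq> {1..n}" for l
    using that by (induction l) (use assms E_OP in \<open>auto simp: mult.assoc\<close>)
  then show ?thesis using assms finite_subset[OF assms(2)] by (simp add: PE_Es)
qed

lemma OP_mult_x: assumes "t \<in> OP" shows "t * x \<in> OP"
  using assms
proof
  assume "t \<in> EXC"
  then obtain p i q where i: "i \<in> Z_index n" and t: "t = y ^ p * (Z i * x ^ q)" by (elim EXC_E)
  then show ?thesis using pow_y_Z_pow_x[OF i, of p "Suc q"] by (simp add: mult.assoc power_commutes)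
qed (simp add: TR_mult_x)

lemma OP_mult_y: assumes "t \<in> OP" shows "t * y \<in> OP"
  using assms
proof
  assume "t \<in> EXC"
  then obtain p i q where i: "i \<in> Z_index n" and t: "t = y ^ p * (Z i * x ^ q)" by (elim EXC_E)
  show ?thesis
  proof (cases q)
    case 0
    have "E 1 * y = y" using E_pow_y_absorb[of 1 1] n4 by simp
    then have "t * y = y ^ p * ((Z i * E 1) * y)" using t 0 by (simp add: mult.assoc)
    then show ?thesis using TR_mult[OF TR_pow_y TR_mult_y[OF Z_E1_TR[OF i]]] by simp
  next
    case (Suc r)
    then have "t * y = (y ^ p * (Z i * x ^ r)) * E n"
      using t by (simp add: mult.assoc power_Suc2 E_n del: power_Suc)
    then show ?thesis using OP_E[OF pow_y_Z_pow_x[OF i], of n p r] n4 by simp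
  qed
qed (simp add: TR_mult_y)

lemma OP_mult_pow_x: "t \<in> OP \<Longrightarrow> t * x ^ k \<in> OP" and OP_mult_pow_y: "t \<in> OP \<Longrightarrow> t * y ^ k \<in> OP"
proof (induction k)
  case (Suc k)
  case 1
  then show ?case using Suc(1) OP_mult_x[of "t * x ^ k"] by (simp add: mult.assoc power_commutes)
next
  case (Suc k)
  case 2
  then show ?case using Suc(2) OP_mult_y[of "t * y ^ k"] by (simp add: mult.assoc power_commutes)
qed simp_all

lemma OP_TR: assumes "t \<in> OP" "u \<in> TR" shows "t * u \<in> OP"
proof -
  have *: "t * Es l \<in> OP" if "set l \<subseteq> {1..n}" for l
    using that assms(1) by (induction l arbitrary: t) (use OP_E in \<open>auto simp flip: mult.assoc\<close>)
  have "t * PE A \<in> OP" if "A \<subseteq> {1..n}" for A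
    using *[of "sorted_list_of_set A"] that finite_subset[OF that] by (simp add: PE_Es)
  with assms(2) show ?thesis
    by (cases rule: TR_cases) (simp_all only: OP_mult_pow_x OP_mult_pow_y flip: mult.assoc)
qed

lemma TR_Z: assumes "t \<in> TR" "i \<in> Z_index n" shows "t * Z i \<in> OP"
proof -
  have 1: "x ^ k * Z i \<in> OP" for k
  proof (cases k)
    case 0
    then show ?thesis using pow_y_Z_pow_x[OF assms(2), of 0 0] by simp
  next
    case (Suc r)
    then have "x ^ k * E 1 = x ^ k" using n4 by (intro pow_x_E_absorb) auto
    then have "x ^ k * Z i = x ^ k * (E 1 * Z i)" by (metis mult.assoc)
    then show ?thesis using TR_mult[OF TR_pow_x E1_Z_TR[OF assms(2)]] by simp
  qed
  have 2: "y ^ k * Z i \<in> OP" for k using pow_y_Z_pow_x[OF assms(2), of k 0] by simp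
  from assms(1) show ?thesis
    by (cases rule: TR_cases) (simp_all only: 1 2 PE_OP mult.assoc)
qed

lemma OP_Z: assumes "t \<in> OP" "j \<in> Z_index n" shows "t * Z j \<in> OP"
  using assms(1)
proof
  assume "t \<in> EXC"
  then obtain p i q where i: "i \<in> Z_index n" and t: "t = y ^ p * (Z i * x ^ q)" by (elim EXC_E)
  show ?thesis
  proof (cases q)
    case 0
    show ?thesis
    proof (cases "n - i = j")
      case True
      then have "t * Z j = y ^ p * (Z i * Z (n - i))" using t 0 by (simp add: mult.assoc)
      then show ?thesis using TR_mult[OF TR_pow_y Z_Z_TR[OF i]] by simp
    next
      case False
      then have "E (n + 1 - i) * Z j = Z j" using i assms(2) by (intro E_Z) (auto simp: Z_index_def)
      then have "t * Z j = y ^ p * (Z i * E (n + 1 - i)) * Z j" using t 0 by (simp add: mult.assoc)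
      then show ?thesis using TR_Z[OF TR_mult[OF TR_pow_y Z_E_TR[OF i]] assms(2)] by simp
    qed
  next
    case (Suc r)
    then have "x ^ q * E 1 = x ^ q" using n4 by (intro pow_x_E_absorb) auto
    then have "t * Z j = (y ^ p * (Z i * x ^ q)) * (E 1 * Z j)" using t by (metis mult.assoc)
    then show ?thesis using OP_TR[OF pow_y_Z_pow_x[OF i] E1_Z_TR[OF assms(2)]] by simp
  qed
qed (use TR_Z assms in blast)

lemma Z_of_X: "i \<in> {1..mN n} \<Longrightarrow> val (LXi i) = Z i \<and> i \<in> Z_index n"
  by (auto simp: Z_def Z_word_def Z_index_def)

lemma Z_of_Y: assumes "i \<in> {1..mN n}" shows "val (LYi i) = Z (n - i) \<and> n - i \<in> Z_index n"
proof -
  have "\<not> n - i \<le> mN n" "n - (n - i) = i" using assms by auto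
  then show ?thesis using assms by (auto simp: Z_def Z_word_def Z_index_def)
qed

lemma letter_cases:
  assumes "a \<in> alphabet n"
  obtains "a = LH" | "val a = x" | j where "j \<in> {1..n}" "val a = E j"
    | i where "i \<in> Z_index n" "val a = Z i"
proof -
  have "val (LE i) = E i \<and> i \<in> {1..n}" if "i \<in> {2..FN n}" for i
    using that n4 E_low[of i] by auto
  then show thesis using assms that Z_of_X Z_of_Y unfolding alphabet_def by blast
qed

definition NF :: "'a set" where "NF = OP \<union> {t * h | t. t \<in> OP}"

lemma NF_letter: assumes "t \<in> NF" "a \<in> alphabet n" shows "t * val a \<in> NF"
proof -
  obtain s where s: "s \<in> OP" "t = s \<or> t = s * h" using assms(1) by (auto simp: NF_def)
  from s(2) show ?thesis
  proof
    assume t: "t = s"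
    from assms(2) show ?thesis
    proof (cases rule: letter_cases)
      case 1
      then show ?thesis using s t by (auto simp: NF_def)
    qed (use s t OP_mult_x OP_E OP_Z in \<open>auto simp: NF_def\<close>)
  next
    assume t: "t = s * h"
    from assms(2) show ?thesis
    proof (cases rule: letter_cases)
      case 1
      then show ?thesis using s t by (auto simp: NF_def mult.assoc)
    next
      case 2
      then have "t * val a = (s * y) * h" using t by (simp add: mult.assoc hx)
      then show ?thesis using OP_mult_y s by (auto simp: NF_def)
    next
      case (3 j)
      then have "t * val a = (s * E (n + 1 - j)) * h" using t by (simp add: mult.assoc hE)
      moreover have "s * E (n + 1 - j) \<in> OP" using s 3 by (intro OP_E) auto
      ultimately show ?thesis by (auto simp: NF_def)
    next
      case (4 i)
      then have "t * val a = (((s * y ^ (n - i - 1)) * Z i) * x ^ (i - 1)) * h"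
        using t by (simp add: mult.assoc h_Z)
      moreover have "((s * y ^ (n - i - 1)) * Z i) * x ^ (i - 1) \<in> OP"
        using s 4 by (intro OP_mult_pow_x OP_Z OP_mult_pow_y) auto
      ultimately show ?thesis unfolding NF_def by blast
    qed
  qed
qed

lemma ev_NF: assumes "w \<in> lists (alphabet n)" shows "ev w \<in> NF"
  using assms
proof (induction w rule: rev_induct)
  case Nil
  show ?case using TR_1 by (simp add: NF_def)
qed (simp add: NF_letter)

end

section \<open>Elements of rank at most one\<close>

context relation_model
begin

lemma PE_absorb: "B \<subseteq> {1..n} \<Longrightarrow> (\<And>j. j \<in> B \<Longrightarrow> E j * t = t) \<Longrightarrow> PE B * t = t"
proof -
  assume B: "B \<subseteq> {1..n}" "\<And>j. j \<in> B \<Longrightarrow> E j * t = t"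
  have "Es l * t = t" if "set l \<subseteq> B" for l
    using that by (induction l) (auto simp: B mult.assoc)
  then show ?thesis using finite_subset[OF B(1)] by (simp add: PE_Es)
qed

lemma PE_pow_x:
  assumes "A \<subseteq> {1..n}"
  shows "PE A * x ^ k = PE ({1..n} - ({1..n - k} - A)) * x ^ k"
proof -
  have "PE {n - k + 1..n} * x ^ k = x ^ k"
    by (rule PE_absorb) (auto simp: E_pow_x_absorb)
  then have "PE A * x ^ k = PE (A \<union> {n - k + 1..n}) * x ^ k"
    using assms by (subst PE_Un[symmetric]) (auto simp: mult.assoc)
  also have "A \<union> {n - k + 1..n} = {1..n} - ({1..n - k} - A)" using assms by auto
  finally show ?thesis .
qed

lemma PE_pow_y:
  assumes "A \<subseteq> {1..n}"
  shows "PE A * y ^ k = PE ({1..n} - ({k + 1..n} - A)) * y ^ k"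
proof -
  have "PE {1..min k n} * y ^ k = y ^ k"
    by (rule PE_absorb) (auto simp: E_pow_y_absorb)
  then have "PE A * y ^ k = PE (A \<union> {1..min k n}) * y ^ k"
    using assms by (subst PE_Un[symmetric]) (auto simp: mult.assoc)
  also have "A \<union> {1..min k n} = {1..n} - ({k + 1..n} - A)" using assms by auto
  finally show ?thesis .
qed

definition zero where "zero = PE {1..n}"
definition eps where "eps = PE {2..n}"

lemma eps_E: "2 \<le> j \<Longrightarrow> j \<le> n \<Longrightarrow> eps * E j = eps"
  unfolding eps_def by (subst PE_E) (auto simp: insert_absorb)

lemma zero_E: "j \<in> {1..n} \<Longrightarrow> zero * E j = zero"
  unfolding zero_def by (subst PE_E) (auto simp: insert_absorb)

lemma zero_eps: "zero = E 1 * eps" and zero_eps': "zero * eps = zero"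
proof -
  have *: "insert 1 {2..n} = {1..n}" "{1..n} \<union> {2..n} = {1..n}" using n4 by auto
  show "zero = E 1 * eps" unfolding zero_def eps_def using n4 by (subst E_PE) (auto simp: *[simplified])
  show "zero * eps = zero" unfolding zero_def eps_def using * by (subst PE_Un) auto
qed

lemma es_middle: "Es [2..<Suc (FN n)] * Es (map (\<lambda>j. n + 1 - j) [2..<Suc (GN n)]) = PE {2..n - 1}"
proof -
  have eq: "set ([2..<Suc (FN n)] @ map (\<lambda>j. n + 1 - j) [2..<Suc (GN n)]) = {2..n - 1}"
  proof (intro equalityI subsetI)
    fix j assume j: "j \<in> {2..n - 1}"
    show "j \<in> set ([2..<Suc (FN n)] @ map (\<lambda>j. n + 1 - j) [2..<Suc (GN n)])"
    proof (cases "j \<le> FN n")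
      case False
      then have "n + 1 - j \<in> {2..<Suc (GN n)}" "j = n + 1 - (n + 1 - j)" using j by auto
      then show ?thesis by (metis UnI2 image_eqI set_append set_map set_upt)
    qed (use j in auto)
  qed (use n4 in auto)
  show ?thesis using PE_set[of "[2..<Suc (FN n)] @ map (\<lambda>j. n + 1 - j) [2..<Suc (GN n)]"]
    unfolding eq by (simp del: upt_Suc)
qed

lemma ev_es_middle: "ev (es 2 (FN n)) * (h * ev (es 2 (GN n))) = PE {2..n - 1} * h"
proof -
  have "h * (ev (es 2 (GN n)) * h) = Es (map (\<lambda>j. n + 1 - j) [2..<Suc (GN n)])"
    using ev_es_high[of "[2..<Suc (GN n)]"]
    by (simp add: es_def atLeastLessThanSuc_atLeastAtMost del: upt_Suc)
  then have "h * ev (es 2 (GN n)) = Es (map (\<lambda>j. n + 1 - j) [2..<Suc (GN n)]) * h"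
    by (metis hh mult.assoc mult_1_right)
  moreover have "ev (es 2 (FN n)) = Es [2..<Suc (FN n)]"
    using ev_es_low[of "[2..<Suc (FN n)]"]
    by (simp add: es_def atLeastLessThanSuc_atLeastAtMost del: upt_Suc)
  ultimately have "ev (es 2 (FN n)) * (h * ev (es 2 (GN n)))
      = Es [2..<Suc (FN n)] * Es (map (\<lambda>j. n + 1 - j) [2..<Suc (GN n)]) * h"
    by (simp only: mult.assoc)
  then show ?thesis by (simp only: es_middle)
qed

lemma eps_h: "eps * h = x ^ (n - 1)"
proof -
  have "x ^ (n - 1) = ev (es 2 (FN n)) * (h * ev (es 2 (GN n))) * E 1"
    using rel[of "es 2 (FN n) @ [LH] @ es 2 (GN n) @ hx2" "replicate (n - 1) LX"]
    by (simp add: relations_def Vbar2_def E_1[simplified] y_def mult.assoc)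
  also have "\<dots> = PE {2..n - 1} * E n * h"
    unfolding ev_es_middle using hE[of 1] n4 by (simp add: mult.assoc)
  also have "PE {2..n - 1} * E n = eps"
  proof -
    have "insert n {2..n - 1} = {2..n}" using n4 by auto
    then show ?thesis unfolding eps_def using n4 by (subst PE_E) auto
  qed
  finally show ?thesis by simp
qed

lemma eps_pow_x: "eps * x ^ (n - 1) = x ^ (n - 1)"
  unfolding eps_def by (rule PE_absorb) (use n4 in \<open>auto intro!: E_pow_x_absorb\<close>)

lemma zero_x: "zero * x = zero"
proof -
  have "(hx2 @ es 2 (FN n) @ [LH] @ es 2 (GN n) @ hx2,
       [LX] @ es 2 (FN n) @ [LH] @ es 2 (GN n) @ hx2) \<in> relations n"
    by (simp add: relations_def V8_def)
  from rel[OF this]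
  have "E 1 * (ev (es 2 (FN n)) * (h * ev (es 2 (GN n))) * E 1)
      = x * (ev (es 2 (FN n)) * (h * ev (es 2 (GN n))) * E 1)"
    by (simp add: E_1[simplified] y_def mult.assoc)
  moreover have "ev (es 2 (FN n)) * (h * ev (es 2 (GN n))) * E 1 = eps * h"
    using eps_h rel[of "es 2 (FN n) @ [LH] @ es 2 (GN n) @ hx2" "replicate (n - 1) LX"]
    by (simp add: relations_def Vbar2_def E_1[simplified] y_def mult.assoc)
  ultimately have "E 1 * (eps * h) * h = x * (eps * h) * h" by simp
  then have *: "zero = x * eps" by (simp add: zero_eps mult.assoc)
  have "x * Es l = Es (map (\<lambda>j. j - 1) l) * x" if "set l \<subseteq> {2..n}" for l
    using that
  proof (induction l)
    case (Cons j l)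
    then have "2 \<le> j" "j \<le> n" by auto
    then have "x * E j = E (j - 1) * x" using x_E[of "j - 1"] by simp
    with Cons show ?case using mult_left_ext[of x "E j"] by (simp add: mult.assoc)
  qed simp
  from this[of "[2..<Suc n]"] have "x * eps = Es (map (\<lambda>j. j - 1) [2..<Suc n]) * x"
    using PE_set[of "[2..<Suc n]"] unfolding eps_def
    by (simp add: atLeastLessThanSuc_atLeastAtMost del: upt_Suc)
  also have "Es (map (\<lambda>j. j - 1) [2..<Suc n]) = PE {1..n - 1}"
  proof -
    have "set (map (\<lambda>j. j - 1) [2..<Suc n]) = {1..n - 1}"
      by (force simp: image_iff Bex_def intro: exI[of _ "Suc _"])
    then show ?thesis using PE_set[of "map (\<lambda>j. j - 1) [2..<Suc n]"] by (simp del: upt_Suc)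
  qed
  also have "PE {1..n - 1} * x = PE {1..n - 1} * E n * x" by (simp add: mult.assoc En_x)
  also have "PE {1..n - 1} * E n = zero"
  proof -
    have "insert n {1..n - 1} = {1..n}" using n4 by auto
    then show ?thesis unfolding zero_def using n4 by (subst PE_E) auto
  qed
  finally show ?thesis using * by metis
qed

lemma zero_y: "zero * y = zero"
proof -
  have "zero * y = zero * x * y" by (simp add: zero_x)
  also have "\<dots> = zero * E n" by (simp add: E_n mult.assoc)
  finally show ?thesis using zero_E n4 by simp
qed

lemma zero_pow_x: "zero * x ^ k = zero" and zero_pow_y: "zero * y ^ k = zero"
  by (induction k) (simp_all add: zero_x zero_y flip: mult.assoc)

lemma zero_h: "zero * h = zero"
proof -
  have "zero * h = E 1 * (eps * x ^ (n - 1))" by (simp add: zero_eps mult.assoc eps_h[simplified] eps_pow_x[simplified])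
  also have "\<dots> = zero * x ^ (n - 1)" unfolding zero_eps by (simp only: mult.assoc)
  finally show ?thesis by (simp add: zero_pow_x)
qed

lemma eps_pow_x_y: "k + j < n \<Longrightarrow> eps * (x ^ (k + j) * y ^ j) = eps * x ^ k"
proof (induction j arbitrary: k)
  case (Suc j)
  have "x ^ (k + Suc j) * y ^ Suc j = x ^ (Suc k + j) * y ^ j * y"
    by (simp add: power_Suc2 mult.assoc del: power_Suc)
  then have "eps * (x ^ (k + Suc j) * y ^ Suc j) = eps * (x ^ (Suc k + j) * y ^ j) * y"
    by (simp add: mult.assoc)
  also have "\<dots> = eps * (x ^ k * E n)" 
    unfolding Suc.IH[of "Suc k", OF Suc.prems[folded add_Suc_shift]]
    by (simp add: E_n power_Suc2 mult.assoc del: power_Suc)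
  also have "x ^ k * E n = E (n - k) * x ^ k" using Suc.prems by (intro pow_x_E) auto
  also have "eps * (E (n - k) * x ^ k) = eps * x ^ k"
    using Suc.prems by (intro mult_left_ext eps_E) auto
  finally show ?case .
qed simp

lemma y_x_pow: "k \<le> n \<Longrightarrow> y ^ k * x ^ k = PE {1..k}"
proof (induction k)
  case (Suc k)
  have "y ^ Suc k * x ^ Suc k = y ^ k * (E 1 * x ^ k)"
    by (simp add: E_1[simplified] power_Suc2[of y] mult.assoc del: power_Suc)
      (simp add: mult.assoc)
  also have "E 1 * x ^ k = x ^ k * E (1 + k)" using Suc.prems by (intro E_pow_x) auto
  also have "y ^ k * (x ^ k * E (1 + k)) = PE {1..k} * E (Suc k)"
    using Suc by (simp flip: mult.assoc)
  also have "\<dots> = PE {1..Suc k}"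
    using Suc.prems by (subst PE_E) (auto simp: atLeastAtMostSuc_conv)
  finally show ?case .
qed simp

lemma pow_y_PE:
  assumes "A \<subseteq> {1..n}" "\<And>j. j \<in> A \<Longrightarrow> j + k \<le> n"
  shows "y ^ k * PE A = PE ((\<lambda>j. j + k) ` A) * y ^ k"
proof -
  have *: "y ^ k * Es l = Es (map (\<lambda>j. j + k) l) * y ^ k" if "set l \<subseteq> A" for l
    using that
  proof (induction l)
    case (Cons j l)
    then have "y ^ k * E j = E (j + k) * y ^ k" using assms by (intro pow_y_E) auto
    with Cons show ?case using mult_left_ext[of "y ^ k" "E j"] by (simp add: mult.assoc)
  qed simp
  have fin: "finite A" using assms finite_subset by blast
  have "set (map (\<lambda>j. j + k) (sorted_list_of_set A)) \<subseteq> {1..n}" using assms fin by force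
  from PE_set[OF this] *[of "sorted_list_of_set A"] fin show ?thesis by (simp add: PE_Es[of A])
qed

definition rank_one where
  "rank_one a c = PE ({1..n} - {a}) * (if a \<le> c then x ^ (c - a) else y ^ (a - c))"

lemma rank_one_eps:
  assumes "a \<in> {1..n}" "c \<in> {1..n}"
  shows "rank_one a c = y ^ (a - 1) * (eps * x ^ (c - 1))"
proof -
  define X where "X = (if a \<le> c then x ^ (c - a) else y ^ (a - c))"
  have "y ^ (a - 1) * eps = y ^ (a - 1) * PE {2..n - a + 1}" 
  proof -
    have "y ^ (a - 1) = y ^ (a - 1) * PE ({n - a + 2..n})"
    proof -
      have "y ^ (a - 1) * Es l = y ^ (a - 1)" if "set l \<subseteq> {n - a + 2..n}" for l
        using that by (induction l) (auto simp: mult_left_ext[OF pow_y_E_absorb])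
      from this[of "sorted_list_of_set {n - a + 2..n}"] show ?thesis by (simp add: PE_Es)
    qed
    moreover have "PE {n - a + 2..n} * PE {2..n - a + 1} = eps"
    proof -
      have "{n - a + 2..n} \<union> {2..n - a + 1} = {2..n}" using assms by auto
      then show ?thesis unfolding eps_def using assms by (subst PE_Un) auto
    qed
    moreover have "PE {n - a + 2..n} * eps = eps"
    proof -
      have "{n - a + 2..n} \<union> {2..n} = {2..n}" using assms by auto
      then show ?thesis unfolding eps_def using assms by (subst PE_Un) auto
    qed
    ultimately show ?thesis by (metis mult.assoc)
  qed
  also have "y ^ (a - 1) * PE {2..n - a + 1} = PE {a + 1..n} * y ^ (a - 1)"
  proof -
    have "(\<lambda>j. j + (a - 1)) ` {2..n - a + 1} = {a + 1..n}"
      using assms by (subst image_add_atLeastAtMost') simp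
    moreover have "y ^ (a - 1) * PE {2..n - a + 1}
        = PE ((\<lambda>j. j + (a - 1)) ` {2..n - a + 1}) * y ^ (a - 1)"
      using assms by (intro pow_y_PE) auto
    ultimately show ?thesis by (simp only:)
  qed
  finally have 1: "y ^ (a - 1) * (eps * x ^ (c - 1)) = PE {a + 1..n} * (y ^ (a - 1) * x ^ (c - 1))"
    by (simp add: mult.assoc flip: mult.assoc[of _ eps])
  also have "y ^ (a - 1) * x ^ (c - 1) = PE {1..a - 1} * X"
  proof (cases "a \<le> c")
    case True
    then have "x ^ (c - 1) = x ^ (a - 1) * x ^ (c - a)" using assms by (simp flip: power_add)
    then show ?thesis using y_x_pow[of "a - 1"] assms True by (simp add: X_def flip: mult.assoc)
  next
    case False
    then have "y ^ (a - 1) = y ^ (a - c) * y ^ (c - 1)" using assms by (simp flip: power_add)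
    then have "y ^ (a - 1) * x ^ (c - 1) = y ^ (a - c) * PE {1..c - 1}"
      using y_x_pow[of "c - 1"] assms by (auto simp: mult.assoc)
    also have "\<dots> = PE {a - c + 1..a - 1} * y ^ (a - c)"
    proof -
      have "(\<lambda>j. j + (a - c)) ` {1..c - 1} = {a - c + 1..a - 1}"
        using assms False by (subst image_add_atLeastAtMost') simp
      then show ?thesis using assms False by (subst pow_y_PE) auto
    qed
    also have "\<dots> = PE {1..a - 1} * y ^ (a - c)"
    proof -
      have "{1..n} - ({a - c + 1..n} - {a - c + 1..a - 1}) = {1..n} - ({a - c + 1..n} - {1..a - 1})"
        using assms False by auto
      then show ?thesis using assms PE_pow_y[of "{1..a - 1}" "a - c"]
          PE_pow_y[of "{a - c + 1..a - 1}" "a - c"] by auto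
    qed
    finally show ?thesis using False by (simp add: X_def)
  qed
  also have "PE {a + 1..n} * (PE {1..a - 1} * X) = PE ({1..n} - {a}) * X"
  proof -
    have "{a + 1..n} \<union> {1..a - 1} = {1..n} - {a}" using assms by auto
    moreover have "PE {a + 1..n} * PE {1..a - 1} = PE ({a + 1..n} \<union> {1..a - 1})"
      using assms by (intro PE_Un) auto
    ultimately show ?thesis by (simp only: mult_left_ext)
  qed
  finally show ?thesis by (simp add: rank_one_def X_def)
qed

lemma rank_one_h:
  assumes "a \<in> {1..n}" "c \<in> {1..n}"
  shows "rank_one a c * h = rank_one a (n + 1 - c)"
proof -
  have "rank_one a c * h = y ^ (a - 1) * (eps * (x ^ (c - 1) * h))"
    using rank_one_eps assms by (simp add: mult.assoc)
  also have "x ^ (c - 1) * h = h * y ^ (c - 1)" by (simp add: h_pow_y)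
  also have "eps * (h * y ^ (c - 1)) = x ^ (n - 1) * y ^ (c - 1)" by (rule mult_left_ext[OF eps_h])
  also have "x ^ (n - 1) * y ^ (c - 1) = eps * (x ^ (n - 1) * y ^ (c - 1))"
    by (rule mult_left_ext[OF eps_pow_x, symmetric])
  also have "n - 1 = n - c + (c - 1)" using assms by auto
  also have "eps * (x ^ (n - c + (c - 1)) * y ^ (c - 1)) = eps * x ^ (n - c)"
    using assms by (intro eps_pow_x_y) auto
  finally have "rank_one a c * h = y ^ (a - 1) * (eps * x ^ (n - c))" .
  moreover have "n + 1 - c \<in> {1..n}" "n + 1 - c - 1 = n - c" using assms by auto
  ultimately show ?thesis using rank_one_eps[of a "n + 1 - c"] assms by metis
qed

end

section \<open>The action of words and soundness\<close>

primrec word_map :: "nat \<Rightarrow> letter list \<Rightarrow> nat \<rightharpoonup> nat" where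
  "word_map n [] = (\<lambda>i. if 1 \<le> i \<and> i \<le> n then Some i else None)"
| "word_map n (a # w) = (\<lambda>i. case a of
      LH \<Rightarrow> if 1 \<le> i \<and> i \<le> n then word_map n w (n + 1 - i) else None
    | LX \<Rightarrow> if 1 \<le> i \<and> i < n then word_map n w (i + 1) else None
    | LE j \<Rightarrow> if 1 \<le> i \<and> i \<le> n \<and> i \<noteq> j then word_map n w i else None
    | LXi j \<Rightarrow> if i = 1 then word_map n w 1
        else if i = j + 1 \<and> i \<le> n then word_map n w (n + 1 - j) else None
    | LYi j \<Rightarrow> if i = 1 then word_map n w 1
        else if i = n + 1 - j \<and> 1 \<le> j \<and> j < n then word_map n w (j + 1) else None)"

lemma word_map_outside: "\<not> (1 \<le> i \<and> i \<le> n) \<Longrightarrow> word_map n w i = None"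
proof (induction w arbitrary: i)
  case (Cons a w)
  then show ?case using Cons.IH[of 1] by (cases a) auto
qed auto

lemma word_map_append: "word_map n (u @ v) = word_map n v \<circ>\<^sub>m word_map n u"
proof -
  have "word_map n (u @ v) i = (word_map n v \<circ>\<^sub>m word_map n u) i" for i
  proof (induction u arbitrary: i)
    case Nil
    show ?case by (simp add: map_comp_def word_map_outside)
  next
    case (Cons a u)
    then show ?case by (cases a) (auto simp: map_comp_def)
  qed
  then show ?thesis by blast
qed

lemma word_map_replicate:
  "word_map n (replicate k LX @ w) = (\<lambda>i. if 1 \<le> i \<and> i + k \<le> n then word_map n w (i + k) else None)"
proof (induction k)
  case 0
  show ?case by (auto simp: word_map_outside)
qed auto

lemma word_map_LEs:
  "word_map n (map LE l @ w) = (\<lambda>i. if 1 \<le> i \<and> i \<le> n \<and> i \<notin> set l then word_map n w i else None)"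
  by (induction l) (auto simp: word_map_outside)

lemma word_map_es:
  "word_map n (es a b @ w) = (\<lambda>i. if 1 \<le> i \<and> i \<le> n \<and> \<not> (a \<le> i \<and> i \<le> b) then word_map n w i else None)"
  unfolding es_def by (subst word_map_LEs) (simp add: less_Suc_eq_le del: upt_Suc)

lemmas word_map_nil = word_map_replicate[of _ _ "[]", simplified append_Nil2]
  word_map_es[of _ _ _ "[]", simplified append_Nil2]

lemma word_map_xh2:
  "word_map n (LX # LH # LX # LH # w) = (\<lambda>i. if 1 \<le> i \<and> i < n then word_map n w i else None)"
  by (auto simp: fun_eq_iff)

lemma word_map_hx2:
  "word_map n (LH # LX # LH # LX # w) = (\<lambda>i. if 2 \<le> i \<and> i \<le> n then word_map n w i else None)"
  by (auto simp: fun_eq_iff)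

lemma word_map_heh:
  "word_map n (LH # LE j # LH # w) =
    (\<lambda>i. if 1 \<le> i \<and> i \<le> n \<and> n + 1 - i \<noteq> j then word_map n w i else None)"
  by (auto simp: fun_eq_iff)

lemma word_map_hesh:
  "word_map n (LH # es a b @ LH # w) =
    (\<lambda>i. if 1 \<le> i \<and> i \<le> n \<and> \<not> (a \<le> n + 1 - i \<and> n + 1 - i \<le> b) then word_map n w i else None)"
  by (auto simp: fun_eq_iff word_map_es)

lemma word_map_hesesh:
  "word_map n (LH # es a b @ es c d @ LH # w) =
    (\<lambda>i. if 1 \<le> i \<and> i \<le> n \<and> \<not> (a \<le> n + 1 - i \<and> n + 1 - i \<le> b) \<and>
      \<not> (c \<le> n + 1 - i \<and> n + 1 - i \<le> d) then word_map n w i else None)"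
  by (auto simp: fun_eq_iff word_map_es)

lemma word_map_y:
  "word_map n (LH # replicate k LX @ LH # w) =
    (\<lambda>i. if k < i \<and> i \<le> n then word_map n w (i - k) else None)"
  by (auto simp: fun_eq_iff word_map_replicate word_map_outside intro!: arg_cong[of _ _ "word_map n w"])

lemma if_None_merge:
  "(if P then if Q then a else None else None) = (if P \<and> Q then a else None)"
  by simp

context
  fixes n F G :: nat
  assumes FG: "n = F + G" "G \<le> F" "F \<le> G + 1" "2 \<le> G"
begin

lemma half_bounds: "(n + 1) div 2 = F" "n div 2 = G" "(n - 1) div 2 = F - 1" "(n - 2) div 2 = G - 1"
  using FG by auto

lemmas wm_simps = word_map_nil word_map_es word_map_replicate word_map_xh2 word_map_hx2
  word_map_heh word_map_hesh word_map_hesesh word_map_y append_Cons append_Nil append_assoc append_Nil2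

lemma sound_V1: "(u, v) \<in> V1 n \<Longrightarrow> word_map n u = word_map n v"
  unfolding V1_def half_bounds by (auto simp: fun_eq_iff)

lemma sound_V2: "(u, v) \<in> V2 \<Longrightarrow> word_map n u = word_map n v"
  unfolding V2_def using FG by (auto simp: fun_eq_iff)

lemma sound_V3: "(u, v) \<in> V3 \<Longrightarrow> word_map n u = word_map n v"
  unfolding V3_def using FG by (auto simp: fun_eq_iff)

lemma sound_V4: "(u, v) \<in> V4 n \<Longrightarrow> word_map n u = word_map n v"
  unfolding V4_def half_bounds using FG by (auto simp: fun_eq_iff)

lemma sound_V5: "(u, v) \<in> V5 n \<Longrightarrow> word_map n u = word_map n v"
  unfolding V5_def half_bounds using FG by (auto simp: fun_eq_iff)

lemma sound_V6: "(u, v) \<in> V6 n \<Longrightarrow> word_map n u = word_map n v"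
  unfolding V6_def half_bounds using FG by (auto simp: fun_eq_iff)

lemma sound_V7: "(u, v) \<in> V7 \<Longrightarrow> word_map n u = word_map n v"
  unfolding V7_def using FG by (auto simp: fun_eq_iff)

lemma sound_V8: "(u, v) \<in> V8 n \<Longrightarrow> word_map n u = word_map n v"
  unfolding V8_def half_bounds using FG
  by (auto simp only: Un_iff mem_Collect_eq insert_iff empty_iff prod.inject wm_simps)
    (simp_all only: fun_eq_iff word_map.simps letter.case if_None_merge wm_simps, auto)

lemma sound_V9: "(u, v) \<in> V9 n \<Longrightarrow> word_map n u = word_map n v"
  unfolding V9_def half_bounds using FG
  by (auto simp only: Un_iff mem_Collect_eq insert_iff empty_iff prod.inject wm_simps)
    (simp_all only: fun_eq_iff word_map.simps letter.case if_None_merge wm_simps, auto)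

lemma sound_V10: "(u, v) \<in> V10 n \<Longrightarrow> word_map n u = word_map n v"
  unfolding V10_def half_bounds using FG
  by (auto simp only: Un_iff mem_Collect_eq insert_iff empty_iff prod.inject wm_simps)
    (simp_all only: fun_eq_iff word_map.simps letter.case if_None_merge wm_simps, auto)

lemma sound_V11: "(u, v) \<in> V11 n \<Longrightarrow> word_map n u = word_map n v"
  unfolding V11_def half_bounds using FG
  by (auto simp only: Un_iff mem_Collect_eq insert_iff empty_iff prod.inject wm_simps)
    (simp_all only: fun_eq_iff word_map.simps letter.case if_None_merge wm_simps, auto)

lemma sound_V12: "(u, v) \<in> V12 n \<Longrightarrow> word_map n u = word_map n v"
  unfolding V12_def half_bounds using FG
  by (auto simp only: Un_iff mem_Collect_eq insert_iff empty_iff prod.inject wm_simps)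
    (simp_all only: fun_eq_iff word_map.simps letter.case if_None_merge wm_simps, auto)

lemma if_Some_eq:
  "(P \<longleftrightarrow> Q) \<Longrightarrow> (P \<Longrightarrow> Q \<Longrightarrow> a = b) \<Longrightarrow> (if P then Some a else None) = (if Q then Some b else None)"
  by simp

lemma V13_x1_map: "word_map n (V13_x1 n) = (\<lambda>j. if j = 2 then Some n else None)"
  unfolding V13_x1_def half_bounds using FG
  by (simp only: wm_simps) (simp only: fun_eq_iff word_map.simps letter.case if_None_merge wm_simps, auto)

text \<open>Here and below \<open>obtain\<close> replaces each truncated difference by a variable, which leaves linear goals.\<close>

lemma V13_x_map:
  assumes "i \<in> {2..F - 1}"
  shows "word_map n (V13_x n i) = (\<lambda>j. if j = i + 1 then Some (n + 1 - i) else None)"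
proof
  fix j
  obtain s where s: "n = 2 * i + s" using assms FG by (intro that[of "n - 2 * i"]) auto
  then have s': "n - 2 * i = s" by simp
  have i: "2 \<le> i" "i < F" using assms by auto
  obtain i' where i': "i = Suc i'" "i - 1 = i'" using i by (intro that[of "i - 1"]) auto
  show "word_map n (V13_x n i) j = (if j = i + 1 then Some (n + 1 - i) else None)"
  proof (cases "j + s \<le> n \<and> 1 \<le> j")
    case True
    then obtain r where r: "r + (j + s) = n + 1" by (intro that[of "n + 1 - (j + s)"]) auto
    then have r': "n + 1 - (j + s) = r" by auto
    show ?thesis
      unfolding V13_x_def half_bounds s'
      apply (simp only: wm_simps)
      apply (simp only: word_map.simps letter.case if_None_merge wm_simps r' i'(2))
      apply (rule if_Some_eq)
      using True FG s i i'(1) r by auto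
  next
    case False
    then show ?thesis
      unfolding V13_x_def half_bounds s' using s i
      by (simp only: wm_simps) (simp only: word_map.simps letter.case if_None_merge wm_simps, auto)
  qed
qed

lemma V13_y_map:
  assumes "i \<in> {1..F - 1}"
  shows "word_map n (V13_y n i) = (\<lambda>j. if j = n + 1 - i then Some (i + 1) else None)"
proof
  fix j
  obtain s where s: "n = 2 * i + s" using assms FG by (intro that[of "n - 2 * i"]) auto
  then have s': "n - 2 * i = s" by simp
  have i: "1 \<le> i" "i < F" using assms by auto
  show "word_map n (V13_y n i) j = (if j = n + 1 - i then Some (i + 1) else None)"
  proof (cases "s + 1 < j \<and> j \<le> n")
    case True
    then obtain r where r: "j = (s + 1) + r" by (intro that[of "j - (s + 1)"]) auto
    then have r': "j - (s + 1) = r" by auto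
    obtain t where t: "t + (r + 1) = n + 1" using r True by (intro that[of "n + 1 - (r + 1)"]) auto
    then have t': "n + 1 - (r + 1) = t" by auto
    show ?thesis
      unfolding V13_y_def half_bounds s'
      apply (simp only: wm_simps)
      apply (simp only: word_map.simps letter.case if_None_merge wm_simps r' t')
      apply (rule if_Some_eq)
      using True FG s i r t by auto
  next
    case False
    then show ?thesis
      unfolding V13_y_def half_bounds s' using s i
      by (simp only: wm_simps) (simp only: word_map.simps letter.case if_None_merge wm_simps, auto)
  qed
qed

lemma hx2_X_map:
  "i \<in> {1..F - 1} \<Longrightarrow> word_map n (hx2 @ [LXi i]) = (\<lambda>j. if j = i + 1 then Some (n + 1 - i) else None)"
  using FG by (simp only: wm_simps) (simp only: fun_eq_iff word_map.simps letter.case if_None_merge wm_simps, auto)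

lemma X_hx2_map:
  "i \<in> {1..F - 1} \<Longrightarrow> word_map n ([LXi i] @ hx2) = (\<lambda>j. if j = i + 1 then Some (n + 1 - i) else None)"
  using FG by (simp only: wm_simps) (simp only: fun_eq_iff word_map.simps letter.case if_None_merge wm_simps, auto)

lemma hx2_Y_map:
  "i \<in> {1..F - 1} \<Longrightarrow> word_map n (hx2 @ [LYi i]) = (\<lambda>j. if j = n + 1 - i then Some (i + 1) else None)"
  using FG by (simp only: wm_simps) (simp only: fun_eq_iff word_map.simps letter.case if_None_merge wm_simps, auto)

lemma Y_hx2_map:
  "i \<in> {1..F - 1} \<Longrightarrow> word_map n ([LYi i] @ hx2) = (\<lambda>j. if j = n + 1 - i then Some (i + 1) else None)"
  using FG by (simp only: wm_simps) (simp only: fun_eq_iff word_map.simps letter.case if_None_merge wm_simps, auto)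

lemma sound_V13: "(u, v) \<in> V13 n \<Longrightarrow> word_map n u = word_map n v"
proof -
  have 1: "1 \<in> {1..F - 1}" "1 + 1 = (2 :: nat)" "n + 1 - 1 = n" using FG by auto
  have 2: "i \<in> {1..F - 1}" if "i \<in> {2..F - 1}" for i using that by auto
  show "(u, v) \<in> V13 n \<Longrightarrow> word_map n u = word_map n v"
    unfolding V13_def half_bounds
    by (auto simp only: Un_iff mem_Collect_eq insert_iff empty_iff prod.inject
        V13_x1_map V13_x_map V13_y_map hx2_X_map X_hx2_map hx2_Y_map Y_hx2_map 1 2)
qed

lemma V14_rhs_map: "word_map n (V14_rhs n) = (\<lambda>j. if j = 1 then Some 1 else None)"
  unfolding V14_rhs_def half_bounds using FG
  by (simp only: wm_simps) (simp only: fun_eq_iff word_map.simps letter.case if_None_merge wm_simps, auto)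

lemma X1_xh2_map:
  "word_map n ([LXi 1] @ xh2) = (\<lambda>j. if j = 1 then Some (1) else None)"
  using FG by (simp only: wm_simps) (simp only: fun_eq_iff word_map.simps letter.case if_None_merge wm_simps, auto)

lemma E_X_map:
  "i \<in> {1..F - 1} \<Longrightarrow> word_map n ([LE (i + 1), LXi i]) = (\<lambda>j. if j = 1 then Some (1) else None)"
  using FG by (simp only: wm_simps) (simp only: fun_eq_iff word_map.simps letter.case if_None_merge wm_simps, auto)

lemma Y_E_map:
  "i \<in> {1..F - 1} \<Longrightarrow> word_map n ([LYi i, LE (i + 1)]) = (\<lambda>j. if j = 1 then Some (1) else None)"
  using FG by (simp only: wm_simps) (simp only: fun_eq_iff word_map.simps letter.case if_None_merge wm_simps, auto)

lemma xh2_Y1_map: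
  "word_map n (xh2 @ [LYi 1]) = (\<lambda>j. if j = 1 then Some (1) else None)"
  using FG by (simp only: wm_simps) (simp only: fun_eq_iff word_map.simps letter.case if_None_merge wm_simps, auto)

lemma X_heh_map:
  "i \<in> {2..F - 1} \<Longrightarrow> word_map n ([LXi i, LH, LE i, LH]) = (\<lambda>j. if j = 1 then Some (1) else None)"
  using FG by (simp only: wm_simps) (simp only: fun_eq_iff word_map.simps letter.case if_None_merge wm_simps, auto)

lemma heh_Y_map:
  "i \<in> {2..F - 1} \<Longrightarrow> word_map n ([LH, LE i, LH, LYi i]) = (\<lambda>j. if j = 1 then Some (1) else None)"
  using FG by (simp only: wm_simps) (simp only: fun_eq_iff word_map.simps letter.case if_None_merge wm_simps, auto)

lemma sound_V14: "(u, v) \<in> V14 n \<Longrightarrow> word_map n u = word_map n v"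
proof -
  have 1: "1 \<in> {1..F - 1}" using FG by auto
  have 2: "i \<in> {1..F - 1}" if "i \<in> {2..F - 1}" for i using that by auto
  note E1 = E_X_map[OF 1, unfolded one_add_one] Y_E_map[OF 1, unfolded one_add_one]
  show "(u, v) \<in> V14 n \<Longrightarrow> word_map n u = word_map n v"
    unfolding V14_def half_bounds
    by (auto simp only: Un_iff mem_Collect_eq insert_iff empty_iff prod.inject
        V14_rhs_map E1 X1_xh2_map E_X_map Y_E_map xh2_Y1_map X_heh_map heh_Y_map 2)
qed

lemma sound_Vbar0: "(u, v) \<in> Vbar0 \<Longrightarrow> word_map n u = word_map n v"
  unfolding Vbar0_def using FG by (auto simp: fun_eq_iff)

lemma Vbar1_x_map:
  assumes "i \<in> {1..F - 1}"
  shows "word_map n ([LH] @ replicate (n - i - 1) LX @ [LH, LXi i] @ replicate (i - 1) LX @ [LH])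
    = word_map n [LH, LXi i]"
proof
  fix j
  obtain k where k: "n = k + i + 1" "n - i - 1 = k" using FG assms by (intro that[of "n - i - 1"]) auto
  obtain l where l: "i = l + 1" "i - 1 = l" using FG assms by (intro that[of "i - 1"]) auto
  show "word_map n ([LH] @ replicate (n - i - 1) LX @ [LH, LXi i] @ replicate (i - 1) LX @ [LH]) j
    = word_map n [LH, LXi i] j"
  proof (cases "k < j \<and> j \<le> n")
    case True
    then obtain d where d: "j = k + d" "1 \<le> d" "d \<le> n - k" by (intro that[of "j - k"]) auto
    show ?thesis
      unfolding k(2) l(2)
      apply (simp only: wm_simps)
      apply (simp only: word_map.simps letter.case if_None_merge wm_simps)
      unfolding d(1) k(1) l(1)
      using d k l by auto
  next
    case False
    show ?thesis
      unfolding k(2) l(2)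
      apply (simp only: wm_simps)
      apply (simp only: word_map.simps letter.case if_None_merge wm_simps)
      using False unfolding k(1) l(1) by auto
  qed
qed

lemma Vbar1_y_map:
  assumes "i \<in> {1..F - 1}"
  shows "word_map n ([LH] @ replicate (i - 1) LX @ [LH, LYi i] @ replicate (n - i - 1) LX @ [LH])
    = word_map n [LH, LYi i]"
proof
  fix j
  obtain l where l: "n = l + i + 1" "n - i - 1 = l" using FG assms by (intro that[of "n - i - 1"]) auto
  obtain k where k: "i = k + 1" "i - 1 = k" using FG assms by (intro that[of "i - 1"]) auto
  show "word_map n ([LH] @ replicate (i - 1) LX @ [LH, LYi i] @ replicate (n - i - 1) LX @ [LH]) j
    = word_map n [LH, LYi i] j"
  proof (cases "k < j \<and> j \<le> n")
    case True
    then obtain d where d: "j = k + d" "1 \<le> d" "d \<le> n - k" by (intro that[of "j - k"]) auto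
    show ?thesis
      unfolding k(2) l(2)
      apply (simp only: wm_simps)
      apply (simp only: word_map.simps letter.case if_None_merge wm_simps)
      unfolding d(1) l(1) k(1)
      using d k l by auto
  next
    case False
    show ?thesis
      unfolding k(2) l(2)
      apply (simp only: wm_simps)
      apply (simp only: word_map.simps letter.case if_None_merge wm_simps)
      using False unfolding l(1) k(1) by auto
  qed
qed

lemma Vbar1_h_map: assumes "odd n" shows "word_map n [LH, LE F] = word_map n [LE F, LH]"
proof -
  have "F = G + 1" using FG assms by presburger
  then show ?thesis using FG by (auto simp: fun_eq_iff)
qed

lemma sound_Vbar1: "(u, v) \<in> Vbar1 n \<Longrightarrow> word_map n u = word_map n v"
  unfolding Vbar1_def half_bounds using Vbar1_x_map Vbar1_y_map Vbar1_h_map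
  by (auto simp del: word_map.simps append_Cons append_Nil split: if_splits)

lemma sound_Vbar2: "(u, v) \<in> Vbar2 n \<Longrightarrow> word_map n u = word_map n v"
  unfolding Vbar2_def half_bounds using FG
  by (auto simp only: Un_iff mem_Collect_eq insert_iff empty_iff prod.inject wm_simps)
    (simp_all only: fun_eq_iff word_map.simps letter.case if_None_merge wm_simps, auto)

end

theorem word_map_relations:
  assumes "4 \<le> n" "(u, v) \<in> relations n"
  shows "word_map n u = word_map n v"
proof -
  have FG: "n = FN n + GN n" "GN n \<le> FN n" "FN n \<le> GN n + 1" "2 \<le> GN n" using assms(1) by presburger+
  note S = sound_V1 sound_V2 sound_V3 sound_V4 sound_V5 sound_V6 sound_V7 sound_V8 sound_V9
    sound_V10 sound_V11 sound_V12 sound_V13 sound_V14 sound_Vbar0 sound_Vbar1 sound_Vbar2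
  show ?thesis
    using assms(2) unfolding relations_def by (elim UnE) (erule S[OF FG])+
qed

section \<open>Canonical words\<close>

lemma E_word_alphabet: "4 \<le> n \<Longrightarrow> j \<in> {1..n} \<Longrightarrow> E_word n j \<in> lists (alphabet n)"
proof -
  assume "4 \<le> n" "j \<in> {1..n}"
  moreover from this have "n + 1 - j \<in> {2..FN n}" if "\<not> j \<le> FN n" "j \<noteq> n" using that by auto
  ultimately show ?thesis by (auto simp: E_word_def alphabet_def simp del: add_Suc_right)
qed

lemma P_word_alphabet:
  assumes "4 \<le> n" "A \<subseteq> {1..n}" shows "P_word n A \<in> lists (alphabet n)"
proof -
  have "concat (map (E_word n) l) \<in> lists (alphabet n)" if "set l \<subseteq> {1..n}" for l
    using that by (induction l) (use E_word_alphabet[OF assms(1)] in auto)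
  then show ?thesis using assms finite_subset[OF assms(2)] by (simp add: P_word_def)
qed

lemma replicate_LX_alphabet: "replicate k LX \<in> lists (alphabet n)"
  by (auto simp: alphabet_def in_lists_conv_set)

lemma y_word_alphabet: "y_word k \<in> lists (alphabet n)"
  using replicate_LX_alphabet[of k n] by (simp add: y_word_def) (simp add: alphabet_def)

lemma Z_word_alphabet: assumes "i \<in> Z_index n" shows "Z_word n i \<in> lists (alphabet n)"
proof (cases "i \<le> mN n")
  case True
  then show ?thesis using assms by (auto simp: Z_word_def Z_index_def alphabet_def)
next
  case False
  then have "n - i \<in> {1..mN n}" using assms unfolding Z_index_def atLeastAtMost_iff mem_Collect_eq
    by presburger
  with False show ?thesis by (auto simp: Z_word_def alphabet_def)
qed

lemma word_map_E_word:
  assumes "4 \<le> n" "j \<in> {1..n}"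
  shows "word_map n (E_word n j @ w) = (\<lambda>i. if i \<in> {1..n} - {j} then word_map n w i else None)"
  using assms
  by (auto simp del: word_map.simps simp: E_word_def word_map_xh2 word_map_hx2 word_map_heh fun_eq_iff)
    (auto)

lemma word_map_P_word:
  assumes "4 \<le> n" "A \<subseteq> {1..n}"
  shows "word_map n (P_word n A @ w) = (\<lambda>i. if i \<in> {1..n} - A then word_map n w i else None)"
proof -
  have "word_map n (concat (map (E_word n) l) @ w) =
      (\<lambda>i. if i \<in> {1..n} - set l then word_map n w i else None)" if "set l \<subseteq> {1..n}" for l
    using that
  proof (induction l)
    case Nil
    show ?case by (auto simp: word_map_outside)
  qed (use word_map_E_word[OF assms(1)] in \<open>auto simp: fun_eq_iff\<close>)
  then show ?thesis using assms finite_subset[OF assms(2)] by (simp add: P_word_def)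
qed

lemma word_map_y_word:
  "word_map n (y_word k @ w) = (\<lambda>i. if k < i \<and> i \<le> n then word_map n w (i - k) else None)"
  using word_map_y by (simp add: y_word_def del: word_map.simps)

lemma word_map_Z_word:
  assumes "i \<in> Z_index n"
  shows "word_map n (Z_word n i @ w) =
    (\<lambda>j. if j = 1 then word_map n w 1 else if j = i + 1 then word_map n w (n + 1 - i) else None)"
  using assms by (auto simp: Z_word_def Z_index_def fun_eq_iff Suc_diff_le)

lemma word_map_trans_x:
  assumes "4 \<le> n" "A \<subseteq> {1..n}"
  shows "word_map n (P_word n A @ replicate k LX) =
    (\<lambda>i. if i \<in> {1..n - k} - A then Some (i + k) else None)"
  unfolding word_map_P_word[OF assms] word_map_nil by (auto simp: fun_eq_iff)

lemma word_map_trans_y: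
  assumes "4 \<le> n" "A \<subseteq> {1..n}"
  shows "word_map n (P_word n A @ y_word k) =
    (\<lambda>i. if i \<in> {k + 1..n} - A then Some (i - k) else None)"
  unfolding word_map_P_word[OF assms] using word_map_y_word[of n k "[]"] by (auto simp: fun_eq_iff)

lemma word_map_exc:
  assumes "(p, i, q) \<in> EXC_index n"
  shows "word_map n (y_word p @ Z_word n i @ replicate q LX) =
    (\<lambda>j. if j = p + 1 then Some (q + 1) else if j = p + i + 1 then Some (n + 1 - i + q) else None)"
proof -
  have i: "i \<in> Z_index n" and *: "1 \<le> i" "p + i < n" "q < i"
    using assms by (auto simp: EXC_index_def Z_index_def)
  show ?thesis unfolding word_map_y_word word_map_Z_word[OF i] word_map_nil
    using * by (auto simp: fun_eq_iff)
qed

lemma word_map_range: "4 \<le> n \<Longrightarrow> word_map n w i = Some j \<Longrightarrow> 1 \<le> j \<and> j \<le> n"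
  by (induction w arbitrary: i) (auto split: if_splits letter.splits)

lemma word_map_h:
  assumes "4 \<le> n"
  shows "word_map n (w @ [LH]) = (\<lambda>i. map_option (\<lambda>j. n + 1 - j) (word_map n w i))"
proof
  fix i
  show "word_map n (w @ [LH]) i = map_option (\<lambda>j. n + 1 - j) (word_map n w i)"
    using word_map_range[OF assms, of w i]
    by (cases "word_map n w i") (auto simp: word_map_append)
qed

lemma word_map_dom: "dom (word_map n w) \<subseteq> {1..n}"
proof
  fix i assume "i \<in> dom (word_map n w)"
  then show "i \<in> {1..n}" using word_map_outside[of i n w] by fastforce
qed

definition op_word :: "nat \<Rightarrow> letter list \<Rightarrow> bool" where
  "op_word n v \<longleftrightarrow> (\<exists>A k. A \<subseteq> {1..n} \<and> v = P_word n A @ replicate k LX) \<or>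
     (\<exists>A k. A \<subseteq> {1..n} \<and> v = P_word n A @ y_word k) \<or>
     (\<exists>p i q. (p, i, q) \<in> EXC_index n \<and> v = y_word p @ Z_word n i @ replicate q LX)"

lemma op_wordI:
  "A \<subseteq> {1..n} \<Longrightarrow> op_word n (P_word n A @ replicate k LX)"
  "A \<subseteq> {1..n} \<Longrightarrow> op_word n (P_word n A @ y_word k)"
  "(p, i, q) \<in> EXC_index n \<Longrightarrow> op_word n (y_word p @ Z_word n i @ replicate q LX)"
  unfolding op_word_def by blast+

lemma op_word_alphabet: "4 \<le> n \<Longrightarrow> op_word n v \<Longrightarrow> v \<in> lists (alphabet n)"
  unfolding op_word_def EXC_index_def
  by (elim disjE exE conjE)
    (simp_all only: append_in_lists_conv P_word_alphabet replicate_LX_alphabet y_word_alphabet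
      Z_word_alphabet mem_Collect_eq prod.case simp_thms)

text \<open>A map with domain \<open>D\<close>, \<open>a = min D\<close>, \<open>b = max D\<close>, \<open>a \<mapsto> c\<close>, \<open>b \<mapsto> d\<close> is a translation iff \<open>d - c = b - a\<close>,
  stated below without subtraction.\<close>

definition core_word :: "nat \<Rightarrow> nat set \<Rightarrow> nat \<Rightarrow> nat \<Rightarrow> nat \<Rightarrow> nat \<Rightarrow> letter list" where
  "core_word n D a b c d =
    (if d + a = b + c
     then P_word n ({1..n} - D) @ (if a \<le> c then replicate (c - a) LX else y_word (a - c))
     else y_word (a - 1) @ Z_word n (b - a) @ replicate (c - 1) LX)"

definition canonical_word :: "nat \<Rightarrow> (nat \<rightharpoonup> nat) \<Rightarrow> letter list" where
  "canonical_word n \<alpha> = (let D = dom \<alpha>; a = Min D; b = Max D; c = the (\<alpha> a); d = the (\<alpha> b) in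
     if D = {} then P_word n {1..n}
     else if c \<le> d then core_word n D a b c d
     else core_word n D a b (n + 1 - c) (n + 1 - d) @ [LH])"

text \<open>A normal form of \<open>w\<close> is only known to have the same value as \<open>w\<close> in the model. Faithfulness, which holds
  for the monoid defined by the presentation, makes it define the same map as \<open>w\<close>.\<close>

locale faithful_model = relation_model +
  assumes faithful: "u \<in> lists (alphabet n) \<Longrightarrow> v \<in> lists (alphabet n) \<Longrightarrow>
    prod_list (map val u) = prod_list (map val v) \<Longrightarrow> word_map n u = word_map n v"

context relation_model
begin

lemma OP_word: assumes "t \<in> OP" shows "\<exists>v. op_word n v \<and> ev v = t"
  using assms
proof
  assume "t \<in> TR"
  then show ?thesis
  proof (cases rule: TR_cases)
    case (1 A k)
    then have "op_word n (P_word n A @ replicate k LX)" by (intro op_wordI)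
    then show ?thesis using 1 by (intro exI conjI) (auto simp: PE_def)
  next
    case (2 A k)
    then have "op_word n (P_word n A @ y_word k)" by (intro op_wordI)
    then show ?thesis using 2 by (intro exI conjI) (auto simp: PE_def ev_y_word)
  qed
next
  assume "t \<in> EXC"
  then obtain p i q where *: "(p, i, q) \<in> EXC_index n" "t = y ^ p * Z i * x ^ q"
    by (auto simp: EXC_def)
  then have "op_word n (y_word p @ Z_word n i @ replicate q LX)" by (intro op_wordI)
  then show ?thesis using * by (intro exI conjI) (auto simp: Z_def ev_y_word mult.assoc)
qed

lemma op_word_canon:
  assumes "op_word n v" and \<alpha>: "\<alpha> = word_map n v" and D: "D = dom \<alpha>"
  shows "D = {} \<Longrightarrow> ev v = zero"
    and "D \<noteq> {} \<Longrightarrow> a = Min D \<Longrightarrow> b = Max D \<Longrightarrow> c = the (\<alpha> a) \<Longrightarrow> d = the (\<alpha> b) \<Longrightarrow>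
      ev v = ev (core_word n D a b c d) \<and> (c < d \<or> c = d \<and> a = b)"
proof -
  have fin: "finite D" using word_map_dom[of n v] finite_subset unfolding \<alpha> D by blast
  consider A k where "A \<subseteq> {1..n}" "v = P_word n A @ replicate k LX"
    | A k where "A \<subseteq> {1..n}" "v = P_word n A @ y_word k"
    | p i q where "(p, i, q) \<in> EXC_index n" "v = y_word p @ Z_word n i @ replicate q LX"
    using assms(1) by (auto simp: op_word_def)
  then have "(D = {} \<longrightarrow> ev v = zero) \<and> (\<forall>a b c d. D \<noteq> {} \<longrightarrow> a = Min D \<longrightarrow> b = Max D \<longrightarrow>
      c = the (\<alpha> a) \<longrightarrow> d = the (\<alpha> b) \<longrightarrow> ev v = ev (core_word n D a b c d) \<and> (c < d \<or> c = d \<and> a = b))"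
  proof cases
    case (1 A k)
    have a: "\<alpha> = (\<lambda>i. if i \<in> {1..n - k} - A then Some (i + k) else None)"
      using \<alpha> 1 word_map_trans_x[OF n4] by simp
    then have dom: "D = {1..n - k} - A" unfolding D by (auto split: if_splits)
    have ev: "ev v = PE ({1..n} - D) * x ^ k"
      using PE_pow_x[OF 1(1), of k] 1(2) unfolding dom by (simp add: PE_def)
    have "ev v = zero" if "D = {}" using ev that zero_pow_x by (simp add: zero_def)
    moreover have "ev v = ev (core_word n D (Min D) (Max D) (the (\<alpha> (Min D))) (the (\<alpha> (Max D)))) \<and>
        (the (\<alpha> (Min D)) < the (\<alpha> (Max D)) \<or> the (\<alpha> (Min D)) = the (\<alpha> (Max D)) \<and> Min D = Max D)"
      if "D \<noteq> {}"
    proof -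
      have "Min D \<in> D" "Max D \<in> D" "Min D \<le> Max D" using fin that by auto
      then have "the (\<alpha> (Min D)) = Min D + k" "the (\<alpha> (Max D)) = Max D + k" "Min D \<le> Max D"
        unfolding a dom by auto
      then show ?thesis using ev by (auto simp: core_word_def PE_def)
    qed
    ultimately show ?thesis by blast
  next
    case (2 A k)
    have a: "\<alpha> = (\<lambda>i. if i \<in> {k + 1..n} - A then Some (i - k) else None)"
      using \<alpha> 2 word_map_trans_y[OF n4] by simp
    then have dom: "D = {k + 1..n} - A" unfolding D by (auto split: if_splits)
    have ev: "ev v = PE ({1..n} - D) * y ^ k"
      using PE_pow_y[OF 2(1), of k] 2(2) unfolding dom by (simp add: PE_def ev_y_word)
    have "ev v = zero" if "D = {}" using ev that zero_pow_y by (simp add: zero_def)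
    moreover have "ev v = ev (core_word n D (Min D) (Max D) (the (\<alpha> (Min D))) (the (\<alpha> (Max D)))) \<and>
        (the (\<alpha> (Min D)) < the (\<alpha> (Max D)) \<or> the (\<alpha> (Min D)) = the (\<alpha> (Max D)) \<and> Min D = Max D)"
      if "D \<noteq> {}"
    proof -
      have "Min D \<in> D" "Max D \<in> D" "Min D \<le> Max D" using fin that by auto
      then have "the (\<alpha> (Min D)) = Min D - k" "the (\<alpha> (Max D)) = Max D - k" "Min D \<le> Max D"
        "k < Min D" "k < Max D"
        unfolding a dom by auto
      then show ?thesis using ev by (cases "k = 0") (auto simp: core_word_def PE_def ev_y_word)
    qed
    ultimately show ?thesis by blast
  next
    case (3 p i q)
    have a: "\<alpha> = (\<lambda>j. if j = p + 1 then Some (q + 1) else if j = p + i + 1 then Some (n + 1 - i + q) else None)"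
      using \<alpha> 3 word_map_exc by simp
    then have "D = {p + 1, p + i + 1}" unfolding D by (auto split: if_splits)
    then have mm: "Min D = p + 1" "Max D = p + i + 1" "D \<noteq> {}" by auto
    have i: "1 \<le> i" "i < n" "2 * i \<noteq> n" using 3 by (auto simp: EXC_index_def Z_index_def)
    have "the (\<alpha> (Min D)) = q + 1" "the (\<alpha> (Max D)) = n + 1 - i + q"
      unfolding a mm using i by auto
    moreover from this have "core_word n D (Min D) (Max D) (the (\<alpha> (Min D))) (the (\<alpha> (Max D))) = v"
      unfolding mm using i 3 by (auto simp: core_word_def)
    ultimately show ?thesis using i mm by auto
  qed
  then show "D = {} \<Longrightarrow> ev v = zero"
    and "D \<noteq> {} \<Longrightarrow> a = Min D \<Longrightarrow> b = Max D \<Longrightarrow> c = the (\<alpha> a) \<Longrightarrow> d = the (\<alpha> b) \<Longrightarrow>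
      ev v = ev (core_word n D a b c d) \<and> (c < d \<or> c = d \<and> a = b)"
    by blast+
qed

lemma canon_op_word: assumes "op_word n v" shows "ev (canonical_word n (word_map n v)) = ev v"
proof (cases "dom (word_map n v) = {}")
  case True
  then show ?thesis using op_word_canon(1)[OF assms refl refl]
    by (simp add: canonical_word_def zero_def PE_def)
next
  case False
  from op_word_canon(2)[OF assms refl refl False refl refl refl refl] False show ?thesis
    by (auto simp: canonical_word_def Let_def)
qed

lemma core_word_singleton: "ev (core_word n {a} a a c c) = rank_one a c"
  by (simp add: core_word_def rank_one_def PE_def ev_y_word)

lemma canon_op_word_h: assumes "op_word n v" shows "ev (canonical_word n (word_map n (v @ [LH]))) = ev v * h"
proof -
  define \<alpha> where "\<alpha> = word_map n v"
  define D where "D = dom \<alpha>"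
  define a b c d where "a = Min D" and "b = Max D" and "c = the (\<alpha> a)" and "d = the (\<alpha> b)"
  note defs = a_def b_def c_def d_def
  have wm: "word_map n (v @ [LH]) = (\<lambda>i. map_option (\<lambda>j. n + 1 - j) (\<alpha> i))"
    using word_map_h[OF n4] by (simp add: \<alpha>_def)
  then have dom: "dom (word_map n (v @ [LH])) = D" by (auto simp: D_def)
  have sub: "D \<subseteq> {1..n}" unfolding D_def \<alpha>_def by (rule word_map_dom)
  then have fin: "finite D" using finite_subset by blast
  show ?thesis
  proof (cases "D = {}")
    case True
    then have "ev v = zero" using op_word_canon(1)[OF assms \<alpha>_def D_def] by simp
    then show ?thesis using True dom zero_h by (simp add: canonical_word_def Let_def zero_def PE_def)
  next
    case False
    have ab: "a \<in> D" "b \<in> D" using False fin by (auto simp: defs)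
    then have "\<alpha> a = Some c" "\<alpha> b = Some d" by (auto simp: D_def defs)
    then have cd: "c \<in> {1..n}" "d \<in> {1..n}"
      using word_map_range[OF n4] unfolding \<alpha>_def by (metis atLeastAtMost_iff)+
    have the: "the (word_map n (v @ [LH]) a) = n + 1 - c" "the (word_map n (v @ [LH]) b) = n + 1 - d"
      unfolding wm using \<open>\<alpha> a = Some c\<close> \<open>\<alpha> b = Some d\<close> by auto
    have ev: "ev v = ev (core_word n D a b c d)" and or: "c < d \<or> c = d \<and> a = b"
      using op_word_canon(2)[OF assms \<alpha>_def D_def False a_def b_def c_def d_def] by auto
    have can: "canonical_word n (word_map n (v @ [LH])) =
      (if n + 1 - c \<le> n + 1 - d then core_word n D a b (n + 1 - c) (n + 1 - d)
       else core_word n D a b (n + 1 - (n + 1 - c)) (n + 1 - (n + 1 - d)) @ [LH])"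
      unfolding canonical_word_def dom Let_def a_def[symmetric] b_def[symmetric] the using False by simp
    from or show ?thesis
    proof
      assume "c < d"
      then show ?thesis using can cd ev by auto
    next
      assume eq: "c = d \<and> a = b"
      then have "D = {a}" using ab fin False unfolding a_def b_def
        by (metis Max_ge Min_le antisym singleton_iff subsetI subset_singleton_iff)
      then show ?thesis using can ev eq ab sub cd core_word_singleton rank_one_h by auto
    qed
  qed
qed

end

theorem (in faithful_model) ev_canon:
  assumes w: "w \<in> lists (alphabet n)"
  shows "ev w = ev (canonical_word n (word_map n w))"
proof -
  obtain t where t: "t \<in> OP" "ev w = t \<or> ev w = t * h" using ev_NF[OF w] by (auto simp: NF_def)
  obtain v where v: "op_word n v" "ev v = t" using OP_word[OF t(1)] by auto
  have al: "v \<in> lists (alphabet n)" "v @ [LH] \<in> lists (alphabet n)"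
    using op_word_alphabet[OF n4 v(1)] by (auto simp: alphabet_def)
  from t(2) show ?thesis
  proof
    assume "ev w = t"
    with v faithful[OF w al(1)] canon_op_word[OF v(1)] show ?thesis by simp
  next
    assume "ev w = t * h"
    with v faithful[OF w al(2)] canon_op_word_h[OF v(1)] show ?thesis by simp
  qed
qed

section \<open>The presented monoid\<close>

typedef 'a endo = "UNIV :: ('a \<Rightarrow> 'a) set"
  morphisms apply_endo Endo by simp

setup_lifting type_definition_endo

instantiation endo :: (type) monoid_mult
begin

lift_definition times_endo :: "'a endo \<Rightarrow> 'a endo \<Rightarrow> 'a endo" is "\<lambda>f g. g \<circ> f" .
lift_definition one_endo :: "'a endo" is id .

instance by standard (transfer; auto)+

end

lemma apply_endo_mult: "apply_endo (f * g) P = apply_endo g (apply_endo f P)"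
  by transfer simp

lemma apply_endo_one: "apply_endo 1 P = P"
  by transfer simp

lemma endo_eqI: "(\<And>P. apply_endo f P = apply_endo g P) \<Longrightarrow> f = g"
  by transfer auto

lemma word_congruenceD:
  assumes "word_congruence A \<sigma>"
  shows "equiv (lists A) \<sigma>"
    and "(u, v) \<in> \<sigma> \<Longrightarrow> w \<in> lists A \<Longrightarrow> (w @ u, w @ v) \<in> \<sigma>"
    and "(u, v) \<in> \<sigma> \<Longrightarrow> w \<in> lists A \<Longrightarrow> (u @ w, v @ w) \<in> \<sigma>"
  using assms unfolding word_congruence_def by auto

text \<open>Words act on the classes of a congruence by right multiplication. The action is extended by the
  identity to sets of words that are not classes, so that relations \<open>u = 1\<close> hold in the model.\<close>

definition right_mult :: "'a set \<Rightarrow> ('a list \<times> 'a list) set \<Rightarrow> 'a \<Rightarrow> 'a list set endo" where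
  "right_mult A \<sigma> a =
    Endo (\<lambda>P. if P \<in> lists A // \<sigma> then \<sigma> `` ((\<lambda>u. u @ [a]) ` P) else P)"

lemma right_mult_class:
  assumes "word_congruence A \<sigma>" "u \<in> lists A" "w \<in> lists A"
  shows "apply_endo (prod_list (map (right_mult A \<sigma>) w)) (\<sigma> `` {u}) = \<sigma> `` {u @ w}"
  using assms(2,3)
proof (induction w arbitrary: u)
  case (Cons a w)
  note cong = word_congruenceD[OF assms(1)]
  have "\<sigma> `` ((\<lambda>u. u @ [a]) ` (\<sigma> `` {u})) = \<sigma> `` {u @ [a]}"
  proof -
    have "\<sigma> `` {v @ [a]} = \<sigma> `` {u @ [a]}" if "(u, v) \<in> \<sigma>" for v
      using cong(3)[OF that, of "[a]"] Cons.prems equiv_class_eq[OF cong(1)] by auto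
    moreover have "(u, u) \<in> \<sigma>" using cong(1) Cons.prems by (meson equivE refl_onD)
    ultimately show ?thesis by blast
  qed
  then have "apply_endo (right_mult A \<sigma> a) (\<sigma> `` {u}) = \<sigma> `` {u @ [a]}"
    using Cons.prems by (simp add: right_mult_def Endo_inverse quotientI)
  then show ?case using Cons.IH[of "u @ [a]"] Cons.prems by (simp add: apply_endo_mult)
qed (simp add: apply_endo_one)

lemma right_mult_outside:
  assumes "P \<notin> lists A // \<sigma>"
  shows "apply_endo (prod_list (map (right_mult A \<sigma>) w)) P = P"
  by (induction w) (simp_all add: apply_endo_one apply_endo_mult right_mult_def Endo_inverse assms)

lemma right_mult_eq_iff:
  assumes "word_congruence A \<sigma>" "u \<in> lists A" "v \<in> lists A"
  shows "prod_list (map (right_mult A \<sigma>) u) = prod_list (map (right_mult A \<sigma>) v) \<longleftrightarrow> (u, v) \<in> \<sigma>"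
proof
  note cong = word_congruenceD[OF assms(1)]
  assume "prod_list (map (right_mult A \<sigma>) u) = prod_list (map (right_mult A \<sigma>) v)"
  then have "\<sigma> `` {u} = \<sigma> `` {v}"
    using right_mult_class[OF assms(1), of "[]"] assms(2,3) by (metis append_Nil lists.Nil)
  then show "(u, v) \<in> \<sigma>" using eq_equiv_class[OF _ cong(1)] assms by auto
next
  note cong = word_congruenceD[OF assms(1)]
  assume uv: "(u, v) \<in> \<sigma>"
  show "prod_list (map (right_mult A \<sigma>) u) = prod_list (map (right_mult A \<sigma>) v)"
  proof (rule endo_eqI)
    fix P
    show "apply_endo (prod_list (map (right_mult A \<sigma>) u)) P =
        apply_endo (prod_list (map (right_mult A \<sigma>) v)) P"
    proof (cases "P \<in> lists A // \<sigma>")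
      case True
      then obtain w where "w \<in> lists A" "P = \<sigma> `` {w}" by (auto simp: quotient_def)
      then show ?thesis
        using right_mult_class[OF assms(1)] assms cong(2)[OF uv] equiv_class_eq[OF cong(1)] by auto
    qed (simp add: right_mult_outside)
  qed
qed

definition word_kernel :: "'a set \<Rightarrow> ('a list \<Rightarrow> 'b) \<Rightarrow> ('a list \<times> 'a list) set" where
  "word_kernel A f = {(u, v). u \<in> lists A \<and> v \<in> lists A \<and> f u = f v}"

lemma word_congruence_word_kernel:
  assumes "\<And>u v. f (u @ v) = m (f u) (f v)"
  shows "word_congruence A (word_kernel A f)"
  unfolding word_congruence_def word_kernel_def
  by (auto simp: assms intro!: equivI refl_onI symI transI)

lemma word_congruence_generated:
  assumes "R \<subseteq> lists A \<times> lists A"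
  shows "word_congruence A (generated_congruence A R)" "R \<subseteq> generated_congruence A R"
proof -
  have "word_congruence A (lists A \<times> lists A)"
    unfolding word_congruence_def by (auto intro!: equivI refl_onI symI transI)
  then have sub: "generated_congruence A R \<subseteq> lists A \<times> lists A"
    using assms unfolding generated_congruence_def by blast
  have D: "word_congruence A \<rho> \<Longrightarrow> refl_on (lists A) \<rho> \<and> sym \<rho> \<and> trans \<rho>" for \<rho> :: "('a list \<times> 'a list) set"
    by (meson word_congruenceD(1) equivE)
  have "equiv (lists A) (generated_congruence A R)"
  proof (rule equivI)
    show "generated_congruence A R \<subseteq> lists A \<times> lists A" by (rule sub)
    show "refl_on (lists A) (generated_congruence A R)"
      using D unfolding generated_congruence_def refl_on_def by blast
    show "sym (generated_congruence A R)"
      using D unfolding generated_congruence_def sym_def by blast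
    show "trans (generated_congruence A R)"
    proof (rule transI)
      fix u v w assume "(u, v) \<in> generated_congruence A R" "(v, w) \<in> generated_congruence A R"
      then show "(u, w) \<in> generated_congruence A R"
        using D unfolding generated_congruence_def by (blast dest: transD)
    qed
  qed
  moreover have "(w @ u, w @ v) \<in> generated_congruence A R \<and> (u @ w, v @ w) \<in> generated_congruence A R"
    if "(u, v) \<in> generated_congruence A R" "w \<in> lists A" for u v w
    using that word_congruenceD(2,3)[of A] unfolding generated_congruence_def by blast
  ultimately show "word_congruence A (generated_congruence A R)"
    unfolding word_congruence_def by blast
  show "R \<subseteq> generated_congruence A R" unfolding generated_congruence_def by blast
qed

lemma relations_alphabet:
  assumes "4 \<le> n" shows "relations n \<subseteq> lists (alphabet n) \<times> lists (alphabet n)"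
proof -
  define F G where "F = FN n" and "G = GN n"
  have FG: "n = F + G" "G \<le> F" "F \<le> G + 1" "2 \<le> G" using assms unfolding F_def G_def by presburger+
  note div = half_bounds[OF FG]
  have [simp]: "LH \<in> alphabet n" "LX \<in> alphabet n" "LE i \<in> alphabet n \<longleftrightarrow> i \<in> {2..F}"
    "LXi i \<in> alphabet n \<longleftrightarrow> i \<in> {1..F - 1}" "LYi i \<in> alphabet n \<longleftrightarrow> i \<in> {1..F - 1}" for i
    unfolding alphabet_def div by auto
  have [simp]: "set (es a b) = LE ` {a..b}" for a b by (auto simp: es_def)
  have 1: "V1 n \<union> V2 \<union> V3 \<union> V4 n \<union> V5 n \<union> V6 n \<union> V7 \<union> V8 n \<subseteq> lists (alphabet n) \<times> lists (alphabet n)"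
    unfolding V1_def V2_def V3_def V4_def V5_def V6_def V7_def V8_def div using FG(2-) by auto
  have 2: "V9 n \<union> V10 n \<union> V11 n \<union> V12 n \<subseteq> lists (alphabet n) \<times> lists (alphabet n)"
    unfolding V9_def V10_def V11_def V12_def div using FG(2-) by auto (linarith+)
  have es: "es a b \<in> lists (alphabet n)" if "2 \<le> a" "b \<le> F" for a b
    using that by auto
  have i: "i \<le> F" "i - 1 \<le> F" "2 \<le> n - 2 * i + 1" if "i \<in> {1..F - 1}" for i
    using that FG by auto
  have i2: "i \<in> {1..F - 1}" if "i \<in> {2..F - 1}" for i using that by auto
  have 13: "V13_x1 n \<in> lists (alphabet n)" "i \<in> {2..F - 1} \<Longrightarrow> V13_x n i \<in> lists (alphabet n)"
    "i \<in> {1..F - 1} \<Longrightarrow> V13_y n i \<in> lists (alphabet n)" "V14_rhs n \<in> lists (alphabet n)" for i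
    unfolding V13_x1_def V13_x_def V13_y_def V14_rhs_def div
    using FG(2-4) es i i2 by (simp_all del: in_listsD in_lists_conv_set add: replicate_LX_alphabet)
  have 3: "V13 n \<union> V14 n \<subseteq> lists (alphabet n) \<times> lists (alphabet n)"
    unfolding V13_def V14_def div using 13 FG(2-) by auto
  have 4: "Vbar0 \<union> Vbar1 n \<union> Vbar2 n \<subseteq> lists (alphabet n) \<times> lists (alphabet n)"
    unfolding Vbar0_def Vbar1_def Vbar2_def div using FG(2-) by auto
  show ?thesis using 1 2 3 4 unfolding relations_def by blast
qed

lemma generated_congruence_relations:
  assumes "4 \<le> n"
  shows "generated_congruence (alphabet n) (relations n) = word_kernel (alphabet n) (word_map n)"
proof
  let ?\<rho> = "generated_congruence (alphabet n) (relations n)"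
  note al = relations_alphabet[OF assms]
  note gen = word_congruence_generated[OF al]
  have "word_congruence (alphabet n) (word_kernel (alphabet n) (word_map n))"
    by (rule word_congruence_word_kernel) (rule word_map_append)
  moreover have "relations n \<subseteq> word_kernel (alphabet n) (word_map n)"
    using al word_map_relations[OF assms] by (auto simp: word_kernel_def)
  ultimately show sub: "?\<rho> \<subseteq> word_kernel (alphabet n) (word_map n)"
    unfolding generated_congruence_def by blast
  interpret faithful_model n "right_mult (alphabet n) ?\<rho>"
  proof
    fix u v assume "(u, v) \<in> relations n"
    then show "prod_list (map (right_mult (alphabet n) ?\<rho>) u) = prod_list (map (right_mult (alphabet n) ?\<rho>) v)"
      using gen al by (subst right_mult_eq_iff) auto
  next
    fix u v assume "u \<in> lists (alphabet n)" "v \<in> lists (alphabet n)"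
      "prod_list (map (right_mult (alphabet n) ?\<rho>) u) = prod_list (map (right_mult (alphabet n) ?\<rho>) v)"
    then have "(u, v) \<in> ?\<rho>" using right_mult_eq_iff[OF gen(1)] by blast
    then show "word_map n u = word_map n v" using sub by (auto simp: word_kernel_def)
  qed (rule assms)
  show "word_kernel (alphabet n) (word_map n) \<subseteq> ?\<rho>"
  proof
    fix r assume "r \<in> word_kernel (alphabet n) (word_map n)"
    then obtain u v where r: "r = (u, v)" "u \<in> lists (alphabet n)" "v \<in> lists (alphabet n)"
      "word_map n u = word_map n v" by (auto simp: word_kernel_def)
    then have "ev u = ev v" using ev_canon by metis
    then show "r \<in> ?\<rho>" using r right_mult_eq_iff[OF gen(1)] by blast
  qed
qed

definition dihedral_partial :: "nat \<Rightarrow> (nat \<rightharpoonup> nat) \<Rightarrow> bool" where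
  "dihedral_partial n \<alpha> \<longleftrightarrow> dom \<alpha> \<subseteq> {1..n} \<and> ran \<alpha> \<subseteq> {1..n} \<and>
    (\<exists>k. (\<forall>i j. \<alpha> i = Some j \<longrightarrow> int n dvd int j - int i - k) \<or>
         (\<forall>i j. \<alpha> i = Some j \<longrightarrow> int n dvd int j + int i - k))"

lemma rot_permutes: "0 < n \<Longrightarrow> rot n permutes {1..n}"
proof (rule bij_imp_permutes)
  assume "0 < n"
  then have "inj_on (rot n) {1..n}" "rot n ` {1..n} \<subseteq> {1..n}"
    by (auto simp: inj_on_def rot_def split: if_splits)
  then show "bij_betw (rot n) {1..n} {1..n}" by (simp add: bij_betw_def endo_inj_surj)
qed (auto simp: rot_def)

lemma flip_permutes: "flip n permutes {1..n}"
proof (rule bij_imp_permutes)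
  have "inj_on (flip n) {1..n}" "flip n ` {1..n} \<subseteq> {1..n}"
    by (auto simp: inj_on_def flip_def split: if_splits)
  then show "bij_betw (flip n) {1..n} {1..n}" by (simp add: bij_betw_def endo_inj_surj)
qed (auto simp: flip_def)

definition mod_affine :: "nat \<Rightarrow> (nat \<Rightarrow> nat) \<Rightarrow> bool" where
  "mod_affine n \<sigma> \<longleftrightarrow> (\<exists>k. (\<forall>i\<in>{1..n}. int n dvd int (\<sigma> i) - int i - k) \<or>
     (\<forall>i\<in>{1..n}. int n dvd int (\<sigma> i) + int i - k))"

lemma mod_affine_inv:
  assumes "\<sigma> permutes {1..n}" "mod_affine n \<sigma>" shows "mod_affine n (inv' \<sigma>)"
proof -
  have inv: "inv' \<sigma> i \<in> {1..n} \<and> \<sigma> (inv' \<sigma> i) = i" if "i \<in> {1..n}" for i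
    using that assms(1) by (metis permutes_inv permutes_in_image permutes_inverses(1))
  obtain k where "(\<forall>i\<in>{1..n}. int n dvd int (\<sigma> i) - int i - k) \<or>
     (\<forall>i\<in>{1..n}. int n dvd int (\<sigma> i) + int i - k)" using assms(2) by (auto simp: mod_affine_def)
  then show ?thesis
  proof
    assume *: "\<forall>i\<in>{1..n}. int n dvd int (\<sigma> i) - int i - k"
    have "int n dvd int (inv' \<sigma> i) - int i - (- k)" if "i \<in> {1..n}" for i
      using *[rule_format, of "inv' \<sigma> i"] inv[OF that] by (simp add: dvd_diff_commute algebra_simps)
    then show ?thesis unfolding mod_affine_def by blast
  next
    assume *: "\<forall>i\<in>{1..n}. int n dvd int (\<sigma> i) + int i - k"
    have "int n dvd int (inv' \<sigma> i) + int i - k" if "i \<in> {1..n}" for i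
      using *[rule_format, of "inv' \<sigma> i"] inv[OF that] by (simp add: add.commute)
    then show ?thesis unfolding mod_affine_def by blast
  qed
qed

lemma mod_affine_comp:
  assumes "\<sigma> permutes {1..n}" "\<tau> permutes {1..n}" "mod_affine n \<sigma>" "mod_affine n \<tau>"
  shows "mod_affine n (\<tau> \<circ> \<sigma>)"
proof -
  have im: "\<sigma> i \<in> {1..n}" if "i \<in> {1..n}" for i using that assms(1) by (metis permutes_in_image)
  obtain k where k: "(\<forall>i\<in>{1..n}. int n dvd int (\<sigma> i) - int i - k) \<or>
     (\<forall>i\<in>{1..n}. int n dvd int (\<sigma> i) + int i - k)" using assms(3) by (auto simp: mod_affine_def)
  obtain l where l: "(\<forall>i\<in>{1..n}. int n dvd int (\<tau> i) - int i - l) \<or>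
     (\<forall>i\<in>{1..n}. int n dvd int (\<tau> i) + int i - l)" using assms(4) by (auto simp: mod_affine_def)
  from k l show ?thesis
  proof (elim disjE)
    assume *: "\<forall>i\<in>{1..n}. int n dvd int (\<sigma> i) - int i - k" "\<forall>i\<in>{1..n}. int n dvd int (\<tau> i) - int i - l"
    have "int n dvd int ((\<tau> \<circ> \<sigma>) i) - int i - (k + l)" if "i \<in> {1..n}" for i
      using dvd_add[OF *(1)[rule_format, OF that] *(2)[rule_format, OF im[OF that]]] by (simp add: algebra_simps)
    then show ?thesis unfolding mod_affine_def by blast
  next
    assume *: "\<forall>i\<in>{1..n}. int n dvd int (\<sigma> i) - int i - k" "\<forall>i\<in>{1..n}. int n dvd int (\<tau> i) + int i - l"
    have "int n dvd int ((\<tau> \<circ> \<sigma>) i) + int i - (l - k)" if "i \<in> {1..n}" for i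
      using dvd_diff[OF *(2)[rule_format, OF im[OF that]] *(1)[rule_format, OF that]] by (simp add: algebra_simps)
    then show ?thesis unfolding mod_affine_def by blast
  next
    assume *: "\<forall>i\<in>{1..n}. int n dvd int (\<sigma> i) + int i - k" "\<forall>i\<in>{1..n}. int n dvd int (\<tau> i) - int i - l"
    have "int n dvd int ((\<tau> \<circ> \<sigma>) i) + int i - (k + l)" if "i \<in> {1..n}" for i
      using dvd_add[OF *(1)[rule_format, OF that] *(2)[rule_format, OF im[OF that]]] by (simp add: algebra_simps)
    then show ?thesis unfolding mod_affine_def by blast
  next
    assume *: "\<forall>i\<in>{1..n}. int n dvd int (\<sigma> i) + int i - k" "\<forall>i\<in>{1..n}. int n dvd int (\<tau> i) + int i - l"
    have "int n dvd int ((\<tau> \<circ> \<sigma>) i) - int i - (l - k)" if "i \<in> {1..n}" for i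
      using dvd_diff[OF *(2)[rule_format, OF im[OF that]] *(1)[rule_format, OF that]] by (simp add: algebra_simps)
    then show ?thesis unfolding mod_affine_def by blast
  qed
qed

lemma dihedral_mod_affine:
  assumes "0 < n" "\<sigma> \<in> dihedral n"
  shows "\<sigma> permutes {1..n} \<and> mod_affine n \<sigma>"
proof -
  have rot: "mod_affine n (rot n)"
    unfolding mod_affine_def by (intro exI[of _ 1] disjI1) (auto simp: rot_def)
  have flip: "mod_affine n (flip n)"
    unfolding mod_affine_def by (intro exI[of _ "int n + 1"] disjI2) (auto simp: flip_def)
  have gen: "\<sigma> permutes {1..n} \<and> mod_affine n \<sigma>" if "\<sigma> \<in> {rot n, flip n}" for \<sigma>
    using that rot flip rot_permutes[OF assms(1)] flip_permutes by auto
  from assms(2) show ?thesis unfolding dihedral_def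
  proof (induction rule: generate.induct)
    case one
    have "mod_affine n id" unfolding mod_affine_def by (intro exI[of _ 0]) auto
    then show ?case unfolding sym_group_one using permutes_id by blast
  next
    case (incl p)
    then show ?case by (rule gen)
  next
    case (inv p)
    then have p: "p permutes {1..n} \<and> mod_affine n p" by (rule gen)
    then have "inv\<^bsub>sym_group n\<^esub> p = inv' p"
      by (intro sym_group_inv_equality) (simp add: sym_group_carrier)
    then show ?case using p mod_affine_inv permutes_inv by metis
  next
    case (eng p q)
    then show ?case unfolding sym_group_mult using mod_affine_comp permutes_compose by blast
  qed
qed

lemma DI_dihedral_partial: assumes "0 < n" "\<alpha> \<in> DI n" shows "dihedral_partial n \<alpha>"
proof -
  obtain \<sigma> A where \<sigma>: "\<sigma> \<in> dihedral n" "A \<subseteq> {1..n}" "\<alpha> = (\<lambda>i. if i \<in> A then Some (\<sigma> i) else None)"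
    using assms(2) by (auto simp: DI_def)
  note d = dihedral_mod_affine[OF assms(1) \<sigma>(1)]
  then have "\<sigma> i \<in> {1..n}" if "i \<in> A" for i using that \<sigma>(2) by (metis permutes_in_image subsetD)
  then have "ran \<alpha> \<subseteq> {1..n}" by (auto simp: \<sigma>(3) ran_def split: if_splits)
  moreover have "dom \<alpha> \<subseteq> {1..n}" using \<sigma> by (auto split: if_splits)
  moreover obtain k where "(\<forall>i\<in>{1..n}. int n dvd int (\<sigma> i) - int i - k) \<or>
     (\<forall>i\<in>{1..n}. int n dvd int (\<sigma> i) + int i - k)" using d by (auto simp: mod_affine_def)
  then have "(\<forall>i j. \<alpha> i = Some j \<longrightarrow> int n dvd int j - int i - k) \<or>
         (\<forall>i j. \<alpha> i = Some j \<longrightarrow> int n dvd int j + int i - k)"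
    using \<sigma>(2) unfolding \<sigma>(3) by (metis option.distinct(1) option.inject subsetD)
  ultimately show ?thesis unfolding dihedral_partial_def by blast
qed

section \<open>The monotone dihedral inverse monoid\<close>

lemma dihedral_partial_h:
  assumes "dihedral_partial n \<alpha>"
  shows "dihedral_partial n (\<lambda>i. map_option (\<lambda>j. n + 1 - j) (\<alpha> i))"
proof -
  let ?\<beta> = "\<lambda>i. map_option (\<lambda>j. n + 1 - j) (\<alpha> i)"
  have ran: "1 \<le> j \<and> j \<le> n" if "\<alpha> i = Some j" for i j
    using assms that by (auto simp: dihedral_partial_def ran_def subset_iff)
  obtain k where "(\<forall>i j. \<alpha> i = Some j \<longrightarrow> int n dvd int j - int i - k) \<or>
         (\<forall>i j. \<alpha> i = Some j \<longrightarrow> int n dvd int j + int i - k)" using assms by (auto simp: dihedral_partial_def)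
  then have "\<exists>k. (\<forall>i j. ?\<beta> i = Some j \<longrightarrow> int n dvd int j - int i - k) \<or>
         (\<forall>i j. ?\<beta> i = Some j \<longrightarrow> int n dvd int j + int i - k)"
  proof
    assume *: "\<forall>i j. \<alpha> i = Some j \<longrightarrow> int n dvd int j - int i - k"
    have "int n dvd int l + int i - (n + 1 - k)" if "?\<beta> i = Some l" for i l
    proof -
      from that obtain j where j: "\<alpha> i = Some j" "l = n + 1 - j" by auto
      then have "int l + int i - (n + 1 - k) = - (int j - int i - k)" using ran[OF j(1)] by auto
      then show ?thesis using * j by (metis dvd_minus_iff)
    qed
    then show ?thesis by blast
  next
    assume *: "\<forall>i j. \<alpha> i = Some j \<longrightarrow> int n dvd int j + int i - k"
    have "int n dvd int l - int i - (n + 1 - k)" if "?\<beta> i = Some l" for i l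
    proof -
      from that obtain j where j: "\<alpha> i = Some j" "l = n + 1 - j" by auto
      then have "int l - int i - (n + 1 - k) = - (int j + int i - k)" using ran[OF j(1)] by auto
      then show ?thesis using * j by (metis dvd_minus_iff)
    qed
    then show ?thesis by blast
  qed
  moreover have "dom ?\<beta> \<subseteq> {1..n}" "ran ?\<beta> \<subseteq> {1..n}"
    using assms ran by (fastforce simp: dihedral_partial_def ran_def)+
  ultimately show ?thesis unfolding dihedral_partial_def by blast
qed

lemma dvd_bounded_eq_0: "int n dvd z \<Longrightarrow> \<bar>z\<bar> < int n \<Longrightarrow> z = 0"
  using zdvd_imp_le[of "int n" "\<bar>z\<bar>"] by auto

lemma dvd_between: assumes "int n dvd z" "0 < z" "z < 2 * int n" shows "z = int n"
  using dvd_bounded_eq_0[of n "z - int n"] assms by auto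

lemma order_preserving_word:
  assumes n: "4 \<le> n" and dih: "dihedral_partial n \<alpha>" and op: "order_preserving \<alpha>"
  shows "\<exists>w. op_word n w \<and> word_map n w = \<alpha>"
proof -
  define D where "D = dom \<alpha>"
  define f where "f i = the (\<alpha> i)" for i
  have \<alpha>: "\<alpha> = (\<lambda>i. if i \<in> D then Some (f i) else None)"
    by (auto simp: fun_eq_iff D_def f_def)
  have D: "1 \<le> i \<and> i \<le> n" if "i \<in> D" for i using dih that by (auto simp: dihedral_partial_def D_def)
  have ran: "1 \<le> f i \<and> f i \<le> n" if "i \<in> D" for i
    using dih that by (auto simp: dihedral_partial_def D_def f_def ran_def subset_iff)
  have fin: "finite D" using D by (intro finite_subset[of D "{1..n}"]) auto
  obtain k where k: "(\<forall>i\<in>D. int n dvd int (f i) - int i - k) \<or> (\<forall>i\<in>D. int n dvd int (f i) + int i - k)"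
    using dih unfolding dihedral_partial_def D_def f_def by (metis domD option.sel)
  have tr2: "int n dvd (int (f j) - int (f i)) - (int j - int i)"
    if "i \<in> D" "j \<in> D" "\<forall>i\<in>D. int n dvd int (f i) - int i - k" for i j
    using dvd_diff[OF that(3)[rule_format, OF that(2)] that(3)[rule_format, OF that(1)]]
    by (simp add: algebra_simps)
  have tr3: "int n dvd (int (f j) - int (f i)) + (int j - int i)"
    if "i \<in> D" "j \<in> D" "\<forall>i\<in>D. int n dvd int (f i) + int i - k" for i j
    using dvd_diff[OF that(3)[rule_format, OF that(2)] that(3)[rule_format, OF that(1)]]
    by (simp add: algebra_simps)
  have tr: "int n dvd (int (f j) - int (f i)) - (int j - int i) \<or>
      int n dvd (int (f j) - int (f i)) + (int j - int i)" if "i \<in> D" "j \<in> D" for i j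
    using k tr2[OF that] tr3[OF that] by blast
  have mono: "f i < f j" if "i \<in> D" "j \<in> D" "i < j" for i j
  proof -
    have "f i \<le> f j" using op that by (auto simp: order_preserving_def D_def f_def)
    moreover have "f i \<noteq> f j"
    proof
      assume "f i = f j"
      then have "int n dvd int j - int i" using tr[OF that(1,2)] by (auto simp: dvd_diff_commute)
      then show False using zdvd_imp_le[of "int n" "int j - int i"] D[OF that(1)] D[OF that(2)] that(3) by auto
    qed
    ultimately show ?thesis by simp
  qed
  have translation: "\<exists>w. op_word n w \<and> word_map n w = \<alpha>"
    if t: "\<And>i. i \<in> D \<Longrightarrow> int (f i) = int i + t" for t
  proof (cases "0 \<le> t")
    case True
    define s where "s = nat t"
    have f: "f i = i + s" if "i \<in> D" for i using t[OF that] True by (simp add: s_def)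
    let ?w = "P_word n ({1..n} - D) @ replicate s LX"
    have "i \<in> {1..n - s} - ({1..n} - D) \<longleftrightarrow> i \<in> D" for i using D[of i] ran[of i] f[of i] by auto
    then have "word_map n ?w = (\<lambda>i. if i \<in> D then Some (i + s) else None)"
      unfolding word_map_trans_x[OF n Diff_subset] by (simp only:)
    also have "\<dots> = \<alpha>" unfolding \<alpha> by (rule ext) (simp add: f)
    finally have "word_map n ?w = \<alpha>" .
    moreover have "op_word n ?w" by (rule op_wordI) (rule Diff_subset)
    ultimately show ?thesis by blast
  next
    case False
    define s where "s = nat (- t)"
    have f: "f i = i - s \<and> s < i" if "i \<in> D" for i using t[OF that] ran[OF that] False by (auto simp: s_def)
    let ?w = "P_word n ({1..n} - D) @ y_word s"
    have "i \<in> {s + 1..n} - ({1..n} - D) \<longleftrightarrow> i \<in> D" for i using D[of i] f[of i] by auto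
    then have "word_map n ?w = (\<lambda>i. if i \<in> D then Some (i - s) else None)"
      unfolding word_map_trans_y[OF n Diff_subset] by (simp only:)
    also have "\<dots> = \<alpha>" unfolding \<alpha> by (rule ext) (simp add: f)
    finally have "word_map n ?w = \<alpha>" .
    moreover have "op_word n ?w" by (rule op_wordI) (rule Diff_subset)
    ultimately show ?thesis by blast
  qed
  show ?thesis
  proof (cases "D = {}")
    case True
    then show ?thesis using translation by blast
  next
    case False
    define a where "a = Min D"
    define b where "b = Max D"
    have ab: "a \<in> D" "b \<in> D" using fin False by (auto simp: a_def b_def)
    have le: "a \<le> i \<and> i \<le> b" if "i \<in> D" for i using fin that by (auto simp: a_def b_def)
    from k show ?thesis
    proof
      assume *: "\<forall>i\<in>D. int n dvd int (f i) - int i - k"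
      have "int (f i) = int i + (int (f a) - int a)" if "i \<in> D" for i
      proof (cases "i = a")
        case False
        then have "a < i" using le[OF that] by simp
        then have "f a < f i" using mono ab that by blast
        then have "(int (f i) - int (f a)) - (int i - int a) = 0"
          using tr2[OF ab(1) that *] ran[OF that] ran[OF ab(1)] D[OF that] D[OF ab(1)] \<open>a < i\<close>
          by (intro dvd_bounded_eq_0[of n]) auto
        then show ?thesis by simp
      qed simp
      then show ?thesis by (rule translation)
    next
      assume *: "\<forall>i\<in>D. int n dvd int (f i) + int i - k"
      have sum: "(int (f j) - int (f i)) + (int j - int i) = int n" if "i \<in> D" "j \<in> D" "i < j" for i j
        using tr3[OF that(1,2) *] mono[OF that] ran[OF that(1)] ran[OF that(2)] D[OF that(1)]
          D[OF that(2)] that(3) by (intro dvd_between) auto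
      show ?thesis
      proof (cases "a = b")
        case True
        then have "i = a" if "i \<in> D" for i using le[OF that] by simp
        then show ?thesis by (intro translation[of "int (f a) - int a"]) auto
      next
        case False
        then have "a < b" using le[OF ab(1)] by simp
        note s = sum[OF ab \<open>a < b\<close>]
        have two: "i = a \<or> i = b" if "i \<in> D" for i
        proof (rule ccontr)
          assume "\<not> (i = a \<or> i = b)"
          then have "a < i" "i < b" using le[OF that] by auto
          then show False using sum[OF ab(1) that] sum[OF that ab(2)] s ran[OF ab(1)] ran[OF ab(2)]
              D[OF ab(1)] D[OF ab(2)] n by linarith
        qed
        show ?thesis
        proof (cases "2 * (b - a) = n")
          case True
          then have "int (f b) - int (f a) = int b - int a" using s \<open>a < b\<close> by linarith
          then have "int (f i) = int i + (int (f a) - int a)" if "i \<in> D" for i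
            using two[OF that] by auto
          then show ?thesis by (rule translation)
        next
          case False
          define p i q where "p = a - 1" and "i = b - a" and "q = f a - 1"
          have bounds: "1 \<le> a" "b \<le> n" "1 \<le> f a" "f b \<le> n" using D ran ab by auto
          have idx: "(p, i, q) \<in> EXC_index n"
            using False bounds s \<open>a < b\<close> unfolding EXC_index_def Z_index_def p_def i_def q_def by auto
          have eqs: "p + 1 = a" "p + i + 1 = b" "q + 1 = f a" "n + 1 - i + q = f b"
            using bounds s \<open>a < b\<close> by (auto simp: p_def i_def q_def)
          let ?w = "y_word p @ Z_word n i @ replicate q LX"
          have "word_map n ?w = \<alpha>"
            unfolding word_map_exc[OF idx] eqs by (subst \<alpha>) (use two ab in \<open>auto simp: fun_eq_iff\<close>)
          moreover have "op_word n ?w" by (rule op_wordI(3)[OF idx])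
          ultimately show ?thesis by blast
        qed
      qed
    qed
  qed
qed

lemma carrier_MDI: "carrier (MDI n) = {\<alpha> \<in> DI n. order_preserving \<alpha> \<or> order_reversing \<alpha>}"
  by (simp add: MDI_def)

lemma mult_MDI: "\<alpha> \<otimes>\<^bsub>MDI n\<^esub> \<beta> = \<beta> \<circ>\<^sub>m \<alpha>"
  by (simp add: MDI_def sym_inv_monoid_def)

lemma MDI_subset_word_map:
  assumes n: "4 \<le> n" and \<alpha>: "\<alpha> \<in> carrier (MDI n)"
  shows "\<alpha> \<in> word_map n ` lists (alphabet n)"
proof -
  have dih: "dihedral_partial n \<alpha>" using \<alpha> n by (intro DI_dihedral_partial) (auto simp: carrier_MDI)
  consider "order_preserving \<alpha>" | "order_reversing \<alpha>" using \<alpha> by (auto simp: carrier_MDI)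
  then show ?thesis
  proof cases
    case 1
    then show ?thesis using order_preserving_word[OF n dih] op_word_alphabet[OF n] by blast
  next
    case 2
    let ?\<beta> = "\<lambda>i. map_option (\<lambda>j. n + 1 - j) (\<alpha> i)"
    have "order_preserving ?\<beta>"
      using 2 unfolding order_preserving_def order_reversing_def by (fastforce simp: dom_def)
    then obtain w where w: "op_word n w" "word_map n w = ?\<beta>"
      using order_preserving_word[OF n dihedral_partial_h[OF dih]] by blast
    have "word_map n (w @ [LH]) = \<alpha>"
    proof
      fix i
      have "ran \<alpha> \<subseteq> {1..n}" using dih by (simp add: dihedral_partial_def)
      then show "word_map n (w @ [LH]) i = \<alpha> i"
        unfolding word_map_h[OF n] w(2) by (cases "\<alpha> i") (auto simp: ran_def)
    qed
    moreover have "w @ [LH] \<in> lists (alphabet n)"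
      using op_word_alphabet[OF n w(1)] by (auto simp: alphabet_def)
    ultimately show ?thesis by blast
  qed
qed

lemma DI_comp:
  assumes "\<alpha> \<in> DI n" "\<beta> \<in> DI n" shows "\<beta> \<circ>\<^sub>m \<alpha> \<in> DI n"
proof -
  obtain \<sigma> A \<tau> B where *: "\<sigma> \<in> dihedral n" "A \<subseteq> {1..n}" "\<alpha> = (\<lambda>i. if i \<in> A then Some (\<sigma> i) else None)"
    "\<tau> \<in> dihedral n" "\<beta> = (\<lambda>i. if i \<in> B then Some (\<tau> i) else None)"
    using assms unfolding DI_def by blast
  then have "\<tau> \<circ> \<sigma> \<in> dihedral n"
    using generate.eng[of \<tau> "sym_group n" _ \<sigma>] by (simp add: dihedral_def sym_group_mult)
  moreover have "{i \<in> A. \<sigma> i \<in> B} \<subseteq> {1..n}" using * by auto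
  moreover have "\<beta> \<circ>\<^sub>m \<alpha> = (\<lambda>i. if i \<in> {i \<in> A. \<sigma> i \<in> B} then Some ((\<tau> \<circ> \<sigma>) i) else None)"
    using * by (auto simp: map_comp_def)
  ultimately show ?thesis unfolding DI_def by blast
qed

lemma monotone_iff:
  "order_preserving \<alpha> \<longleftrightarrow> (\<forall>a b c d. \<alpha> a = Some c \<longrightarrow> \<alpha> b = Some d \<longrightarrow> a \<le> b \<longrightarrow> c \<le> d)"
  "order_reversing \<alpha> \<longleftrightarrow> (\<forall>a b c d. \<alpha> a = Some c \<longrightarrow> \<alpha> b = Some d \<longrightarrow> a \<le> b \<longrightarrow> d \<le> c)"
proof -
  have *: "(\<forall>a\<in>dom \<alpha>. \<forall>b\<in>dom \<alpha>. a \<le> b \<longrightarrow> P (the (\<alpha> a)) (the (\<alpha> b))) \<longleftrightarrow>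
    (\<forall>a b c d. \<alpha> a = Some c \<longrightarrow> \<alpha> b = Some d \<longrightarrow> a \<le> b \<longrightarrow> P c d)" for P :: "nat \<Rightarrow> nat \<Rightarrow> bool"
    by (auto simp: dom_def) fastforce
  show "order_preserving \<alpha> \<longleftrightarrow> (\<forall>a b c d. \<alpha> a = Some c \<longrightarrow> \<alpha> b = Some d \<longrightarrow> a \<le> b \<longrightarrow> c \<le> d)"
    "order_reversing \<alpha> \<longleftrightarrow> (\<forall>a b c d. \<alpha> a = Some c \<longrightarrow> \<alpha> b = Some d \<longrightarrow> a \<le> b \<longrightarrow> d \<le> c)"
    unfolding order_preserving_def order_reversing_def
    using *[of "(\<le>)"] *[of "\<lambda>c d. d \<le> c"] by simp_all
qed

lemma monotone_comp:
  assumes "order_preserving \<alpha> \<or> order_reversing \<alpha>" "order_preserving \<beta> \<or> order_reversing \<beta>"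
  shows "order_preserving (\<beta> \<circ>\<^sub>m \<alpha>) \<or> order_reversing (\<beta> \<circ>\<^sub>m \<alpha>)"
  using assms unfolding monotone_iff map_comp_Some_iff by meson

lemma MDI_closed: "\<alpha> \<in> carrier (MDI n) \<Longrightarrow> \<beta> \<in> carrier (MDI n) \<Longrightarrow> \<beta> \<circ>\<^sub>m \<alpha> \<in> carrier (MDI n)"
  using DI_comp monotone_comp by (simp add: carrier_MDI)

lemma MDI_I:
  assumes "\<sigma> \<in> dihedral n" "A \<subseteq> {1..n}" "\<alpha> = (\<lambda>i. if i \<in> A then Some (\<sigma> i) else None)"
    "order_preserving \<alpha> \<or> order_reversing \<alpha>"
  shows "\<alpha> \<in> carrier (MDI n)"
  using assms unfolding carrier_MDI DI_def by blast

lemma word_map_letter_MDI: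
  assumes n: "4 \<le> n" and a: "a \<in> alphabet n"
  shows "word_map n [a] \<in> carrier (MDI n)"
proof -
  have rot: "rot n \<in> dihedral n" and flip: "flip n \<in> dihedral n"
    by (auto simp: dihedral_def intro: generate.incl)
  have id: "id \<in> dihedral n" using generate.one[of "sym_group n"] by (simp add: dihedral_def sym_group_one)
  have refl: "rot n \<circ> flip n \<in> dihedral n"
    using generate.eng[of "rot n" "sym_group n" _ "flip n"] rot flip
    by (simp add: dihedral_def sym_group_mult)
  show ?thesis
  proof (cases a)
    case LH
    then show ?thesis using n
      by (intro MDI_I[OF flip, of "{1..n}"]) (auto simp: flip_def fun_eq_iff monotone_iff split: if_splits)
  next
    case LX
    then show ?thesis using n
      by (intro MDI_I[OF rot, of "{1..n - 1}"]) (auto simp: rot_def fun_eq_iff monotone_iff split: if_splits)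
  next
    case (LE j)
    then show ?thesis
      by (intro MDI_I[OF id, of "{1..n} - {j}"]) (auto simp: fun_eq_iff monotone_iff split: if_splits)
  next
    case (LXi j)
    then have "1 \<le> j" "j < n" using a n by (auto simp: alphabet_def)
    with LXi show ?thesis using n
      by (intro MDI_I[OF refl, of "{1, j + 1}"])
        (auto simp: fun_eq_iff monotone_iff rot_def flip_def split: if_splits)
  next
    case (LYi j)
    then have "1 \<le> j" "j < n" using a n by (auto simp: alphabet_def)
    with LYi show ?thesis using n
      by (intro MDI_I[OF refl, of "{1, n + 1 - j}"])
        (auto simp: fun_eq_iff monotone_iff rot_def flip_def split: if_splits)
  qed
qed

lemma word_map_image:
  assumes n: "4 \<le> n"
  shows "word_map n ` lists (alphabet n) = carrier (MDI n)"
proof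
  have "word_map n w \<in> carrier (MDI n)" if "w \<in> lists (alphabet n)" for w
    using that
  proof (induction w rule: rev_induct)
    case Nil
    have "id \<in> dihedral n" using generate.one[of "sym_group n"] by (simp add: dihedral_def sym_group_one)
    then show ?case
      by (rule MDI_I[of _ _ "{1..n}"]) (auto simp: monotone_iff split: if_splits)
  next
    case (snoc a w)
    then show ?case using MDI_closed word_map_letter_MDI[OF n] by (simp add: word_map_append del: word_map.simps)
  qed
  then show "word_map n ` lists (alphabet n) \<subseteq> carrier (MDI n)" by blast
qed (use MDI_subset_word_map[OF n] in blast)

lemma word_kernel_quotient_iso:
  fixes M (structure) and f :: "'a list \<Rightarrow> 'm"
  assumes im: "f ` lists A = carrier M" and hom: "\<And>u v. f (u @ v) = f u \<otimes> f v"
  shows "M \<cong> word_quotient A (word_kernel A f)"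
proof -
  let ?K = "word_kernel A f"
  define F where "F \<alpha> = {w \<in> lists A. f w = \<alpha>}" for \<alpha>
  have F: "F (f w) = ?K `` {w}" if "w \<in> lists A" for w
    using that by (auto simp: F_def word_kernel_def)
  have mult: "P \<otimes>\<^bsub>word_quotient A ?K\<^esub> Q = (\<Union>u\<in>P. \<Union>v\<in>Q. ?K `` {u @ v})" for P Q
    by (simp add: word_quotient_def)
  have car: "carrier (word_quotient A ?K) = lists A // ?K" by (simp add: word_quotient_def)
  have "F \<in> iso M (word_quotient A ?K)"
    unfolding iso_def
  proof (intro CollectI conjI homI)
    fix \<alpha> assume "\<alpha> \<in> carrier M"
    then obtain u where "u \<in> lists A" "\<alpha> = f u" using im by blast
    then show "F \<alpha> \<in> carrier (word_quotient A ?K)" unfolding car by (auto simp: F quotientI)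
  next
    fix \<alpha> \<beta> assume "\<alpha> \<in> carrier M" "\<beta> \<in> carrier M"
    then obtain u v where u: "u \<in> lists A" "\<alpha> = f u" and v: "v \<in> lists A" "\<beta> = f v" using im by blast
    have "?K `` {p @ q} = ?K `` {u @ v}" if "p \<in> F \<alpha>" "q \<in> F \<beta>" for p q
      using that u v by (auto simp: F_def word_kernel_def hom)
    moreover have "u \<in> F \<alpha>" "v \<in> F \<beta>" using u v by (auto simp: F_def)
    ultimately have "(\<Union>p\<in>F \<alpha>. \<Union>q\<in>F \<beta>. ?K `` {p @ q}) = ?K `` {u @ v}" by blast
    moreover have "F (\<alpha> \<otimes> \<beta>) = ?K `` {u @ v}" using u v F[of "u @ v"] by (simp add: hom)
    ultimately show "F (\<alpha> \<otimes> \<beta>) = F \<alpha> \<otimes>\<^bsub>word_quotient A ?K\<^esub> F \<beta>" unfolding mult by simp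
  next
    show "bij_betw F (carrier M) (carrier (word_quotient A ?K))"
      unfolding bij_betw_def car
    proof
      show "inj_on F (carrier M)" unfolding im[symmetric] by (auto simp: inj_on_def F_def)
      show "F ` carrier M = lists A // ?K"
        unfolding im[symmetric] image_image using F by (auto simp: quotient_def)
    qed
  qed
  then show ?thesis by (rule is_isoI)
qed

theorem MDI_presentation:
  assumes n: "4 \<le> n"
  shows "defined_by_presentation (MDI n) (alphabet n) (relations n)"
  unfolding defined_by_presentation_def generated_congruence_relations[OF n]
  using relations_alphabet[OF n] word_map_image[OF n]
  by (auto intro!: word_kernel_quotient_iso simp: mult_MDI word_map_append)

section \<open>Counting the relations\<close>

definition has_card :: "'a set \<Rightarrow> nat \<Rightarrow> bool" where
  "has_card S k \<longleftrightarrow> finite S \<and> card S = k"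

lemma has_card_Un: "has_card A a \<Longrightarrow> has_card B b \<Longrightarrow> A \<inter> B = {} \<Longrightarrow> has_card (A \<union> B) (a + b)"
  by (simp add: has_card_def card_Un_disjoint)

lemma has_card_image: "has_card A a \<Longrightarrow> inj_on f A \<Longrightarrow> has_card (f ` A) a"
  by (simp add: has_card_def card_image)

lemma has_card_insert: "has_card A a \<Longrightarrow> x \<notin> A \<Longrightarrow> has_card (insert x A) (Suc a)"
  by (simp add: has_card_def)

lemma has_card_empty: "has_card {} 0"
  by (simp add: has_card_def)

lemma has_card_rel:
  assumes "has_card A a" "inj_on u A"
  shows "has_card {(u i, v i) | i. i \<in> A} a"
proof -
  have "{(u i, v i) | i. i \<in> A} = (\<lambda>i. (u i, v i)) ` A" by auto
  then show ?thesis using assms has_card_image[of A a "\<lambda>i. (u i, v i)"] by (auto simp: inj_on_def)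
qed

lemma has_card_rel2:
  assumes "has_card {(i, j). P i j} a" "\<And>i j i' j'. P i j \<Longrightarrow> P i' j' \<Longrightarrow> u i j = u i' j' \<Longrightarrow> i = i' \<and> j = j'"
  shows "has_card {(u i j, v i j) | i j. P i j} a"
proof -
  have "{(u i j, v i j) | i j. P i j} = (\<lambda>(i, j). (u i j, v i j)) ` {(i, j). P i j}" by auto
  then show ?thesis using assms(2) has_card_image[OF assms(1), of "\<lambda>(i, j). (u i j, v i j)"]
    by (auto simp: inj_on_def)
qed

lemma has_card_interval: "b + 1 = a + k \<Longrightarrow> has_card {a..b} k" for a b k :: nat
  by (simp add: has_card_def)

lemma has_card_product: "has_card A a \<Longrightarrow> has_card B b \<Longrightarrow> has_card {(i, j). i \<in> A \<and> j \<in> B} (a * b)"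
  using card_cartesian_product[of A B] finite_cartesian_product[of A B]
  by (simp add: has_card_def Collect_case_prod_Sigma)

lemma has_card_product_minus:
  assumes "has_card A a" "has_card B b" "has_card C c" "inj_on f C" "f ` C \<subseteq> A \<times> B"
    "\<And>i j. i \<in> A \<Longrightarrow> j \<in> B \<Longrightarrow> Q i j \<longleftrightarrow> (i, j) \<notin> f ` C"
  shows "has_card {(i, j). i \<in> A \<and> j \<in> B \<and> Q i j} (a * b - c)"
proof -
  have "{(i, j). i \<in> A \<and> j \<in> B \<and> Q i j} = A \<times> B - f ` C" using assms(6) by auto
  then show ?thesis using assms(1-5)
    by (simp add: has_card_def card_Diff_subset finite_subset card_image)
qed

lemma sum_upto: "2 * (\<Sum>j = 2..f + 1. j - 2) = f * (f - 1)" for f :: nat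
proof (induction f)
  case (Suc f)
  then show ?case by (cases f) (auto simp: algebra_simps)
qed simp

lemma has_card_less: "has_card {(i, j). i \<in> {2..f + 1} \<and> j \<in> {2..f + 1} \<and> i < j} (f * (f - 1) div 2)" for f :: nat
proof -
  have "{(i, j). i \<in> {2..f + 1} \<and> j \<in> {2..f + 1} \<and> i < j} = prod.swap ` (SIGMA j:{2..f + 1}. {2..<j})"
    by (auto simp: image_iff)
  moreover have "card (SIGMA j:{2..f + 1}. {2..<j}) = f * (f - 1) div 2"
    using sum_upto[of f] by (subst card_SigmaI) auto
  ultimately show ?thesis by (simp add: has_card_def card_image)
qed

primrec letter_kind :: "letter \<Rightarrow> nat" where
  "letter_kind LH = 0" | "letter_kind LX = 1" | "letter_kind (LE i) = 2" | "letter_kind (LXi i) = 3" | "letter_kind (LYi i) = 4"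

text \<open>Left-hand sides of relations from different families are told apart by forgetting the indices of the
  letters.\<close>

definition shapes :: "word_relations \<Rightarrow> nat list set" where
  "shapes R = (\<lambda>r. map letter_kind (fst r)) ` R"

lemma shapes_Un: "shapes (A \<union> B) = shapes A \<union> shapes B"
  by (auto simp: shapes_def)

lemma shapes_disjoint: "shapes A \<inter> shapes B = {} \<Longrightarrow> A \<inter> B = {}"
  unfolding shapes_def by blast

context
  fixes n f g :: nat
  assumes fg: "n = f + g + 2" "g \<le> f" "f \<le> g + 1" "1 \<le> g"
begin

lemma half_bounds_shifted: "(n + 1) div 2 = f + 1" "n div 2 = g + 1" "(n - 1) div 2 = f" "(n - 2) div 2 = g"
  using fg by auto

lemmas has_card_intros = has_card_rel has_card_rel2 has_card_interval has_card_product has_card_insert has_card_empty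

lemma card_V1: "has_card (V1 n) f"
  unfolding V1_def half_bounds_shifted by (intro has_card_intros) (auto simp: inj_on_def)

lemma card_V4: "has_card (V4 n) (f * (f - 1) div 2 + f * g)"
  unfolding V4_def half_bounds_shifted
  by (intro has_card_Un has_card_intros has_card_less) auto

lemma card_V5: "has_card (V5 n) (f + f)"
  unfolding V5_def half_bounds_shifted by (intro has_card_Un has_card_intros) (auto simp: inj_on_def)

lemma card_V6: "has_card (V6 n) ((f - 1) + 1 + (g - 1))"
  unfolding V6_def half_bounds_shifted using fg
  by (intro has_card_Un has_card_intros[unfolded One_nat_def[symmetric]] has_card_insert[OF has_card_empty, unfolded One_nat_def[symmetric]]) (auto simp: inj_on_def)

lemma card_V9: "has_card (V9 n) (f + 1 + (f - 1))"
  unfolding V9_def half_bounds_shifted using fg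
  by (intro has_card_Un has_card_intros has_card_insert[OF has_card_empty, unfolded One_nat_def[symmetric]]) (auto simp: inj_on_def)

lemma card_ne: "has_card {(i, j). i \<in> {1..f} \<and> j \<in> {2..g + 1} \<and> j \<noteq> i} (f * g - (f - 1))"
  using fg by (intro has_card_product_minus[where C = "{2..f}" and f = "\<lambda>i. (i, i)"] has_card_intros) (auto simp: inj_on_def)

lemma card_ne_Suc: "has_card {(i, j). i \<in> {1..f} \<and> j \<in> {2..f + 1} \<and> j \<noteq> i + 1} (f * f - f)"
  using fg by (intro has_card_product_minus[where C = "{1..f}" and f = "\<lambda>i. (i, i + 1)"] has_card_intros) (auto simp: inj_on_def)

lemma card_V10: "has_card (V10 n) (f * f + f * f + (f * g - (f - 1)) + (f * g - (f - 1)))"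
  unfolding V10_def half_bounds_shifted by (intro has_card_Un has_card_intros card_ne) auto

lemma card_V11: "has_card (V11 n) ((f * f - f) + (f * f - f) + f * g + f * g)"
  unfolding V11_def half_bounds_shifted by (intro has_card_Un has_card_intros card_ne_Suc) auto

lemma card_V12: "has_card (V12 n) ((f - 1) + (f - 1) + (f - 1) + (f - 1) + Suc (Suc 0))"
  unfolding V12_def half_bounds_shifted using fg by (intro has_card_Un has_card_intros) (auto simp: inj_on_def)

lemma card_V13: "has_card (V13 n) (Suc (Suc 0) + (f - 1) + (f - 1) + f + f)"
  unfolding V13_def half_bounds_shifted using fg by (intro has_card_Un has_card_intros) (auto simp: inj_on_def)

lemma card_V14: "has_card (V14 n) (Suc (Suc (Suc (Suc 0))) + (f - 1) + (f - 1) + (f - 1) + (f - 1))"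
  unfolding V14_def half_bounds_shifted using fg by (intro has_card_Un has_card_intros) (auto simp: inj_on_def)

lemma card_Vbar1: "has_card (Vbar1 n) ((if odd n then 1 else 0) + f + f)"
  unfolding Vbar1_def half_bounds_shifted using fg
  by (intro has_card_Un has_card_intros) (auto simp: inj_on_def has_card_def)

lemma card_singles: "has_card V2 1" "has_card V3 1" "has_card V7 2" "has_card (V8 n) 1" "has_card Vbar0 1"
  "has_card (Vbar2 n) 1"
  by (simp_all add: V2_def V3_def V7_def V8_def Vbar0_def Vbar2_def has_card_def)

lemma card_W1: "has_card (V1 n \<union> V4 n) (f + (f * (f - 1) div 2 + f * g))"
  by (intro has_card_Un card_V1 card_V4) (auto simp: V1_def V4_def)

lemma card_W2: "has_card (V10 n \<union> V11 n \<union> V12 n \<union> V14 n)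
   ((f * f + f * f + (f * g - (f - 1)) + (f * g - (f - 1))) +
    ((f * f - f) + (f * f - f) + f * g + f * g) +
    ((f - 1) + (f - 1) + (f - 1) + (f - 1) + Suc (Suc 0)) +
    (Suc (Suc (Suc (Suc 0))) + (f - 1) + (f - 1) + (f - 1) + (f - 1)))"
  by (intro has_card_Un card_V10 card_V11 card_V12 card_V14)
    (auto simp: V10_def V11_def V12_def V14_def)

lemma shapes_W1: "shapes (V1 n \<union> V4 n) \<subseteq> {[2,2], [2,0,2,0]}"
  by (auto simp: shapes_def V1_def V4_def)

lemma shapes_W2: "shapes (V10 n \<union> V11 n \<union> V12 n \<union> V14 n) \<subseteq>
  {[3,2], [2,4], [3,0,2,0], [0,2,0,4], [2,3], [4,2], [0,2,0,3], [4,0,2,0],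
   [3,1,0,1,0], [1,0,1,0,3], [1,0,1,0,4], [4,1,0,1,0]}"
  by (auto simp: shapes_def V10_def V11_def V12_def V14_def)

lemma shapes_small:
  "shapes V2 \<subseteq> {[1,0,1,0,1]}" "shapes V3 \<subseteq> {[1,0,1,1,0,1,0]}"
  "shapes (V5 n) \<subseteq> {[1,0,1,0,2], [0,1,0,1,2]}" "shapes (V6 n) \<subseteq> {[1,2], [1,0,2,0]}"
  "shapes V7 \<subseteq> {[1,1,0,1,0], [0,1,0,1,1]}" "shapes (V9 n) \<subseteq> {[3,4], [4,3]}"
  "shapes (V13 n) \<subseteq> {[0,1,0,1,3], [3,0,1,0,1], [0,1,0,1,4], [4,0,1,0,1]}"
  "shapes Vbar0 \<subseteq> {[0,0]}" "shapes (Vbar1 n) \<subseteq> {[0,2], [0,3], [0,4]}"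
  by (auto simp: shapes_def V2_def V3_def V5_def V6_def V7_def V9_def V13_def Vbar0_def Vbar1_def split: if_splits)

lemma shapes_V8: "shapes (V8 n) \<subseteq> {s. length s = n + 7}"
  unfolding V8_def half_bounds_shifted using fg by (auto simp: shapes_def es_def)

lemma shapes_Vbar2: "shapes (Vbar2 n) \<subseteq> {s. length s = n + 3 \<and> hd s = 2}"
proof -
  have "[2..<Suc (f + 1)] = 2 # [3..<Suc (f + 1)]" using fg by (simp add: upt_conv_Cons)
  then show ?thesis unfolding Vbar2_def half_bounds_shifted using fg by (auto simp: shapes_def es_def simp del: upt_Suc)
qed

lemma card_relations_nat:
  "card (relations n) = (f + (f * (f - 1) div 2 + f * g)) +
   ((f * f + f * f + (f * g - (f - 1)) + (f * g - (f - 1))) +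
    ((f * f - f) + (f * f - f) + f * g + f * g) +
    ((f - 1) + (f - 1) + (f - 1) + (f - 1) + Suc (Suc 0)) +
    (Suc (Suc (Suc (Suc 0))) + (f - 1) + (f - 1) + (f - 1) + (f - 1))) +
   1 + 1 + (f + f) + ((f - 1) + 1 + (g - 1)) + 2 + (f + 1 + (f - 1)) +
   (Suc (Suc 0) + (f - 1) + (f - 1) + f + f) + 1 + ((if odd n then 1 else 0) + f + f) + 1 + 1"
  (is "_ = ?N")
proof -
  define W1 where "W1 = V1 n \<union> V4 n"
  define W2 where "W2 = V10 n \<union> V11 n \<union> V12 n \<union> V14 n"
  have disj: "A \<inter> B = {}" if "A \<subseteq> S" "B \<subseteq> T" "S \<inter> T = {}" for A B S T :: "nat list set"
    using that by blast
  note sh = shapes_small shapes_W1[folded W1_def] shapes_W2[folded W2_def] shapes_V8 shapes_Vbar2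
  have "relations n = W1 \<union> W2 \<union> V2 \<union> V3 \<union> V5 n \<union> V6 n \<union> V7 \<union> V9 n \<union> V13 n \<union> Vbar0 \<union> Vbar1 n \<union>
      V8 n \<union> Vbar2 n"
    unfolding relations_def W1_def W2_def by blast
  moreover have "has_card (W1 \<union> W2 \<union> V2 \<union> V3 \<union> V5 n \<union> V6 n \<union> V7 \<union> V9 n \<union> V13 n \<union> Vbar0 \<union> Vbar1 n \<union>
      V8 n \<union> Vbar2 n) ?N"
    by (intro has_card_Un card_W1[folded W1_def] card_W2[folded W2_def] card_singles card_V5
        card_V6 card_V9 card_V13 card_Vbar1 shapes_disjoint;
        (simp only: shapes_Un Int_Un_distrib2 Un_empty)?;
        (intro conjI)?; (rule disj, rule sh, rule sh, use fg in auto))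
  ultimately show ?thesis by (simp add: has_card_def)
qed

lemma card_relations_real:
  defines "F \<equiv> real f" and "G \<equiv> real g"
  shows "real (card (relations n)) =
    F * (F - 1) / 2 + 4 * (F * F) + 5 * (F * G) + 16 * F + G + 6 + (if odd n then 1 else 0)"
proof -
  have "f \<le> f * f" by (cases f) auto
  then have 1: "real (f * f - f) = F * F - F" by (simp add: F_def of_nat_diff)
  have 2: "real (f - 1) = F - 1" "real (g - 1) = G - 1"
    using fg by (auto simp: F_def G_def of_nat_diff)
  have "f * 1 \<le> f * g" using fg(4) by (rule mult_le_mono2)
  then have "f - 1 \<le> f * g" by linarith
  then have 3: "real (f * g - (f - 1)) = F * G - (F - 1)"
    using 2(1) by (simp only: of_nat_diff of_nat_mult F_def G_def)
  have 4: "real (f * (f - 1) div 2) = F * (F - 1) / 2"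
    by (cases f) (auto simp: real_of_nat_div F_def algebra_simps)
  show ?thesis
    unfolding card_relations_nat of_nat_add 1 2 3 4 of_nat_mult of_nat_Suc of_nat_1 of_nat_0
      F_def[symmetric] G_def[symmetric]
    by (simp add: algebra_simps)
qed

end

theorem card_relations:
  assumes "4 \<le> n"
  shows "real (card (relations n)) =
    19 / 8 * real n ^ 2 - (1 + 9 * (-1) ^ n) / 8 * real n + (13 - 29 * (-1) ^ n) / 16"
proof (cases "even n")
  case True
  then obtain g where "n = g + g + 2" "1 \<le> g"
    using assms by (elim evenE) (intro that[of "n div 2 - 1"], auto)
  then show ?thesis using True
    by (subst card_relations_real[of n g g]) (auto simp: field_simps power2_eq_square)
next
  case False
  then obtain g where "n = (g + 1) + g + 2" "1 \<le> g"
    using assms by (elim oddE) (intro that[of "n div 2 - 1"], auto)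
  then show ?thesis using False
    by (subst card_relations_real[of n "g + 1" g]) (auto simp: field_simps power2_eq_square)
qed

lemma card_alphabet:
  assumes "4 \<le> n" shows "card (alphabet n) = 2 + 3 * mN n"
proof -
  have "FN n - 1 = mN n" by presburger
  then have "has_card (LE ` {2..FN n}) (mN n)"
    by (intro has_card_image) (auto simp: has_card_def inj_on_def)
  moreover have "has_card (LXi ` {1..mN n}) (mN n)" "has_card (LYi ` {1..mN n}) (mN n)"
    by (intro has_card_image; auto simp: has_card_def inj_on_def)+
  ultimately have "has_card (alphabet n) (Suc (Suc 0) + mN n + mN n + mN n)"
    unfolding alphabet_def by (intro has_card_Un has_card_insert has_card_empty) auto
  then show ?thesis by (simp add: has_card_def)
qed

theorem theorem4p2:
  fixes n :: nat
  assumes "n \<ge> 4"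
  shows "defined_by_presentation (MDI n) (alphabet n) (relations n) \<and>
         card (alphabet n) = 2 + 3 * ((n - 1) div 2) \<and>
         real (card (relations n)) =
           19 / 8 * real n ^ 2 - (1 + 9 * (-1) ^ n) / 8 * real n + (13 - 29 * (-1) ^ n) / 16"
  using MDI_presentation[OF assms] card_alphabet[OF assms] card_relations[OF assms] by blast

end
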